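(* Let $\mathcal H$ be a real Hilbert space, $\gamma>0$, $\beta\ge 0$. Let $f\in C^1(\mathcal H)$ be real-valued with $\nabla f$ Lipschitz continuous on bounded subsets of $\mathcal H$ and $\inf_{\mathcal H}f>-\infty$. Let $\phi:\mathcal H\to\mathbb R\cup\{+\infty\}$ be proper, lower semicontinuous and convex with $\phi(0)=\min\phi=0$, and let $r>0$ be such that $r\mathbb B\subseteq\partial\phi(0)$. Then for every $(x_0,v_0)\in\mathcal H\times\mathrm{Dom}(\partial\phi)$ the Cauchy problem $$\ddot x(t)+\gamma\dot x(t)+\partial\phi(\dot x(t))+\nabla f(x(t)+\beta\dot x(t))\ni 0,\quad t\ge0,\qquad x(0)=x_0,\ \dot x(0)=v_0,$$ has a unique global strong solution $(x,v)$, $v=\dot x$. More precisely, on every bounded interval $[0,T]$ one has $x\in C^1([0,T];\mathcal H)$, $v=\dot x\in W^{1,\infty}(0,T;\mathcal H)$, and the equation admits a selection $\xi\in L^\infty(0,T;\mathcal H)$ with $\xi(t)\in\partial\phi(v(t))$ and $\dot v(t)+\gamma v(t)+\xi(t)+\nabla f(x(t)+\beta v(t))=0$ for almost every $t$. For this selection, with $y=x+\beta v$ and $$\mathcal E_\beta(t)=f(y(t))-\inf_{\mathcal H}f+\frac{1+\beta\gamma}{2}\|v(t)\|^2+\beta\phi(v(t)),$$ one has $$\dot{\mathcal E}_\beta(t)+\beta\|\dot v(t)\|^2+\gamma\|v(t)\|^2+\langle\xi(t),v(t)\rangle=0\quad\text{for a.e. }t>0.$$ Consequently, for every $T>0$,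 $$\mathcal E_\beta(T)+\beta\int_0^T\|\dot v\|^2dt+\gamma\int_0^T\|v\|^2dt+r\int_0^T\|v\|dt\le\mathcal E_\beta(0),$$ and $\int_0^{+\infty}\|v(t)\|\,dt\le \mathcal E_\beta(0)/r$. When $\beta>0$, also $\dot v\in L^2(0,+\infty;\mathcal H)$. If $\phi$ is finite and continuous on $\mathcal H$, all these conclusions hold for every $v_0\in\mathcal H$.
   Context: $\mathbb B$ is the closed unit ball of $\mathcal H$; $\partial\phi$ is the convex subdifferential and $\mathrm{Dom}(\partial\phi)=\{v:\partial\phi(v)\neq\varnothing\}$. A strong solution on $[0,T]$ is a pair $(x,v)$ with $x,v\in W^{1,2}(0,T;\mathcal H)$, $v=\dot x$ a.e., $x(0)=x_0$, $v(0)=v_0$, for which there exists $\xi\in L^2(0,T;\mathcal H)$ with $\xi(t)\in\partial\phi(v(t))$ and $\dot v(t)+\gamma v(t)+\xi(t)+\nabla f(x(t)+\beta v(t))=0$ for a.e. $t\in(0,T)$. A global strong solution is one whose restriction to every $[0,T]$, $T>0$, is a strong solution. When $\beta=0$, the term $\beta\phi(v(t))$ in $\mathcal E_\beta$ is omitted (not interpreted as $0\cdot(+\infty)$). *)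

theory Defs
  imports "HOL-Analysis.Analysis"
begin

section \<open>Convex analysis for extended-real-valued functions\<close>

definition proper :: "('a \<Rightarrow> ereal) \<Rightarrow> bool" where
  "proper \<phi> \<longleftrightarrow> (\<forall>x. \<phi> x \<noteq> -\<infinity>) \<and> (\<exists>x. \<phi> x \<noteq> \<infinity>)"

definition lsc :: "('a::topological_space \<Rightarrow> ereal) \<Rightarrow> bool" where
  "lsc \<phi> \<longleftrightarrow> (\<forall>x. \<phi> x \<le> Liminf (at x) \<phi>)"

definition ereal_convex :: "('a::real_vector \<Rightarrow> ereal) \<Rightarrow> bool" where
  "ereal_convex \<phi> \<longleftrightarrow> (\<forall>x y u. 0 < u \<and> u < 1 \<longrightarrow>
     \<phi> ((1 - u) *\<^sub>R x + u *\<^sub>R y) \<le> ereal (1 - u) * \<phi> x + ereal u * \<phi> y)"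

text \<open>For proper \<open>\<phi>\<close> the set is empty at every point where \<open>\<phi>\<close> is infinite.\<close>

definition subdiff :: "('a::real_inner \<Rightarrow> ereal) \<Rightarrow> 'a \<Rightarrow> 'a set" where
  "subdiff \<phi> v = {\<xi>. \<forall>w. \<phi> v + ereal (\<xi> \<bullet> (w - v)) \<le> \<phi> w}"

definition Dom_subdiff :: "('a::real_inner \<Rightarrow> ereal) \<Rightarrow> 'a set" where
  "Dom_subdiff \<phi> = {v. subdiff \<phi> v \<noteq> {}}"

section \<open>Lebesgue--Bochner and Sobolev spaces of functions of one real variable\<close>

text \<open>The Hilbert space is not assumed separable, so the library's Bochner integral (which needs a
  second countable codomain) does not apply. Measurability is strong (Bochner) measurability:
  almost everywhere limit of a sequence of simple functions. The spaces below are sets of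
  representatives, not of equivalence classes.\<close>

definition strongly_measurable_on :: "real set \<Rightarrow> (real \<Rightarrow> 'a::topological_space) \<Rightarrow> bool" where
  "strongly_measurable_on I u \<longleftrightarrow>
     (\<exists>s. (\<forall>n::nat. simple_function (lebesgue_on I) (s n)) \<and>
          (AE t in lebesgue_on I. (\<lambda>n. s n t) \<longlonglongrightarrow> u t))"

definition L2 :: "real set \<Rightarrow> (real \<Rightarrow> 'a::real_normed_vector) set" where
  "L2 I = {u. strongly_measurable_on I u \<and> integrable (lebesgue_on I) (\<lambda>t. (norm (u t))\<^sup>2)}"

definition Linf :: "real set \<Rightarrow> (real \<Rightarrow> 'a::real_normed_vector) set" where
  "Linf I = {u. strongly_measurable_on I u \<and> (\<exists>C. AE t in lebesgue_on I. norm (u t) \<le> C)}"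

definition test_function :: "real set \<Rightarrow> (real \<Rightarrow> real) \<Rightarrow> (real \<Rightarrow> real) \<Rightarrow> bool" where
  "test_function I \<psi> \<psi>' \<longleftrightarrow>
     (\<forall>t. (\<psi> has_real_derivative \<psi>' t) (at t)) \<and> continuous_on UNIV \<psi>' \<and>
     (\<exists>K. compact K \<and> K \<subseteq> I \<and> (\<forall>t. t \<notin> K \<longrightarrow> \<psi> t = 0))"

text \<open>Distributional derivative, tested against continuously differentiable functions with compact
  support in the open interval \<open>I\<close>. The vector-valued integrals are gauge integrals; for the
  Bochner integrable integrands that occur here they coincide with the Bochner integral.\<close>

definition weak_derivative ::
    "real set \<Rightarrow> (real \<Rightarrow> 'a::banach) \<Rightarrow> (real \<Rightarrow> 'a) \<Rightarrow> bool" where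
  "weak_derivative I u g \<longleftrightarrow>
     (\<forall>\<psi> \<psi>'. test_function I \<psi> \<psi>' \<longrightarrow>
        (\<exists>J. ((\<lambda>t. \<psi>' t *\<^sub>R u t) has_integral J) I \<and>
             ((\<lambda>t. \<psi> t *\<^sub>R g t) has_integral (- J)) I))"

definition W12 :: "real set \<Rightarrow> (real \<Rightarrow> 'a::banach) set" where
  "W12 I = {u \<in> L2 I. \<exists>g \<in> L2 I. weak_derivative I u g}"

definition W1inf :: "real set \<Rightarrow> (real \<Rightarrow> 'a::banach) set" where
  "W1inf I = {u \<in> Linf I. \<exists>g \<in> Linf I. weak_derivative I u g}"

section \<open>The differential inclusion\<close>

text \<open>\<open>df\<close> is the gradient of \<open>f\<close>, \<open>w\<close> is the derivative of \<open>v\<close>, and \<open>\<xi>\<close> is the selection.\<close>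

definition inclusion_ae ::
    "real \<Rightarrow> real \<Rightarrow> ('a::real_inner \<Rightarrow> ereal) \<Rightarrow> ('a \<Rightarrow> 'a) \<Rightarrow> real \<Rightarrow>
     (real \<Rightarrow> 'a) \<Rightarrow> (real \<Rightarrow> 'a) \<Rightarrow> (real \<Rightarrow> 'a) \<Rightarrow> (real \<Rightarrow> 'a) \<Rightarrow> bool" where
  "inclusion_ae \<gamma> \<beta> \<phi> df T x v w \<xi> \<longleftrightarrow>
     (AE t in lebesgue_on {0<..<T}. \<xi> t \<in> subdiff \<phi> (v t) \<and>
        w t + \<gamma> *\<^sub>R v t + \<xi> t + df (x t + \<beta> *\<^sub>R v t) = 0)"

text \<open>Elements of \<open>W12\<close> are represented by their continuous representatives on \<open>[0, T]\<close>, which gives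
  a meaning to the initial conditions.\<close>

definition strong_solution ::
    "real \<Rightarrow> real \<Rightarrow> ('a::{real_inner,banach} \<Rightarrow> ereal) \<Rightarrow> ('a \<Rightarrow> 'a) \<Rightarrow> 'a \<Rightarrow> 'a \<Rightarrow> real \<Rightarrow>
     (real \<Rightarrow> 'a) \<Rightarrow> (real \<Rightarrow> 'a) \<Rightarrow> bool" where
  "strong_solution \<gamma> \<beta> \<phi> df x0 v0 T x v \<longleftrightarrow>
     continuous_on {0..T} x \<and> continuous_on {0..T} v \<and>
     x \<in> W12 {0<..<T} \<and> v \<in> W12 {0<..<T} \<and>
     weak_derivative {0<..<T} x v \<and> x 0 = x0 \<and> v 0 = v0 \<and>
     (\<exists>w \<in> L2 {0<..<T}. \<exists>\<xi> \<in> L2 {0<..<T}.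
        weak_derivative {0<..<T} v w \<and> inclusion_ae \<gamma> \<beta> \<phi> df T x v w \<xi>)"

text \<open>Only the values on \<open>[0, \<infinity>)\<close> are relevant.\<close>

definition global_strong_solution ::
    "real \<Rightarrow> real \<Rightarrow> ('a::{real_inner,banach} \<Rightarrow> ereal) \<Rightarrow> ('a \<Rightarrow> 'a) \<Rightarrow> 'a \<Rightarrow> 'a \<Rightarrow>
     (real \<Rightarrow> 'a) \<Rightarrow> (real \<Rightarrow> 'a) \<Rightarrow> bool" where
  "global_strong_solution \<gamma> \<beta> \<phi> df x0 v0 x v \<longleftrightarrow>
     (\<forall>T>0. strong_solution \<gamma> \<beta> \<phi> df x0 v0 T x v)"

definition energy ::
    "real \<Rightarrow> real \<Rightarrow> ('a::real_inner \<Rightarrow> ereal) \<Rightarrow> ('a \<Rightarrow> real) \<Rightarrow>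
     (real \<Rightarrow> 'a) \<Rightarrow> (real \<Rightarrow> 'a) \<Rightarrow> real \<Rightarrow> ereal" where
  "energy \<gamma> \<beta> \<phi> f x v t =
     ereal (f (x t + \<beta> *\<^sub>R v t) - (INF z. f z) + (1 + \<beta> * \<gamma>) / 2 * (norm (v t))\<^sup>2) +
     (if \<beta> = 0 then 0 else ereal \<beta> * \<phi> (v t))"

end

(* As a first-order equation for U = (x, v) in H x H the problem reads
   U' + A U + F U = 0 with A (x, v) = {0} x subdiff \<phi> v maximal monotone and F locally Lipschitz.
   After truncating df outside a ball, F is L-Lipschitz, and the Yosida approximations converge to a
   flow U for which e^{-L t} |(A + F) (U t)|_min is nonincreasing, hence continuous off a countable
   set N. At a point t outside N, the minimal section w t of -(A + F) (U t) is continuous and U is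
   differentiable with derivative w t, so every almost-everywhere statement holds off a countable
   set and no differentiation theorem for Lipschitz curves is needed; weak compactness is replaced
   by pairing with resolvents. Off N the selection is continuous as well, which makes \<phi> (v t)
   differentiable there and gives the energy identity. The energy bounds v, hence x + \<beta> v on
   bounded time intervals, so the truncation is invisible if the ball is large. Uniqueness is a
   Gronwall argument for |U - U'|^2, with the weak derivatives integrated by a du Bois-Reymond
   lemma. *)

theory Submission
  imports Defs
begin

section \<open>Fundamental theorem of calculus and Picard's theorem on the half-line\<close>

text \<open>Norm convergence is always reached in the same way: a family tends to \<open>m\<close>
  once its pairings with \<open>m\<close> are asymptotically at least \<open>|m|^2\<close> and its
  norms asymptotically at most \<open>|m|\<close>. Monotonicity supplies the pairing bound, and a
  growth estimate with a sharp constant supplies the norm bound; this is why constants such as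
  \<open>|minvel x|\<close> must not be enlarged on the way. The decreasing weighted norm of the
  minimal velocity can jump, and only its jumps can spoil differentiability. The inclusion itself
  holds at every time, so dissipation inequalities are pointwise and only derivatives need
  exceptional points. The truncation argument is a bootstrap: the energy estimate is valid only
  while \<open>x + \<beta> v\<close> stays in the ball, and there it returns a strictly better
  bound. Uniqueness is needed twice, for the statement and for gluing solutions on growing
  intervals; it has to work for arbitrary strong solutions, whose derivative is known only in the
  weak sense, and therefore cannot use the regularity of the constructed one.\<close>

lemma negligible_countable:
  fixes S :: "'a::euclidean_space set"
  assumes "countable S"
  shows "negligible S"
proof -
  have "negligible (\<Union>((\<lambda>x. {x}) ` S))" using assms by (intro negligible_countable_Union) auto
  then show ?thesis by simp
qed

text \<open>The errors at the exceptional points are absorbed into the increments of the jump function \<open>\<psi>\<close>,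
  which puts mass of order \<open>2\<^sup>-\<^sup>n\<close> on the \<open>n\<close>-th exceptional point.\<close>

lemma fundamental_theorem_of_calculus_countable:
  fixes f :: "real \<Rightarrow> 'a::banach"
  assumes S: "countable S" and ab: "a \<le> b" and cont: "continuous_on {a..b} f"
    and deriv: "\<And>x. x \<in> {a<..<b} - S \<Longrightarrow> (f has_vector_derivative f' x) (at x)"
  shows "(f' has_integral (f b - f a)) {a..b}"
proof -
  \<comment> \<open>Treating the endpoints as exceptional points lets continuity alone handle
    them.\<close>
  define S' where "S' = insert a (insert b S)"
  have S': "countable S'" "S' \<noteq> {}" using S by (auto simp: S'_def)
  define g where "g x = (if x \<in> S' then 0 else f' x)" for x
  define s where "s = from_nat_into S'"
  \<comment> \<open>Counting the strict and the weak inequality gives an increment of at least 1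
    across every nondegenerate interval containing \<open>s n\<close>, also when \<open>s n\<close>
    is one of its endpoints.\<close>
  define h :: "nat \<Rightarrow> real \<Rightarrow> real" where "h n t = of_bool (s n < t) + of_bool (s n \<le> t)" for n t
  define \<psi> where "\<psi> t = (\<Sum>n. (1/2)^n * h n t)" for t
  have h02: "0 \<le> h n t" "h n t \<le> 2" for n t by (auto simp: h_def)
  have summ: "summable (\<lambda>n. (1/2)^n * h n t)" for t
  proof (rule summable_comparison_test')
    show "summable (\<lambda>n. (1/2::real)^n * 2)" by (intro summable_mult2 summable_geometric) auto
    show "norm ((1/2)^n * h n t) \<le> (1/2)^n * 2" for n
      using h02[of n t] by (auto simp: abs_mult)
  qed
  have hmono: "h n u \<le> h n v" if "u \<le> v" for n u v using that by (auto simp: h_def)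
  have \<psi>_incr: "(1/2)^n \<le> \<psi> v - \<psi> u" if "u \<le> s n" "s n \<le> v" "u < v" for n u v
  proof -
    have "\<psi> v - \<psi> u = (\<Sum>n. (1/2)^n * h n v - (1/2)^n * h n u)"
      unfolding \<psi>_def by (rule suminf_diff) (rule summ)+
    also have "\<dots> \<ge> (\<Sum>k\<in>{n}. (1/2)^k * h k v - (1/2)^k * h k u)"
      by (rule sum_le_suminf) (use hmono that in \<open>auto intro!: summable_diff summ mult_left_mono\<close>)
    moreover have "(1/2)^n * 1 \<le> (1/2)^n * (h n v - h n u)"
      using that by (intro mult_left_mono) (auto simp: h_def)
    ultimately show ?thesis by (simp add: right_diff_distrib)
  qed
  have \<psi>_mono: "\<psi> u \<le> \<psi> v" if "u \<le> v" for u v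
    unfolding \<psi>_def by (rule suminf_le) (use hmono that in \<open>auto intro!: summ mult_left_mono\<close>)
  have "(g has_integral (f b - f a)) {a..b}"
    unfolding has_integral_real
  proof (intro allI impI)
    fix e :: real assume "e > 0"
    \<comment> \<open>\<open>K\<close> dominates the total length plus the total increment of
      \<open>\<psi>\<close>; the summand 1 makes the last estimate strict.\<close>
    define K where "K = b - a + (\<psi> b - \<psi> a) + 1"
    have K: "K > 0" using ab \<psi>_mono[OF ab] by (auto simp: K_def)
    define c where "c = e / K"
    have c: "c > 0" using \<open>e > 0\<close> K by (auto simp: c_def)
    \<comment> \<open>At ordinary tags the derivative gives the first term on the right; at
      exceptional tags \<open>g x = 0\<close>, and continuity is paid for by the second. Both terms
      telescope over a division.\<close>
    have ex: "\<exists>d>0. \<forall>u v. u \<le> x \<and> x \<le> v \<and> {u..v} \<subseteq> ball x d \<and> {u..v} \<subseteq> {a..b} \<longrightarrow>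
        norm ((v - u) *\<^sub>R g x - (f v - f u)) \<le> c * (v - u) + c * (\<psi> v - \<psi> u)" if "x \<in> {a..b}" for x
    proof (cases "x \<in> S'")
      case True
      define n where "n = to_nat_on S' x"
      have sn: "s n = x" using True S' by (simp add: s_def n_def)
      have "c * (1/2)^n / 2 > 0" using c by auto
      then obtain d where d: "d > 0" "\<And>y. y \<in> {a..b} \<Longrightarrow> dist y x < d \<Longrightarrow> dist (f y) (f x) < c * (1/2)^n / 2"
        using cont \<open>x \<in> {a..b}\<close> unfolding continuous_on_iff by blast
      show ?thesis
      proof (intro exI[of _ d] conjI allI impI d)
        fix u v assume uv: "u \<le> x \<and> x \<le> v \<and> {u..v} \<subseteq> ball x d \<and> {u..v} \<subseteq> {a..b}"
        then have m: "u \<in> {u..v}" "v \<in> {u..v}" by auto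
        show "norm ((v - u) *\<^sub>R g x - (f v - f u)) \<le> c * (v - u) + c * (\<psi> v - \<psi> u)"
        proof (cases "u = v")
          case False
          then have "u < v" using uv by auto
          have "u \<in> ball x d" "v \<in> ball x d" "u \<in> {a..b}" "v \<in> {a..b}" using uv m by blast+
          then have uu: "norm (f u - f x) < c * (1/2)^n / 2" "norm (f v - f x) < c * (1/2)^n / 2"
            using d(2)[of u] d(2)[of v] by (simp_all add: dist_norm norm_minus_commute)
          have "norm (f v - f u) = norm ((f v - f x) - (f u - f x))" by simp
          also have "\<dots> \<le> norm (f v - f x) + norm (f u - f x)" by (rule norm_triangle_ineq4)
          also have "\<dots> \<le> c * (1/2)^n" using uu by simp
          also have "\<dots> \<le> c * (\<psi> v - \<psi> u)"
            using \<psi>_incr[of u n v] sn uv \<open>u < v\<close> c by (intro mult_left_mono) auto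
          finally show ?thesis using True c \<open>u < v\<close> by (simp add: g_def norm_minus_commute add_increasing)
        qed auto
      qed
    next
      case False
      then have "x \<in> {a<..<b} - S" using that by (auto simp: S'_def)
      then obtain d where d: "d > 0" "\<And>y. norm (y - x) < d \<Longrightarrow> norm (f y - f x - (y - x) *\<^sub>R f' x) \<le> c * norm (y - x)"
        using deriv[of x] c unfolding has_vector_derivative_def has_derivative_at_alt by blast
      show ?thesis
      proof (intro exI[of _ d] conjI allI impI d)
        fix u v assume uv: "u \<le> x \<and> x \<le> v \<and> {u..v} \<subseteq> ball x d \<and> {u..v} \<subseteq> {a..b}"
        then have m: "u \<in> {u..v}" "v \<in> {u..v}" by auto
        have "u \<in> ball x d" "v \<in> ball x d" using uv m by blast+
        then have uu: "norm (f u - f x - (u - x) *\<^sub>R f' x) \<le> c * (x - u)" "norm (f v - f x - (v - x) *\<^sub>R f' x) \<le> c * (v - x)"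
          using d(2)[of u] d(2)[of v] uv by (simp_all add: dist_norm norm_minus_commute)
        have "(v - u) *\<^sub>R g x - (f v - f u) = (f u - f x - (u - x) *\<^sub>R f' x) - (f v - f x - (v - x) *\<^sub>R f' x)"
          using False by (simp add: g_def algebra_simps)
        also have "norm \<dots> \<le> norm (f u - f x - (u - x) *\<^sub>R f' x) + norm (f v - f x - (v - x) *\<^sub>R f' x)"
          by (rule norm_triangle_ineq4)
        also have "\<dots> \<le> c * (v - u)" using uu by (simp add: algebra_simps)
        finally show "norm ((v - u) *\<^sub>R g x - (f v - f u)) \<le> c * (v - u) + c * (\<psi> v - \<psi> u)"
          using c \<psi>_mono[of u v] uv by (smt (verit) mult_nonneg_nonneg)
      qed
    qed
    then obtain d where d: "\<And>x. x \<in> {a..b} \<Longrightarrow> d x > 0" 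
      "\<And>x u v. x \<in> {a..b} \<Longrightarrow> u \<le> x \<and> x \<le> v \<and> {u..v} \<subseteq> ball x (d x) \<and> {u..v} \<subseteq> {a..b} \<Longrightarrow>
        norm ((v - u) *\<^sub>R g x - (f v - f u)) \<le> c * (v - u) + c * (\<psi> v - \<psi> u)"
      by metis
    define \<gamma> where "\<gamma> x = ball x (if x \<in> {a..b} then d x else 1)" for x
    have gauge: "gauge \<gamma>" using d(1) by (auto simp: \<gamma>_def gauge_def)
    have fine: "norm ((\<Sum>(x,k)\<in>p. Henstock_Kurzweil_Integration.content k *\<^sub>R g x) - (f b - f a)) < e"
      if p: "p tagged_division_of {a..b}" "\<gamma> fine p" for p
    proof -
      note * = additive_tagged_division_1[OF ab p(1), symmetric]
      have "(\<Sum>(x,k)\<in>p. Henstock_Kurzweil_Integration.content k *\<^sub>R g x) - (f b - f a)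
          = (\<Sum>(x,k)\<in>p. Henstock_Kurzweil_Integration.content k *\<^sub>R g x - (f (Sup k) - f (Inf k)))"
        by (simp add: *[of f] sum_subtractf split_def)
      also have "norm \<dots> \<le> (\<Sum>(x,k)\<in>p. c * (Sup k - Inf k) + c * (\<psi> (Sup k) - \<psi> (Inf k)))"
      proof (rule sum_norm_le, clarify)
        fix x k assume xk: "(x, k) \<in> p"
        obtain u v where k: "k = {u..v}" using tagged_division_ofD(4)[OF p(1) xk] by auto
        have xin: "x \<in> k" "k \<subseteq> {a..b}" using tagged_division_ofD(2,3)[OF p(1) xk] by auto
        then have "u \<le> v" "x \<in> {a..b}" "u \<le> x" "x \<le> v" using k by auto
        moreover have "k \<subseteq> ball x (d x)" using fineD[OF p(2) xk] \<open>x \<in> {a..b}\<close> by (simp add: \<gamma>_def)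
        ultimately have "norm ((v - u) *\<^sub>R g x - (f v - f u)) \<le> c * (v - u) + c * (\<psi> v - \<psi> u)"
          using d(2)[of x u v] xin k by blast
        then show "norm (Henstock_Kurzweil_Integration.content k *\<^sub>R g x - (f (Sup k) - f (Inf k))) \<le> c * (Sup k - Inf k) + c * (\<psi> (Sup k) - \<psi> (Inf k))"
          using k \<open>u \<le> v\<close> by simp
      qed
      also have "\<dots> = c * (b - a) + c * (\<psi> b - \<psi> a)"
        by (simp add: *[of \<psi>] *[of "\<lambda>x. x"] sum.distrib sum_distrib_left split_def)
      also have "\<dots> < c * K" using c by (simp add: K_def algebra_simps)
      also have "\<dots> = e" using K by (simp add: c_def)
      finally show ?thesis .
    qed
    show "\<exists>\<gamma>. gauge \<gamma> \<and> (\<forall>p. p tagged_division_of {a..b} \<and> \<gamma> fine p \<longrightarrow>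
        norm ((\<Sum>(x,k)\<in>p. Henstock_Kurzweil_Integration.content k *\<^sub>R g x) - (f b - f a)) < e)"
      by (intro exI[of _ \<gamma>] conjI allI impI gauge fine) (elim conjE, assumption)+
  qed
  moreover have "negligible S'" using S'(1) by (rule negligible_countable)
  ultimately show ?thesis
    by (rule has_integral_spike[where f=g, rotated 2]) (auto simp: g_def)
qed

text \<open>In the norm \<open>sup e\<^sup>-\<^sup>K\<^sup>t |u t|\<close> the Picard map is a contraction on the whole half-line at once.\<close>

lemma picard_global:
  fixes G :: "'a::banach \<Rightarrow> 'a"
  assumes lip: "M-lipschitz_on UNIV G"
  shows "\<exists>u. u 0 = y0 \<and> (\<forall>t\<ge>0. (u has_vector_derivative G (u t)) (at t within {0..}))"
proof -
  \<comment> \<open>The extra 1 keeps the exponential rate \<open>K\<close> positive even for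
    constant \<open>G\<close>.\<close>
  define M' where "M' = M + 1"
  have M: "M \<ge> 0" using lip by (rule lipschitz_on_nonneg)
  have M': "M' > 0" using M by (simp add: M'_def)
  have lipn: "norm (G x - G y) \<le> M' * norm (x - y)" for x y
    using lipschitz_onD[OF lip, of x y] by (simp add: M'_def dist_norm algebra_simps add_increasing)
  have contG: "continuous_on UNIV G" using lip by (rule lipschitz_on_continuous_on)
  \<comment> \<open>The Picard map contracts by at most \<open>M' / K\<close> in the weighted norm,
    so this choice gives the factor 1/2.\<close>
  define K where "K = 2 * M'"
  have K: "K > 0" using M' by (simp add: K_def)
  define H where "H z = (\<lambda>s. G (exp (K * s) *\<^sub>R apply_bcontfun z s))" for z :: "real \<Rightarrow>\<^sub>C 'a"
  have contH: "continuous_on A (H z)" for A z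
    unfolding H_def
    by (rule continuous_on_compose2[OF contG]) (auto intro!: continuous_intros)
  have exp_int: "((\<lambda>s. exp (K * s)) has_integral (exp (K * t) - 1) / K) {0..t}" if "t \<ge> 0" for t
  proof -
    have "((\<lambda>s. exp (K * s)) has_integral (exp (K * t) / K - exp (K * 0) / K)) {0..t}"
      using that K by (intro fundamental_theorem_of_calculus)
        (auto intro!: derivative_eq_intros simp flip: has_real_derivative_iff_has_vector_derivative)
    then show ?thesis by (simp add: diff_divide_distrib)
  qed
  \<comment> \<open>Freezing time at \<open>max 0 t\<close> extends the map by a constant to
    negative times, so that it acts on bounded continuous functions of the whole line.\<close>
  define op where "op z t = exp (- K * max 0 t) *\<^sub>R (y0 + integral {0..max 0 t} (H z))" for z t
  have cont_op: "continuous_on UNIV (op z)" for z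
  proof -
    have "continuous_on {0..} (\<lambda>t. integral {0..t} (H z))"
      unfolding continuous_on_eq_continuous_within
    proof
      fix t :: real assume "t \<in> {0..}"
      have "((\<lambda>u. integral {0..u} (H z)) has_vector_derivative H z t) (at t within {0..t+1})"
        using \<open>t \<in> {0..}\<close> by (intro integral_has_vector_derivative contH) auto
      moreover have "at t within {0..t+1} = at t within {0..}"
        by (rule at_within_nhd[of _ "{t-1<..<t+1}"]) auto
      ultimately have "((\<lambda>u. integral {0..u} (H z)) has_vector_derivative H z t) (at t within {0..})"
        by simp
      then show "continuous (at t within {0..}) (\<lambda>u. integral {0..u} (H z))"
        by (rule has_vector_derivative_continuous)
    qed
    then have "continuous_on UNIV (\<lambda>t. integral {0..max 0 t} (H z))"
      by (rule continuous_on_compose2) (auto intro!: continuous_intros)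
    then show ?thesis unfolding op_def by (intro continuous_intros)
  qed
  have H_diff: "norm (H z s - H z' s) \<le> M' * (exp (K * s) * norm (z - z'))" for z z' s
  proof -
    have "norm (H z s - H z' s) \<le> M' * norm (exp (K * s) *\<^sub>R z s - exp (K * s) *\<^sub>R z' s)"
      unfolding H_def by (rule lipn)
    also have "exp (K * s) *\<^sub>R z s - exp (K * s) *\<^sub>R z' s = exp (K * s) *\<^sub>R (z - z') s"
      by (simp add: algebra_simps)
    also have "norm \<dots> \<le> exp (K * s) * norm (z - z')"
      using norm_bounded[of "z - z'" s] by simp
    finally show ?thesis using M' by (simp add: mult_left_mono)
  qed
  have op_diff: "norm (op z t - op z' t) \<le> 1/2 * norm (z - z')" for z z' t
  proof -
    define \<tau> where "\<tau> = max 0 t"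
    have \<tau>: "\<tau> \<ge> 0" by (simp add: \<tau>_def)
    have int: "H z integrable_on {0..\<tau>}" for z by (intro integrable_continuous_real contH)
    have "op z t - op z' t = exp (- K * \<tau>) *\<^sub>R (integral {0..\<tau>} (H z) - integral {0..\<tau>} (H z'))"
      by (simp add: op_def \<tau>_def algebra_simps)
    also have "integral {0..\<tau>} (H z) - integral {0..\<tau>} (H z') = integral {0..\<tau>} (\<lambda>s. H z s - H z' s)"
      using int by (simp add: integral_diff)
    finally have "norm (op z t - op z' t) = exp (- K * \<tau>) * norm (integral {0..\<tau>} (\<lambda>s. H z s - H z' s))"
      by simp
    also have "norm (integral {0..\<tau>} (\<lambda>s. H z s - H z' s)) \<le> (exp (K * \<tau>) - 1) / K * (M' * norm (z - z'))"
    proof -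
      have "((\<lambda>s. M' * (exp (K * s) * norm (z - z'))) has_integral (M' * norm (z - z')) * ((exp (K * \<tau>) - 1) / K)) {0..\<tau>}"
        using has_integral_mult_right[OF exp_int[OF \<tau>], of "M' * norm (z - z')"] by (simp add: mult_ac)
      then have "norm (integral {0..\<tau>} (\<lambda>s. H z s - H z' s)) \<le> integral {0..\<tau>} (\<lambda>s. M' * (exp (K * s) * norm (z - z')))"
        by (intro integral_norm_bound_integral integrable_diff int H_diff) (auto simp: integrable_on_def)
      also have "\<dots> = (M' * norm (z - z')) * ((exp (K * \<tau>) - 1) / K)"
        by (rule integral_unique) fact
      finally show ?thesis by (simp add: mult_ac)
    qed
    also have "exp (- K * \<tau>) * ((exp (K * \<tau>) - 1) / K * (M' * norm (z - z')))
        = (1 - exp (- K * \<tau>)) * (1/2 * norm (z - z'))"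
      using M' by (simp add: K_def field_simps exp_minus)
    also have "\<dots> \<le> 1 * (1/2 * norm (z - z'))" by (intro mult_right_mono) auto
    finally show ?thesis by simp
  qed
  \<comment> \<open>Only the image of the zero function is bounded directly, through
    \<open>K * \<tau> * exp (- K * \<tau>) \<le> 1\<close>; the contraction estimate then bounds
    every \<open>op z\<close>.\<close>
  have op0: "norm (op 0 t) \<le> norm y0 + norm (G 0) / K" for t
  proof -
    define \<tau> where "\<tau> = max 0 t"
    have \<tau>: "\<tau> \<ge> 0" by (simp add: \<tau>_def)
    have "op 0 t = exp (- K * \<tau>) *\<^sub>R (y0 + \<tau> *\<^sub>R G 0)"
      using \<tau> by (simp add: op_def H_def \<tau>_def[symmetric])
    also have "norm \<dots> \<le> exp (- K * \<tau>) * (norm y0 + \<tau> * norm (G 0))"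
      using norm_triangle_ineq[of y0 "\<tau> *\<^sub>R G 0"] \<tau> by simp
    also have "\<dots> = exp (- K * \<tau>) * norm y0 + (exp (- K * \<tau>) * (K * \<tau>)) * (norm (G 0) / K)"
      using K by (simp add: field_simps)
    also have "\<dots> \<le> 1 * norm y0 + 1 * (norm (G 0) / K)"
    proof (intro add_mono mult_right_mono)
      show "exp (- K * \<tau>) * (K * \<tau>) \<le> 1"
        using exp_ge_add_one_self[of "K * \<tau>"] by (simp add: exp_minus field_simps del: exp_ge_add_one_self)
    qed (use K \<tau> in auto)
    finally show ?thesis by simp
  qed
  have op_bcont: "op z \<in> bcontfun" for z
  proof (rule bcontfun_normI[OF cont_op])
    show "norm (op z t) \<le> norm y0 + norm (G 0) / K + 1/2 * norm z" for t
      using op_diff[of z t 0] op0[of t] norm_triangle_sub[of "op z t" "op 0 t"] by simp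
  qed
  define \<Psi> where "\<Psi> z = Bcontfun (op z)" for z
  have app: "apply_bcontfun (\<Psi> z) = op z" for z
    unfolding \<Psi>_def using op_bcont by (rule Bcontfun_inverse)
  have "\<exists>!z. \<Psi> z = z"
  proof (rule banach_fix_type[of "1/2"])
    show "\<forall>z z'. dist (\<Psi> z) (\<Psi> z') \<le> 1/2 * dist z z'"
    proof (intro allI dist_bound)
      show "dist (\<Psi> z t) (\<Psi> z' t) \<le> 1/2 * dist z z'" for z z' t
        using op_diff[of z t z'] by (simp add: app dist_norm)
    qed
  qed auto
  then obtain z where z: "\<Psi> z = z" by blast
  define u where "u t = exp (K * t) *\<^sub>R z t" for t
  have u_eq: "u t = y0 + integral {0..t} (\<lambda>s. G (u s))" if "t \<ge> 0" for t
  proof -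
    have "z t = op z t" using app[of z] z by simp
    then show ?thesis using that by (simp add: u_def op_def H_def exp_minus)
  qed
  have contGu: "continuous_on A (\<lambda>s. G (u s))" for A
    using contH[of A z] by (simp add: H_def u_def)
  show ?thesis
  proof (intro exI conjI allI impI)
    show "u 0 = y0" using u_eq[of 0] by simp
    fix t :: real assume t: "t \<ge> 0"
    have "((\<lambda>t. y0 + integral {0..t} (\<lambda>s. G (u s))) has_vector_derivative G (u t)) (at t within {0..t+1})"
      using t integral_has_vector_derivative[OF contGu, of t 0 "t+1"]
      by (auto intro!: derivative_eq_intros)
    moreover have "at t within {0..t+1} = at t within {0..}"
      by (rule at_within_nhd[of _ "{t-1<..<t+1}"]) auto
    ultimately have "((\<lambda>t. y0 + integral {0..t} (\<lambda>s. G (u s))) has_vector_derivative G (u t)) (at t within {0..})"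
      by simp
    then show "(u has_vector_derivative G (u t)) (at t within {0..})"
      by (rule has_vector_derivative_transform[rotated 2]) (use t u_eq in auto)
  qed
qed

section \<open>Maximal monotone operators\<close>

text \<open>Expanding \<open>|a - a0|^2\<close> leaves
  \<open>|a|^2 - 2 (a \<bullet> a0) + |a0|^2\<close>, whose upper limit is at most 0. This is the
  Radon-Riesz property, with weak convergence replaced by pairing with the limit alone.\<close>

lemma tendsto_of_inner_and_norm:
  fixes a :: "'i \<Rightarrow> 'a::real_inner"
  assumes "\<And>e. e > 0 \<Longrightarrow> \<forall>\<^sub>F i in F. (norm a0)\<^sup>2 - e \<le> a i \<bullet> a0"
    and "\<And>e. e > 0 \<Longrightarrow> \<forall>\<^sub>F i in F. norm (a i) \<le> norm a0 + e"
  shows "(a \<longlongrightarrow> a0) F"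
proof (rule tendstoI)
  fix e :: real assume "e > 0"
  \<comment> \<open>With \<open>d \<le> 1\<close> the expansion is at most
    \<open>d * (2 * norm a0 + d + 2)\<close>, which explains the denominator.\<close>
  define d where "d = min 1 (e\<^sup>2 / (2 * norm a0 + 4))"
  have pos: "2 * norm a0 + 4 > 0" using norm_ge_zero[of a0] by linarith
  have "d \<le> e\<^sup>2 / (2 * norm a0 + 4)" by (simp add: d_def)
  then have d: "d * (2 * norm a0 + 4) \<le> e\<^sup>2" "d > 0" "d \<le> 1"
    unfolding pos_le_divide_eq[OF pos] using \<open>e > 0\<close> pos by (auto simp: d_def)
  show "\<forall>\<^sub>F i in F. dist (a i) a0 < e"
    using assms(1)[OF d(2)] assms(2)[OF d(2)]
  proof eventually_elim
    case (elim i)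
    have "(norm (a i - a0))\<^sup>2 = (norm (a i))\<^sup>2 - 2 * (a i \<bullet> a0) + (norm a0)\<^sup>2"
      by (simp add: power2_norm_eq_inner inner_diff algebra_simps inner_commute)
    also have "\<dots> \<le> (norm a0 + d)\<^sup>2 - 2 * ((norm a0)\<^sup>2 - d) + (norm a0)\<^sup>2"
      using elim by (intro add_mono diff_mono power_mono mult_left_mono) auto
    also have "\<dots> = d * (2 * norm a0 + d + 2)" by (simp add: power2_eq_square algebra_simps)
    also have "\<dots> < d * (2 * norm a0 + 4)" using d by (intro mult_strict_left_mono) auto
    finally have "(norm (a i - a0))\<^sup>2 < e\<^sup>2" using d by linarith
    then show ?case using \<open>e > 0\<close> by (simp add: dist_norm power2_less_imp_less)
  qed
qed

text \<open>Maximality enters through solvability of the resolvent equation for all positive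
  parameters, which is Minty's characterisation.\<close>

locale maximal_monotone =
  fixes A :: "'a::{real_inner,banach} \<Rightarrow> 'a set"
  assumes mono: "\<zeta> \<in> A x \<Longrightarrow> \<zeta>' \<in> A x' \<Longrightarrow> 0 \<le> (\<zeta> - \<zeta>') \<bullet> (x - x')"
    and ex_resolvent: "0 < \<mu> \<Longrightarrow> \<exists>p. (x - p) /\<^sub>R \<mu> \<in> A p"
begin

text \<open>The resolvent of \<open>A\<close>; \<open>Y\<close> below is the Yosida approximation.
  For positive \<open>\<mu>\<close> monotonicity makes the chosen point unique.\<close>

definition J :: "real \<Rightarrow> 'a \<Rightarrow> 'a" where
  "J \<mu> x = (SOME p. (x - p) /\<^sub>R \<mu> \<in> A p)"

definition Y :: "real \<Rightarrow> 'a \<Rightarrow> 'a" where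
  "Y \<mu> x = (x - J \<mu> x) /\<^sub>R \<mu>"

lemma Y_in: "0 < \<mu> \<Longrightarrow> Y \<mu> x \<in> A (J \<mu> x)"
  unfolding Y_def J_def by (rule someI_ex) (rule ex_resolvent)

lemma J_eq: "0 < \<mu> \<Longrightarrow> J \<mu> x = x - \<mu> *\<^sub>R Y \<mu> x"
  by (simp add: Y_def)

text \<open>Two solutions of one resolvent equation are tested against each other, which gives
  \<open>- \<mu> |difference|^2 \<ge> 0\<close>. The lemma locates a point at which
  \<open>Y \<mu>\<close> takes a prescribed value of \<open>A\<close>.\<close>

lemma Y_resolvent:
  assumes "0 < \<mu>" "\<zeta> \<in> A p"
  shows "Y \<mu> (p + \<mu> *\<^sub>R \<zeta>) = \<zeta>"
proof -
  let ?x = "p + \<mu> *\<^sub>R \<zeta>"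
  have "0 \<le> (Y \<mu> ?x - \<zeta>) \<bullet> (J \<mu> ?x - p)" using assms Y_in mono by blast
  also have "\<dots> = - \<mu> * (norm (Y \<mu> ?x - \<zeta>))\<^sup>2"
    using assms by (simp add: J_eq power2_norm_eq_inner inner_diff algebra_simps)
  finally show ?thesis using assms(1)
    by (smt (verit, ccfv_SIG) eq_iff_diff_eq_0 mult_minus_left mult_pos_pos norm_eq_zero zero_less_power2)
qed

text \<open>Monotonicity at the resolvent points, combined with \<open>J = x - \<mu> Y\<close>,
  becomes cocoercivity; the Lipschitz constant \<open>1 / \<mu>\<close> follows from it.\<close>

lemma Y_monotone:
  assumes "0 < \<mu>"
  shows "\<mu> * (norm (Y \<mu> x - Y \<mu> y))\<^sup>2 \<le> (Y \<mu> x - Y \<mu> y) \<bullet> (x - y)"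
proof -
  have "0 \<le> (Y \<mu> x - Y \<mu> y) \<bullet> (J \<mu> x - J \<mu> y)" using assms Y_in mono by blast
  also have "\<dots> = (Y \<mu> x - Y \<mu> y) \<bullet> (x - y) - \<mu> * (norm (Y \<mu> x - Y \<mu> y))\<^sup>2"
    using assms by (simp add: J_eq power2_norm_eq_inner inner_diff algebra_simps)
  finally show ?thesis by simp
qed

lemma Y_lipschitz:
  assumes "0 < \<mu>"
  shows "norm (Y \<mu> x - Y \<mu> y) \<le> norm (x - y) / \<mu>"
proof -
  have "\<mu> * (norm (Y \<mu> x - Y \<mu> y))\<^sup>2 \<le> norm (Y \<mu> x - Y \<mu> y) * norm (x - y)"
    using Y_monotone[OF assms, of x y] norm_cauchy_schwarz[of "Y \<mu> x - Y \<mu> y" "x - y"] by linarith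
  then have "\<mu> * norm (Y \<mu> x - Y \<mu> y) \<le> norm (x - y)"
    by (cases "Y \<mu> x = Y \<mu> y") (simp_all add: power2_eq_square mult.left_commute[of \<mu>])
  then show ?thesis using assms by (simp add: field_simps)
qed

text \<open>Minty's argument: in the limit the pair \<open>(x, \<zeta>)\<close> is monotone against
  the resolvent pair of \<open>x + \<zeta>\<close>, and their pairing equals
  \<open>- |y - \<zeta>|^2\<close>, so the two pairs coincide.\<close>

lemma closed_graph:
  assumes "F \<noteq> bot" "(X \<longlongrightarrow> x) F" "(Z \<longlongrightarrow> \<zeta>) F" "\<forall>\<^sub>F i in F. Z i \<in> A (X i)"
  shows "\<zeta> \<in> A x"
proof -
  define y where "y = Y 1 (x + \<zeta>)"
  have y: "y \<in> A (x + \<zeta> - y)" using Y_in[of 1 "x + \<zeta>"] by (simp add: J_eq y_def)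
  have "((\<lambda>i. (y - Z i) \<bullet> (x + \<zeta> - y - X i)) \<longlongrightarrow> (y - \<zeta>) \<bullet> (x + \<zeta> - y - x)) F"
    by (intro tendsto_intros assms)
  moreover have "\<forall>\<^sub>F i in F. 0 \<le> (y - Z i) \<bullet> (x + \<zeta> - y - X i)"
    using assms(4) by eventually_elim (use y mono in blast)
  ultimately have "0 \<le> (y - \<zeta>) \<bullet> (x + \<zeta> - y - x)"
    using assms(1) by (metis tendsto_lowerbound)
  also have "\<dots> = - (norm (y - \<zeta>))\<^sup>2"
    by (simp add: power2_norm_eq_inner inner_diff algebra_simps)
  finally have "y = \<zeta>" by simp
  then show ?thesis using y by simp
qed

text \<open>The Yosida approximation of the shifted operator \<open>A + c\<close> at \<open>x\<close>. Pairing with it replaces weak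
  compactness in the demiclosedness arguments.\<close>

definition shY :: "real \<Rightarrow> 'a \<Rightarrow> 'a \<Rightarrow> 'a" where
  "shY \<mu> x c = Y \<mu> (x - \<mu> *\<^sub>R c) + c"

lemma shY_in: "0 < \<mu> \<Longrightarrow> shY \<mu> x c - c \<in> A (x - \<mu> *\<^sub>R shY \<mu> x c)"
  using Y_in[of \<mu> "x - \<mu> *\<^sub>R c"] by (simp add: shY_def J_eq algebra_simps)

text \<open>Monotonicity between the resolvent pair of the shifted operator and the pairs
  \<open>(X i, a i - C i)\<close> reads \<open>\<mu> |s|^2 \<le> \<mu> (a i \<bullet> s)\<close> up
  to errors that vanish because \<open>a\<close> is bounded. No limit of \<open>a\<close> itself is
  involved.\<close>

lemma shY_inner_lower:
  assumes "(X \<longlongrightarrow> x) F" "(C \<longlongrightarrow> c) F" "\<forall>\<^sub>F i in F. a i - C i \<in> A (X i)"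
    "\<forall>\<^sub>F i in F. norm (a i) \<le> M" "0 < \<mu>" "0 < e"
  shows "\<forall>\<^sub>F i in F. (norm (shY \<mu> x c))\<^sup>2 - e \<le> a i \<bullet> shY \<mu> x c"
proof -
  define s where "s = shY \<mu> x c"
  define p where "p = x - \<mu> *\<^sub>R s"
  have sp: "s - c \<in> A p" using shY_in[OF assms(5)] by (simp add: s_def p_def)
  \<comment> \<open>This majorant collects both error terms; it is pushed below
    \<open>\<mu> * e\<close> because the final inequality is divided by
    \<open>\<mu>\<close>.\<close>
  have "((\<lambda>i. (norm (s - c) + M + norm (C i)) * norm (x - X i) + \<mu> * norm (C i - c) * norm s)
      \<longlongrightarrow> (norm (s - c) + M + norm c) * norm (x - x) + \<mu> * norm (c - c) * norm s) F"
    by (intro tendsto_intros assms)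
  then have "\<forall>\<^sub>F i in F. (norm (s - c) + M + norm (C i)) * norm (x - X i) + \<mu> * norm (C i - c) * norm s < \<mu> * e"
    using assms(5,6) by (intro order_tendstoD) auto
  then show ?thesis using assms(3,4) unfolding s_def[symmetric]
  proof eventually_elim
    case (elim i)
    have "0 \<le> (s - c - (a i - C i)) \<bullet> (p - X i)" using elim sp mono by blast
    also have "p - X i = (x - X i) - \<mu> *\<^sub>R s" by (simp add: p_def)
    also have "(s - c - (a i - C i)) \<bullet> ((x - X i) - \<mu> *\<^sub>R s)
        = (s - c - (a i - C i)) \<bullet> (x - X i) - \<mu> * (norm s)\<^sup>2 + \<mu> * (a i \<bullet> s) - \<mu> * ((C i - c) \<bullet> s)"
      by (simp add: inner_diff inner_add power2_norm_eq_inner algebra_simps)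
    finally have 0: "0 \<le> (s - c - (a i - C i)) \<bullet> (x - X i) - \<mu> * (norm s)\<^sup>2 + \<mu> * (a i \<bullet> s) - \<mu> * ((C i - c) \<bullet> s)" .
    have 1: "(s - c - (a i - C i)) \<bullet> (x - X i) \<le> (norm (s - c) + M + norm (C i)) * norm (x - X i)"
    proof -
      have "norm (s - c - (a i - C i)) \<le> norm (s - c) + M + norm (C i)"
        using norm_triangle_ineq4[of "s - c" "a i - C i"] norm_triangle_ineq4[of "a i" "C i"] elim by linarith
      then show ?thesis
        using norm_cauchy_schwarz[of "s - c - (a i - C i)" "x - X i"]
        by (meson mult_right_mono norm_ge_zero order_trans)
    qed
    have 2: "- (\<mu> * ((C i - c) \<bullet> s)) \<le> \<mu> * norm (C i - c) * norm s"
    proof -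
      have "- ((C i - c) \<bullet> s) \<le> norm (C i - c) * norm s"
        using Cauchy_Schwarz_ineq2[of "C i - c" s] by linarith
      then have "\<mu> * - ((C i - c) \<bullet> s) \<le> \<mu> * (norm (C i - c) * norm s)"
        using assms(5) by (intro mult_left_mono) auto
      then show ?thesis by (simp add: mult.assoc)
    qed
    have "\<mu> * ((norm s)\<^sup>2 - e) = \<mu> * (norm s)\<^sup>2 - \<mu> * e" by (simp add: right_diff_distrib)
    then have "\<mu> * ((norm s)\<^sup>2 - e) \<le> \<mu> * (a i \<bullet> s)"
      using elim(1) 0 1 2 by linarith
    then show ?case using assms(5) by simp
  qed
qed

text \<open>Cauchy-Schwarz turns the preceding bound into \<open>|s|^2 \<le> M |s|\<close>. The
  bound is uniform in \<open>\<mu>\<close> and does not presuppose that \<open>A x\<close> is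
  nonempty, which is how values of \<open>A\<close> at limit points are found.\<close>

lemma shY_le:
  assumes "F \<noteq> bot" "(X \<longlongrightarrow> x) F" "(C \<longlongrightarrow> c) F" "\<forall>\<^sub>F i in F. a i - C i \<in> A (X i)"
    "\<forall>\<^sub>F i in F. norm (a i) \<le> M" "0 < \<mu>"
  shows "norm (shY \<mu> x c) \<le> M"
proof -
  define s where "s = shY \<mu> x c"
  have "(norm s)\<^sup>2 \<le> M * norm s"
  proof (rule field_le_epsilon)
    fix e :: real assume "e > 0"
    have "\<forall>\<^sub>F i in F. (norm s)\<^sup>2 \<le> M * norm s + e"
      using shY_inner_lower[OF assms(2-6) \<open>e > 0\<close>] assms(5) unfolding s_def[symmetric]
    proof eventually_elim
      case (elim i)
      have "a i \<bullet> s \<le> norm (a i) * norm s" by (rule norm_cauchy_schwarz)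
      also have "\<dots> \<le> M * norm s" using elim by (intro mult_right_mono) auto
      finally show ?case using elim by simp
    qed
    then show "(norm s)\<^sup>2 \<le> M * norm s + e" using assms(1) by simp
  qed
  moreover have "0 \<le> M" using eventually_happens'[OF assms(1,5)] norm_ge_zero order_trans by blast
  ultimately show ?thesis unfolding s_def[symmetric]
    by (cases "s = 0") (auto simp: power2_eq_square)
qed

text \<open>Monotonicity between the two resolvent pairs yields
  \<open>(s - t) \<bullet> t \<ge> 0\<close>, and then \<open>|s|^2\<close> dominates
  \<open>|s - t|^2 + |t|^2\<close>. Thus the norms increase as the parameter shrinks, and bounded
  norms force a Cauchy sequence.\<close>

lemma shY_diff:
  assumes "0 < \<mu>" "\<mu> \<le> \<nu>"
  shows "(norm (shY \<mu> x c - shY \<nu> x c))\<^sup>2 \<le> (norm (shY \<mu> x c))\<^sup>2 - (norm (shY \<nu> x c))\<^sup>2"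
proof -
  define s t where "s = shY \<mu> x c" and "t = shY \<nu> x c"
  have "0 \<le> (s - c - (t - c)) \<bullet> (x - \<mu> *\<^sub>R s - (x - \<nu> *\<^sub>R t))"
    using assms shY_in mono unfolding s_def t_def by (meson less_le_trans)
  also have "\<dots> = (\<nu> - \<mu>) * ((s - t) \<bullet> t) - \<mu> * (norm (s - t))\<^sup>2"
    by (simp add: inner_diff algebra_simps power2_norm_eq_inner inner_commute)
  finally have *: "\<mu> * (norm (s - t))\<^sup>2 \<le> (\<nu> - \<mu>) * ((s - t) \<bullet> t)" by simp
  have "0 \<le> (s - t) \<bullet> t"
  proof (cases "\<nu> = \<mu>")
    case True
    then have "s = t" by (simp add: s_def t_def)
    then show ?thesis by simp
  next
    case False
    have "0 \<le> \<mu> * (norm (s - t))\<^sup>2" using assms by simp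
    with * have "0 \<le> (\<nu> - \<mu>) * ((s - t) \<bullet> t)" by linarith
    then show ?thesis using False assms by (simp add: zero_le_mult_iff)
  qed
  moreover have "(norm s)\<^sup>2 = (norm (s - t))\<^sup>2 + 2 * ((s - t) \<bullet> t) + (norm t)\<^sup>2"
    by (simp add: inner_diff algebra_simps power2_norm_eq_inner inner_commute)
  ultimately show ?thesis unfolding s_def[symmetric] t_def[symmetric] by simp
qed

text \<open>As \<open>\<mu>\<close> tends to 0 the approximations converge to the element of minimal norm of \<open>A x + c\<close>. If
  \<open>A x\<close> is empty, the limit does not exist and the value is meaningless.\<close>

definition minsel :: "'a \<Rightarrow> 'a \<Rightarrow> 'a" where
  "minsel x c = lim (\<lambda>n. shY (inverse (real (Suc n))) x c)"

text \<open>The squared norms are increasing and bounded, hence Cauchy; \<open>shY_diff\<close>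
  transfers this to the vectors, and the closed graph places the limit in
  \<open>A x + c\<close>.\<close>

lemma minsel_convergence:
  assumes "\<And>\<mu>. 0 < \<mu> \<Longrightarrow> norm (shY \<mu> x c) \<le> M"
  shows "(\<lambda>n. shY (inverse (real (Suc n))) x c) \<longlonglongrightarrow> minsel x c"
    "minsel x c - c \<in> A x" "norm (minsel x c) \<le> M"
proof -
  define s where "s n = shY (inverse (real (Suc n))) x c" for n
  have d: "(norm (s n - s m))\<^sup>2 \<le> (norm (s n))\<^sup>2 - (norm (s m))\<^sup>2" if "m \<le> n" for m n
    unfolding s_def by (rule shY_diff) (use that in \<open>auto simp: field_simps\<close>)
  have M: "norm (s n) \<le> M" for n unfolding s_def by (rule assms) simp
  have "incseq (\<lambda>n. (norm (s n))\<^sup>2)"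
    unfolding incseq_def using d by (smt (verit) zero_le_power2)
  moreover have "Bseq (\<lambda>n. (norm (s n))\<^sup>2)"
    using M by (intro BseqI'[of _ "M\<^sup>2"]) (auto intro: power_mono)
  ultimately have "Cauchy (\<lambda>n. (norm (s n))\<^sup>2)"
    by (simp add: Bseq_mono_convergent incseq_def convergent_Cauchy)
  have "Cauchy s"
    unfolding Cauchy_altdef
  proof (intro allI impI)
    fix e :: real assume "e > 0"
    then obtain N where N: "\<And>m n. m \<ge> N \<Longrightarrow> n \<ge> N \<Longrightarrow> dist ((norm (s m))\<^sup>2) ((norm (s n))\<^sup>2) < e\<^sup>2"
      using \<open>Cauchy (\<lambda>n. (norm (s n))\<^sup>2)\<close> unfolding Cauchy_def by (meson zero_less_power)
    show "\<exists>M. \<forall>m\<ge>M. \<forall>n>m. dist (s m) (s n) < e"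
    proof (intro exI[of _ N] allI impI)
      fix m n assume "m \<ge> N" "n > m"
      then have "(norm (s n - s m))\<^sup>2 < e\<^sup>2" using d[of m n] N[of n m] by (auto simp: dist_real_def)
      then show "dist (s m) (s n) < e"
        using \<open>e > 0\<close> by (simp add: dist_norm norm_minus_commute power2_less_imp_less)
    qed
  qed
  then have "convergent s" by (rule Cauchy_convergent)
  then have lim: "s \<longlonglongrightarrow> minsel x c"
    unfolding minsel_def s_def by (rule convergent_LIMSEQ_iff[THEN iffD1])
  then show "(\<lambda>n. shY (inverse (real (Suc n))) x c) \<longlonglongrightarrow> minsel x c" by (simp add: s_def[abs_def])
  show "norm (minsel x c) \<le> M"
    using lim M by (intro Lim_bounded[OF tendsto_norm[OF lim]]) auto
  show "minsel x c - c \<in> A x"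
  proof (rule closed_graph)
    show "(\<lambda>n. s n - c) \<longlonglongrightarrow> minsel x c - c" by (intro tendsto_intros lim)
    have "(\<lambda>n. x - inverse (real (Suc n)) *\<^sub>R s n) \<longlonglongrightarrow> x - 0 *\<^sub>R minsel x c"
      by (intro tendsto_intros lim LIMSEQ_inverse_real_of_nat)
    then show "(\<lambda>n. x - inverse (real (Suc n)) *\<^sub>R s n) \<longlonglongrightarrow> x" by simp
    show "\<forall>\<^sub>F n in sequentially. s n - c \<in> A (x - inverse (real (Suc n)) *\<^sub>R s n)"
      unfolding s_def by (intro always_eventually allI shY_in) simp
  qed simp
qed

lemma minsel_limit:
  assumes "F \<noteq> bot" "(X \<longlongrightarrow> x) F" "(C \<longlongrightarrow> c) F" "\<forall>\<^sub>F i in F. a i - C i \<in> A (X i)"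
    "\<forall>\<^sub>F i in F. norm (a i) \<le> M"
  shows "minsel x c - c \<in> A x" "norm (minsel x c) \<le> M"
    "(\<lambda>n. shY (inverse (real (Suc n))) x c) \<longlonglongrightarrow> minsel x c"
  using minsel_convergence[of x c M] shY_le[OF assms] by auto

lemma minsel_le:
  assumes "b - c \<in> A x"
  shows "minsel x c - c \<in> A x" "norm (minsel x c) \<le> norm b"
  using minsel_limit[of sequentially "\<lambda>_. x" x "\<lambda>_. c" c "\<lambda>_. b" "norm b"] assms by auto

text \<open>The minimal element is replaced by one approximation \<open>s n\<close> so close that
  the replacement costs at most \<open>e / 2\<close>, uniformly over the bounded family;
  \<open>shY_inner_lower\<close> for this fixed \<open>n\<close> costs the other half.\<close>

lemma minsel_inner_lower:
  assumes "F \<noteq> bot" "(X \<longlongrightarrow> x) F" "(C \<longlongrightarrow> c) F" "\<forall>\<^sub>F i in F. a i - C i \<in> A (X i)"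
    "\<forall>\<^sub>F i in F. norm (a i) \<le> M" "0 < e"
  shows "\<forall>\<^sub>F i in F. (norm (minsel x c))\<^sup>2 - e \<le> a i \<bullet> minsel x c"
proof -
  define m where "m = minsel x c"
  define s where "s n = shY (inverse (real (Suc n))) x c" for n
  have lim: "s \<longlonglongrightarrow> m" using minsel_limit(3)[OF assms(1-5)] by (simp add: m_def s_def[abs_def])
  have "(\<lambda>n. (norm m)\<^sup>2 - (norm (s n))\<^sup>2 + M * norm (s n - m)) \<longlonglongrightarrow> (norm m)\<^sup>2 - (norm m)\<^sup>2 + M * norm (m - m)"
    by (intro tendsto_intros lim)
  then have "\<forall>\<^sub>F n in sequentially. (norm m)\<^sup>2 - (norm (s n))\<^sup>2 + M * norm (s n - m) < e / 2"
    using \<open>0 < e\<close> by (intro order_tendstoD) auto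
  then obtain n where n: "(norm m)\<^sup>2 - (norm (s n))\<^sup>2 + M * norm (s n - m) < e / 2"
    by (meson eventually_happens' sequentially_bot)
  have "\<forall>\<^sub>F i in F. (norm (s n))\<^sup>2 - e/2 \<le> a i \<bullet> s n"
    unfolding s_def by (rule shY_inner_lower[OF assms(2-5)]) (use assms in auto)
  then show ?thesis using assms(5) unfolding m_def[symmetric]
  proof eventually_elim
    case (elim i)
    have "a i \<bullet> (s n - m) \<le> norm (a i) * norm (s n - m)" by (rule norm_cauchy_schwarz)
    also have "\<dots> \<le> M * norm (s n - m)" using elim by (intro mult_right_mono) auto
    finally show ?case using elim n by (simp add: inner_diff)
  qed
qed

text \<open>Elements of the graph that are asymptotically not longer than the minimal element
  converge to it in norm. The instance \<open>e = 1\<close> of \<open>le\<close> supplies the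
  boundedness that the pairing bound requires.\<close>

lemma minsel_tendsto:
  assumes "F \<noteq> bot" "(X \<longlongrightarrow> x) F" "(C \<longlongrightarrow> c) F" "\<forall>\<^sub>F i in F. a i - C i \<in> A (X i)"
    and le: "\<And>e. e > 0 \<Longrightarrow> \<forall>\<^sub>F i in F. norm (a i) \<le> norm (minsel x c) + e"
  shows "(a \<longlongrightarrow> minsel x c) F"
  by (rule tendsto_of_inner_and_norm[OF minsel_inner_lower[OF assms(1-4) le[of 1]] le]) auto

end

section \<open>Lipschitz perturbations of maximal monotone operators\<close>

lemma has_vector_derivative_iff_quotient:
  "(f has_vector_derivative f') (at x within S) \<longleftrightarrow>
    ((\<lambda>y. (f y - f x) /\<^sub>R (y - x)) \<longlongrightarrow> f') (at x within S)"
proof -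
  have eq: "norm (f y - f x - (y - x) *\<^sub>R f') / norm (y - x) = norm ((f y - f x) /\<^sub>R (y - x) - f')"
    if "y \<noteq> x" for y
  proof -
    have "(f y - f x) /\<^sub>R (y - x) - f' = (f y - f x - (y - x) *\<^sub>R f') /\<^sub>R (y - x)"
      using that by (simp add: scaleR_diff_right)
    then show ?thesis by (simp add: divide_inverse)
  qed
  have "(f has_vector_derivative f') (at x within S) \<longleftrightarrow>
      ((\<lambda>y. norm (f y - f x - (y - x) *\<^sub>R f') / norm (y - x)) \<longlongrightarrow> 0) (at x within S)"
    unfolding has_vector_derivative_def has_derivative_iff_norm
    by (simp add: bounded_linear_scaleR_left)
  also have "\<dots> \<longleftrightarrow> ((\<lambda>y. norm ((f y - f x) /\<^sub>R (y - x) - f')) \<longlongrightarrow> 0) (at x within S)"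
    by (intro tendsto_cong) (simp add: eventually_at_filter eq[unfolded real_norm_def])
  also have "\<dots> \<longleftrightarrow> ((\<lambda>y. (f y - f x) /\<^sub>R (y - x)) \<longlongrightarrow> f') (at x within S)"
    by (simp only: tendsto_norm_zero_iff LIM_zero_iff)
  finally show ?thesis .
qed

lemma nonincreasing_of_deriv:
  assumes "\<And>t. 0 \<le> t \<Longrightarrow> (g has_real_derivative g' t) (at t within {0..})"
    and "0 \<le> a" "a \<le> b" "\<And>t. a < t \<Longrightarrow> t < b \<Longrightarrow> g' t \<le> 0"
  shows "g b \<le> g a"
proof (rule DERIV_nonpos_imp_decreasing_open[OF \<open>a \<le> b\<close>])
  show "\<exists>y. DERIV g t :> y \<and> y \<le> 0" if "a < t" "t < b" for t
  proof (intro exI conjI)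
    have "at t within {0..} = at t"
      using that assms(2) by (intro at_within_interior) (simp add: interior_real_atLeast)
    then show "DERIV g t :> g' t" using assms(1)[of t] assms(2) that by simp
  qed (use assms that in auto)
  show "continuous_on {a..b} g"
    unfolding continuous_on_eq_continuous_within
  proof
    fix t assume "t \<in> {a..b}"
    then show "continuous (at t within {a..b}) g"
      using assms(1)[of t] assms(2) by (intro continuous_within_subset[OF DERIV_continuous]) auto
  qed
qed

lemma inner_increment_le:
  fixes u :: "real \<Rightarrow> 'a::real_inner"
  assumes "\<And>t. 0 \<le> t \<Longrightarrow> (u has_vector_derivative u' t) (at t within {0..})"
    and "0 \<le> a" "a \<le> b" "\<And>t. a < t \<Longrightarrow> t < b \<Longrightarrow> u' t \<bullet> e \<le> k"
  shows "(u b - u a) \<bullet> e \<le> k * (b - a)"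
proof -
  have "(u b \<bullet> e - k * b) \<le> u a \<bullet> e - k * a"
  proof (rule nonincreasing_of_deriv[where g = "\<lambda>t. u t \<bullet> e - k * t" and g' = "\<lambda>t. u' t \<bullet> e - k"])
    fix t :: real assume "0 \<le> t"
    then have "((\<lambda>t. u t \<bullet> e) has_vector_derivative u' t \<bullet> e) (at t within {0..})"
      using assms(1)[of t] by (intro bounded_linear.has_vector_derivative[OF bounded_linear_inner_left])
    then show "((\<lambda>t. u t \<bullet> e - k * t) has_real_derivative u' t \<bullet> e - k) (at t within {0..})"
      unfolding has_real_derivative_iff_has_vector_derivative[symmetric]
      by (auto intro!: derivative_eq_intros)
  qed (use assms in auto)
  then show ?thesis by (simp add: inner_diff algebra_simps)
qed

text \<open>The scalar estimate is tested in the direction of the increment itself, and one factor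
  of its norm is cancelled.\<close>

lemma norm_increment_le:
  fixes u :: "real \<Rightarrow> 'a::real_inner"
  assumes "\<And>t. 0 \<le> t \<Longrightarrow> (u has_vector_derivative u' t) (at t within {0..})"
    and "0 \<le> a" "a \<le> b" "\<And>t. a < t \<Longrightarrow> t < b \<Longrightarrow> norm (u' t) \<le> k"
  shows "norm (u b - u a) \<le> k * (b - a)"
proof (cases "u b = u a \<or> a = b")
  case True
  show ?thesis
  proof (cases "a = b")
    case False
    then have "0 \<le> k" using assms(3) by (intro order_trans[OF norm_ge_zero assms(4)[of "(a + b) / 2"]]) auto
    then show ?thesis using True False assms(3) by auto
  qed auto
next
  case False
  define e where "e = u b - u a"
  have "e \<bullet> e \<le> (k * norm e) * (b - a)"
    unfolding e_def[symmetric]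
    using inner_increment_le[OF assms(1-3), where e = e and k = "k * norm e"] assms(4)
    by (metis e_def mult_right_mono norm_cauchy_schwarz norm_ge_zero order_trans)
  then have "norm e * norm e \<le> norm e * (k * (b - a))" by (simp add: norm_eq_sqrt_inner mult_ac)
  moreover have "norm e > 0" using False by (auto simp: e_def)
  ultimately show ?thesis by (simp add: e_def)
qed

text \<open>The exponential is the integrating factor of \<open>|d|^2\<close>. It is at most 1 at
  nonnegative times, so the source \<open>k\<close> contributes no more than
  \<open>2 * k * (t - s)\<close>.\<close>

lemma norm_square_growth:
  fixes d :: "real \<Rightarrow> 'a::real_inner"
  assumes "\<And>t. 0 \<le> t \<Longrightarrow> (d has_vector_derivative d' t) (at t within {0..})"
    and "0 \<le> s" "s \<le> t" "0 \<le> k"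
    and "\<And>\<tau>. s < \<tau> \<Longrightarrow> \<tau> < t \<Longrightarrow> d' \<tau> \<bullet> d \<tau> \<le> L * (norm (d \<tau>))\<^sup>2 + k"
    and "0 \<le> L"
  shows "exp (- 2 * L * t) * (norm (d t))\<^sup>2 \<le> exp (- 2 * L * s) * (norm (d s))\<^sup>2 + 2 * k * (t - s)"
proof -
  define g where "g \<tau> = exp (- 2 * L * \<tau>) * (norm (d \<tau>))\<^sup>2 - 2 * k * \<tau>" for \<tau>
  define g' where "g' \<tau> = exp (- 2 * L * \<tau>) * (2 * (d' \<tau> \<bullet> d \<tau>) - 2 * L * (norm (d \<tau>))\<^sup>2) - 2 * k" for \<tau>
  have "g t \<le> g s"
  proof (rule nonincreasing_of_deriv[where g = g and g' = g'])
    fix \<tau> :: real assume "0 \<le> \<tau>"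
    then have "((\<lambda>\<tau>. d \<tau> \<bullet> d \<tau>) has_vector_derivative (d \<tau> \<bullet> d' \<tau> + d' \<tau> \<bullet> d \<tau>)) (at \<tau> within {0..})"
      using assms(1)[of \<tau>] by (intro bounded_bilinear.has_vector_derivative[OF bounded_bilinear_inner])
    then have d2: "((\<lambda>\<tau>. (norm (d \<tau>))\<^sup>2) has_real_derivative 2 * (d' \<tau> \<bullet> d \<tau>)) (at \<tau> within {0..})"
      by (simp add: has_real_derivative_iff_has_vector_derivative power2_norm_eq_inner inner_commute)
    have "((\<lambda>\<tau>. exp (- 2 * L * \<tau>)) has_real_derivative exp (- 2 * L * \<tau>) * (- 2 * L)) (at \<tau> within {0..})"
      "((\<lambda>\<tau>. 2 * k * \<tau>) has_real_derivative 2 * k) (at \<tau> within {0..})"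
      by (auto intro!: derivative_eq_intros)
    from DERIV_diff[OF DERIV_mult[OF this(1) d2] this(2)]
    have "(g has_real_derivative exp (- 2 * L * \<tau>) * (- 2 * L) * (norm (d \<tau>))\<^sup>2
        + 2 * (d' \<tau> \<bullet> d \<tau>) * exp (- 2 * L * \<tau>) - 2 * k) (at \<tau> within {0..})"
      unfolding g_def[abs_def] .
    then show "(g has_real_derivative g' \<tau>) (at \<tau> within {0..})"
      by (rule DERIV_cong) (simp add: g'_def algebra_simps)
  next
    fix \<tau> assume "s < \<tau>" "\<tau> < t"
    have "exp (- 2 * L * \<tau>) * (2 * (d' \<tau> \<bullet> d \<tau>) - 2 * L * (norm (d \<tau>))\<^sup>2) \<le> exp (- 2 * L * \<tau>) * (2 * k)"
      using assms(5)[of \<tau>] \<open>s < \<tau>\<close> \<open>\<tau> < t\<close> by (intro mult_left_mono) auto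
    also have "\<dots> \<le> 1 * (2 * k)" using assms \<open>s < \<tau>\<close> by (intro mult_right_mono) auto
    finally show "g' \<tau> \<le> 0" by (simp add: g'_def)
  qed (use assms in auto)
  then show ?thesis by (simp add: g_def algebra_simps)
qed

section \<open>Yosida-regularised trajectories and their velocities\<close>

locale lipschitz_perturbation = maximal_monotone A for A :: "'a::{real_inner,banach} \<Rightarrow> 'a set" +
  fixes F :: "'a \<Rightarrow> 'a" and L :: real
  assumes L_pos: "0 < L" and F_lipschitz: "norm (F x - F y) \<le> L * norm (x - y)"
begin

lemma F_tendsto: "(X \<longlongrightarrow> x) G \<Longrightarrow> ((\<lambda>i. F (X i)) \<longlongrightarrow> F x) G"
proof -
  assume X: "(X \<longlongrightarrow> x) G"
  have "L-lipschitz_on UNIV F"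
    using L_pos F_lipschitz by (intro lipschitz_onI) (auto simp: dist_norm)
  then have "isCont F x"
    using lipschitz_on_continuous_on continuous_on_eq_continuous_at open_UNIV by blast
  then show ?thesis using X by (rule isCont_tendsto_compose)
qed

definition sol :: "real \<Rightarrow> 'a \<Rightarrow> real \<Rightarrow> 'a" where
  "sol \<mu> y = (SOME u. u 0 = y \<and>
     (\<forall>t\<ge>0. (u has_vector_derivative - (Y \<mu> (u t) + F (u t))) (at t within {0..})))"

lemma sol:
  assumes "0 < \<mu>"
  shows "sol \<mu> y 0 = y"
    "0 \<le> t \<Longrightarrow> (sol \<mu> y has_vector_derivative - (Y \<mu> (sol \<mu> y t) + F (sol \<mu> y t))) (at t within {0..})"
proof -
  have "(1 / \<mu> + L)-lipschitz_on UNIV (\<lambda>x. - (Y \<mu> x + F x))"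
  proof (rule lipschitz_onI)
    fix x y
    have "dist (- (Y \<mu> x + F x)) (- (Y \<mu> y + F y)) = norm ((Y \<mu> x - Y \<mu> y) + (F x - F y))"
      unfolding dist_norm by (subst norm_minus_commute) (rule arg_cong[where f = norm], simp)
    also have "\<dots> \<le> norm (Y \<mu> x - Y \<mu> y) + norm (F x - F y)" by (rule norm_triangle_ineq)
    also have "\<dots> \<le> norm (x - y) / \<mu> + L * norm (x - y)"
      using Y_lipschitz[OF assms] F_lipschitz by (intro add_mono)
    finally show "dist (- (Y \<mu> x + F x)) (- (Y \<mu> y + F y)) \<le> (1 / \<mu> + L) * dist x y"
      by (simp add: dist_norm algebra_simps)
  qed (use assms L_pos in auto)
  from someI_ex[OF picard_global[OF this, of y]]
  show "sol \<mu> y 0 = y"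
    "0 \<le> t \<Longrightarrow> (sol \<mu> y has_vector_derivative - (Y \<mu> (sol \<mu> y t) + F (sol \<mu> y t))) (at t within {0..})"
    unfolding sol_def by blast+
qed

text \<open>Trajectories move with velocity \<open>- vel\<close>. The sign of the operator is kept,
  as in \<open>minvel\<close>, and is reversed only in \<open>flow_solution\<close>.\<close>

definition vel :: "real \<Rightarrow> 'a \<Rightarrow> 'a" where
  "vel \<mu> x = Y \<mu> x + F x"

lemma vel_inner: "0 < \<mu> \<Longrightarrow> - (vel \<mu> x - vel \<mu> y) \<bullet> (x - y) \<le> L * (norm (x - y))\<^sup>2"
proof -
  assume \<mu>: "0 < \<mu>"
  have "0 \<le> \<mu> * (norm (Y \<mu> x - Y \<mu> y))\<^sup>2" using \<mu> by simp
  then have "0 \<le> (Y \<mu> x - Y \<mu> y) \<bullet> (x - y)" using Y_monotone[OF \<mu>, of x y] by linarith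
  moreover have "- ((F x - F y) \<bullet> (x - y)) \<le> norm (F x - F y) * norm (x - y)"
    using Cauchy_Schwarz_ineq2[of "F x - F y" "x - y"] by linarith
  moreover have "norm (F x - F y) * norm (x - y) \<le> L * norm (x - y) * norm (x - y)"
    using F_lipschitz by (intro mult_right_mono) auto
  ultimately show ?thesis by (simp add: vel_def inner_diff inner_add power2_eq_square algebra_simps)
qed

text \<open>The monotone part can only decrease the distance, so the growth rate is \<open>L\<close>
  for every \<open>\<mu>\<close>, although the Lipschitz constant of the vector field explodes like
  \<open>1 / \<mu>\<close>.\<close>

lemma trajectories_contract:
  assumes "0 < \<mu>" "0 \<le> s" "s \<le> t"
    and "\<And>t. 0 \<le> t \<Longrightarrow> (u has_vector_derivative - vel \<mu> (u t)) (at t within {0..})"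
    and "\<And>t. 0 \<le> t \<Longrightarrow> (v has_vector_derivative - vel \<mu> (v t)) (at t within {0..})"
  shows "norm (u t - v t) \<le> exp (L * (t - s)) * norm (u s - v s)"
proof -
  have "exp (- 2 * L * t) * (norm (u t - v t))\<^sup>2 \<le> exp (- 2 * L * s) * (norm (u s - v s))\<^sup>2 + 2 * 0 * (t - s)"
  proof (rule norm_square_growth[where d = "\<lambda>t. u t - v t"])
    show "((\<lambda>t. u t - v t) has_vector_derivative - (vel \<mu> (u t) - vel \<mu> (v t))) (at t within {0..})"
      if "0 \<le> t" for t
      using has_vector_derivative_diff[OF assms(4,5)[OF that]] by simp
  qed (use assms L_pos vel_inner in auto)
  then have "exp (2 * L * t) * (exp (- 2 * L * t) * (norm (u t - v t))\<^sup>2)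
      \<le> exp (2 * L * t) * (exp (- 2 * L * s) * (norm (u s - v s))\<^sup>2)" by simp
  then have "(norm (u t - v t))\<^sup>2 \<le> exp (2 * L * t - 2 * L * s) * (norm (u s - v s))\<^sup>2"
    unfolding mult.assoc[symmetric] exp_add[symmetric] by simp
  also have "exp (2 * L * t - 2 * L * s) = (exp (L * (t - s)))\<^sup>2"
    by (simp add: power2_eq_square algebra_simps flip: exp_add)
  finally have "(norm (u t - v t))\<^sup>2 \<le> (exp (L * (t - s)) * norm (u s - v s))\<^sup>2"
    by (simp add: power_mult_distrib)
  then show ?thesis by (rule power2_le_imp_le) simp
qed

lemma trajectory_shift:
  assumes "\<And>t. 0 \<le> t \<Longrightarrow> (u has_vector_derivative - vel \<mu> (u t)) (at t within {0..})" "0 \<le> h" "0 \<le> t"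
  shows "((\<lambda>t. u (h + t)) has_vector_derivative - vel \<mu> (u (h + t))) (at t within {0..})"
proof -
  have "((u \<circ> (\<lambda>t. h + t)) has_vector_derivative (1::real) *\<^sub>R (- vel \<mu> (u (h + t)))) (at t within {0..})"
  proof (rule vector_diff_chain_within)
    show "((\<lambda>t. h + t) has_vector_derivative 1) (at t within {0..})"
      by (auto intro!: derivative_eq_intros)
    show "(u has_vector_derivative - vel \<mu> (u (h + t))) (at (h + t) within (\<lambda>t. h + t) ` {0..})"
      by (rule has_vector_derivative_within_subset[OF assms(1)]) (use assms in auto)
  qed
  then show ?thesis by (simp add: o_def)
qed

text \<open>A trajectory is compared with its own time shift; dividing by the shift and letting it
  vanish transfers the estimate to velocities without differentiating
  \<open>Y \<mu>\<close>.\<close>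

lemma velocity_growth:
  assumes "0 < \<mu>" "0 \<le> s" "s \<le> t"
    and u: "\<And>t. 0 \<le> t \<Longrightarrow> (u has_vector_derivative - vel \<mu> (u t)) (at t within {0..})"
  shows "norm (vel \<mu> (u t)) \<le> exp (L * (t - s)) * norm (vel \<mu> (u s))"
proof -
  define h where "h n = inverse (real (Suc n))" for n
  have lim: "(\<lambda>n. norm ((u (\<tau> + h n) - u \<tau>) /\<^sub>R h n)) \<longlonglongrightarrow> norm (vel \<mu> (u \<tau>))" if "0 \<le> \<tau>" for \<tau>
  proof -
    have "filterlim (\<lambda>n. \<tau> + h n) (at \<tau> within {0..}) sequentially"
      unfolding filterlim_at
    proof (intro conjI)
      have "(\<lambda>n. \<tau> + h n) \<longlonglongrightarrow> \<tau> + 0" unfolding h_def by (intro tendsto_intros LIMSEQ_inverse_real_of_nat)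
      then show "(\<lambda>n. \<tau> + h n) \<longlonglongrightarrow> \<tau>" by simp
    qed (use that in \<open>auto simp: h_def\<close>)
    from filterlim_compose[OF u[OF that, unfolded has_vector_derivative_iff_quotient] this]
    have "(\<lambda>n. (u (\<tau> + h n) - u \<tau>) /\<^sub>R h n) \<longlonglongrightarrow> - vel \<mu> (u \<tau>)" by simp
    from tendsto_norm[OF this] show ?thesis by simp
  qed
  show ?thesis
  proof (rule LIMSEQ_le)
    show "(\<lambda>n. norm ((u (t + h n) - u t) /\<^sub>R h n)) \<longlonglongrightarrow> norm (vel \<mu> (u t))"
      using assms by (intro lim) auto
    show "(\<lambda>n. exp (L * (t - s)) * norm ((u (s + h n) - u s) /\<^sub>R h n)) \<longlonglongrightarrow> exp (L * (t - s)) * norm (vel \<mu> (u s))"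
      using assms by (intro tendsto_intros lim) auto
    have "norm ((u (t + h n) - u t) /\<^sub>R h n) \<le> exp (L * (t - s)) * norm ((u (s + h n) - u s) /\<^sub>R h n)" for n
    proof -
      have h: "0 < h n" by (simp add: h_def)
      have "norm (u (h n + t) - u t) \<le> exp (L * (t - s)) * norm (u (h n + s) - u s)"
        by (rule trajectories_contract[where u = "\<lambda>t. u (h n + t)", OF assms(1-3)])
          (use u trajectory_shift[OF u] h in auto)
      then have "inverse (h n) * norm (u (h n + t) - u t) \<le> inverse (h n) * (exp (L * (t - s)) * norm (u (h n + s) - u s))"
        using h by (intro mult_left_mono) auto
      then show ?thesis using h by (simp add: add.commute mult_ac)
    qed
    then show "\<exists>N. \<forall>n\<ge>N. norm ((u (t + h n) - u t) /\<^sub>R h n) \<le> exp (L * (t - s)) * norm ((u (s + h n) - u s) /\<^sub>R h n)"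
      by blast
  qed
qed

text \<open>The initial value is moved to \<open>x + \<mu>\<^sub>n \<zeta>\<close> with \<open>\<zeta> + F x\<close> of minimal norm in \<open>A x + F x\<close>, because
  the Yosida approximation of parameter \<open>\<mu>\<^sub>n\<close> takes exactly the value \<open>\<zeta>\<close> there. This makes the
  velocity bounds sharp in the limit.\<close>

definition minvel :: "'a \<Rightarrow> 'a" where "minvel x = minsel x (F x)"
definition step :: "nat \<Rightarrow> real" where "step n = inverse (real (Suc n))"
definition approx :: "'a \<Rightarrow> nat \<Rightarrow> real \<Rightarrow> 'a" where
  "approx x n = sol (step n) (x + step n *\<^sub>R (minvel x - F x))"

lemma step_pos: "0 < step n" by (simp add: step_def)
lemma step_le_1: "step n \<le> 1" by (simp add: step_def field_simps)
lemma step_tendsto: "step \<longlonglongrightarrow> 0" unfolding step_def[abs_def] by (rule LIMSEQ_inverse_real_of_nat)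

lemma approx_0: "approx x n 0 = x + step n *\<^sub>R (minvel x - F x)"
  by (simp add: approx_def sol(1) step_pos)

lemma approx_deriv:
  "0 \<le> t \<Longrightarrow> (approx x n has_vector_derivative - vel (step n) (approx x n t)) (at t within {0..})"
  using sol(2)[OF step_pos] by (simp add: approx_def vel_def)

context
  fixes x assumes dom: "A x \<noteq> {}"
begin

lemma minvel_in: "minvel x - F x \<in> A x"
  using dom minsel_le(1)[of "_ + F x" "F x" x] unfolding minvel_def by force

text \<open>At time 0 the Yosida part equals \<open>minvel x - F x\<close> exactly, so the initial
  velocity misses \<open>minvel x\<close> only by the change of \<open>F\<close> over a displacement
  of order \<open>step n\<close>.\<close>

lemma vel_approx_bound:
  assumes "0 \<le> t"
  shows "norm (vel (step n) (approx x n t)) \<le> exp (L * t) * (norm (minvel x) + L * step n * norm (minvel x - F x))"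
proof -
  define z where "z = minvel x - F x"
  have "vel (step n) (approx x n 0) = minvel x + (F (x + step n *\<^sub>R z) - F x)"
    using Y_resolvent[OF step_pos minvel_in] by (simp add: vel_def approx_0 z_def)
  also have "norm \<dots> \<le> norm (minvel x) + norm (F (x + step n *\<^sub>R z) - F x)" by (rule norm_triangle_ineq)
  also have "norm (F (x + step n *\<^sub>R z) - F x) \<le> L * step n * norm z"
    using F_lipschitz[of "x + step n *\<^sub>R z" x] step_pos[of n] by simp
  finally have "norm (vel (step n) (approx x n 0)) \<le> norm (minvel x) + L * step n * norm z" by simp
  then have "exp (L * (t - 0)) * norm (vel (step n) (approx x n 0)) \<le> exp (L * t) * (norm (minvel x) + L * step n * norm z)"
    by simp
  then show ?thesis unfolding z_def
    using velocity_growth[OF step_pos order_refl assms approx_deriv, of n x] by linarith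
qed

definition velbound :: "real" where
  "velbound = norm (minvel x) + L * norm (minvel x - F x)"

lemma velbound_nonneg: "0 \<le> velbound" using L_pos by (simp add: velbound_def)

lemma vel_approx_uniform_bound:
  assumes "0 \<le> t" "t \<le> T"
  shows "norm (vel (step n) (approx x n t)) \<le> exp (L * T) * velbound"
proof -
  have "norm (vel (step n) (approx x n t)) \<le> exp (L * t) * (norm (minvel x) + L * step n * norm (minvel x - F x))"
    by (rule vel_approx_bound) fact
  also have "\<dots> \<le> exp (L * T) * (norm (minvel x) + L * 1 * norm (minvel x - F x))"
    using L_pos assms step_le_1[of n] step_pos[of n] by (intro mult_mono add_mono) auto
  finally show ?thesis by (simp add: velbound_def)
qed

lemma approx_increment:
  assumes "0 \<le> s" "s \<le> t"
  shows "norm (approx x n t - approx x n s)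
    \<le> exp (L * t) * (norm (minvel x) + L * step n * norm (minvel x - F x)) * (t - s)"
proof (rule norm_increment_le[OF approx_deriv assms])
  fix \<tau> assume \<tau>: "s < \<tau>" "\<tau> < t"
  have "norm (vel (step n) (approx x n \<tau>)) \<le> exp (L * \<tau>) * (norm (minvel x) + L * step n * norm (minvel x - F x))"
    using assms \<tau> by (intro vel_approx_bound) auto
  also have "\<dots> \<le> exp (L * t) * (norm (minvel x) + L * step n * norm (minvel x - F x))"
    using \<tau> L_pos step_pos[of n] by (intro mult_right_mono) (auto intro!: add_nonneg_nonneg mult_nonneg_nonneg)
  finally show "norm (- vel (step n) (approx x n \<tau>)) \<le> exp (L * t) * (norm (minvel x) + L * step n * norm (minvel x - F x))"
    by simp
qed

lemma approx_lipschitz: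
  assumes "0 \<le> s" "0 \<le> t" "s \<le> T" "t \<le> T"
  shows "norm (approx x n t - approx x n s) \<le> exp (L * T) * velbound * \<bar>t - s\<bar>"
proof -
  have *: "norm (approx x n b - approx x n a) \<le> exp (L * T) * velbound * (b - a)"
    if "0 \<le> a" "a \<le> b" "b \<le> T" for a b
    using that by (intro norm_increment_le[OF approx_deriv]) (auto intro: vel_approx_uniform_bound)
  show ?thesis using *[of s t] *[of t s] assms
    by (cases "s \<le> t") (auto simp: norm_minus_commute)
qed

text \<open>As \<open>Y = vel - F\<close>, the velocity bound is increased by a bound of
  \<open>F\<close> along the trajectory, which starts within \<open>norm (minvel x - F x)\<close> of
  \<open>x\<close> and moves with bounded speed.\<close>

definition yosbound :: "real \<Rightarrow> real" where
  "yosbound T = exp (L * T) * velbound + norm (F x) + L * (exp (L * T) * velbound * T + norm (minvel x - F x))"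

lemma Y_approx_bound:
  assumes "0 \<le> t" "t \<le> T"
  shows "norm (Y (step n) (approx x n t)) \<le> yosbound T"
proof -
  let ?u = "approx x n"
  have "norm (?u t - x) \<le> norm (?u t - ?u 0) + norm (?u 0 - x)"
    using norm_triangle_ineq[of "?u t - ?u 0" "?u 0 - x"] by simp
  also have "norm (?u t - ?u 0) \<le> exp (L * T) * velbound * \<bar>t - 0\<bar>"
    using assms by (intro approx_lipschitz) auto
  also have "\<dots> \<le> exp (L * T) * velbound * T"
    using assms velbound_nonneg by (intro mult_left_mono) auto
  also have "norm (?u 0 - x) \<le> norm (minvel x - F x)"
    using step_le_1[of n] step_pos[of n] by (simp add: approx_0 mult_left_le_one_le)
  finally have 1: "norm (?u t - x) \<le> exp (L * T) * velbound * T + norm (minvel x - F x)" by simp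
  have "norm (F (?u t)) \<le> norm (F x) + norm (F (?u t) - F x)"
    using norm_triangle_ineq[of "F x" "F (?u t) - F x"] by simp
  also have "norm (F (?u t) - F x) \<le> L * norm (?u t - x)" by (rule F_lipschitz)
  also have "\<dots> \<le> L * (exp (L * T) * velbound * T + norm (minvel x - F x))"
    using 1 L_pos by (intro mult_left_mono) auto
  finally have 2: "norm (F (?u t)) \<le> norm (F x) + L * (exp (L * T) * velbound * T + norm (minvel x - F x))" by simp
  have "norm (Y (step n) (?u t)) \<le> norm (vel (step n) (?u t)) + norm (F (?u t))"
    using norm_triangle_ineq4[of "vel (step n) (?u t)" "F (?u t)"] by (simp add: vel_def)
  with 2 vel_approx_uniform_bound[OF assms, of n] show ?thesis by (simp add: yosbound_def)
qed

lemma yosbound_nonneg: "0 \<le> T \<Longrightarrow> 0 \<le> yosbound T"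
  using Y_approx_bound[of T T 0] norm_ge_zero order_trans by blast

text \<open>Monotonicity holds at the resolvent points, not at the trajectories; the two differ by
  \<open>step n *\<^sub>R a - step m *\<^sub>R b\<close>. Bounded Yosida values make the resulting
  source term of order \<open>step n + step m\<close>.\<close>

lemma approx_diff:
  assumes "0 \<le> t"
  shows "exp (- 2 * L * t) * (norm (approx x n t - approx x m t))\<^sup>2
    \<le> (norm ((step n - step m) *\<^sub>R (minvel x - F x)))\<^sup>2 + 4 * (yosbound t)\<^sup>2 * (step n + step m) * t"
proof -
  let ?u = "approx x n" and ?v = "approx x m"
  have C: "0 \<le> yosbound t" by (rule yosbound_nonneg) fact
  have "exp (- 2 * L * t) * (norm (?u t - ?v t))\<^sup>2
      \<le> exp (- 2 * L * 0) * (norm (?u 0 - ?v 0))\<^sup>2 + 2 * (2 * (yosbound t)\<^sup>2 * (step n + step m)) * (t - 0)"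
  proof (rule norm_square_growth[where d = "\<lambda>t. ?u t - ?v t"])
    show "((\<lambda>t. ?u t - ?v t) has_vector_derivative - vel (step n) (?u t) + vel (step m) (?v t)) (at t within {0..})"
      if "0 \<le> t" for t
      using has_vector_derivative_diff[OF approx_deriv approx_deriv] that by simp
    show "0 \<le> 2 * (yosbound t)\<^sup>2 * (step n + step m)"
      using step_pos[of n] step_pos[of m] by simp
    fix \<tau> assume \<tau>: "0 < \<tau>" "\<tau> < t"
    define a b where "a = Y (step n) (?u \<tau>)" and "b = Y (step m) (?v \<tau>)"
    have ab: "norm a \<le> yosbound t" "norm b \<le> yosbound t"
      unfolding a_def b_def using \<tau> by (auto intro!: Y_approx_bound)
    have "0 \<le> (a - b) \<bullet> (J (step n) (?u \<tau>) - J (step m) (?v \<tau>))"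
      using mono[OF Y_in Y_in] step_pos unfolding a_def b_def by blast
    also have "J (step n) (?u \<tau>) - J (step m) (?v \<tau>) = (?u \<tau> - ?v \<tau>) - (step n *\<^sub>R a - step m *\<^sub>R b)"
      by (simp add: J_eq step_pos a_def b_def)
    finally have 1: "- ((a - b) \<bullet> (?u \<tau> - ?v \<tau>)) \<le> - ((a - b) \<bullet> (step n *\<^sub>R a - step m *\<^sub>R b))"
      by (simp add: inner_diff_right)
    have "norm (step n *\<^sub>R a - step m *\<^sub>R b) \<le> step n * yosbound t + step m * yosbound t"
      using norm_triangle_ineq4[of "step n *\<^sub>R a" "step m *\<^sub>R b"] ab step_pos[of n] step_pos[of m]
      by (smt (verit, best) abs_of_pos mult_left_mono norm_scaleR)
    moreover have "norm (a - b) \<le> 2 * yosbound t" using norm_triangle_ineq4[of a b] ab by linarith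
    ultimately have "norm (a - b) * norm (step n *\<^sub>R a - step m *\<^sub>R b) \<le> (2 * yosbound t) * (step n * yosbound t + step m * yosbound t)"
      using C by (intro mult_mono) auto
    also have "\<dots> = 2 * (yosbound t)\<^sup>2 * (step n + step m)" by (simp add: power2_eq_square algebra_simps)
    finally have 2: "- ((a - b) \<bullet> (step n *\<^sub>R a - step m *\<^sub>R b)) \<le> 2 * (yosbound t)\<^sup>2 * (step n + step m)"
      using Cauchy_Schwarz_ineq2[of "a - b" "step n *\<^sub>R a - step m *\<^sub>R b"] by linarith
    have "- ((F (?u \<tau>) - F (?v \<tau>)) \<bullet> (?u \<tau> - ?v \<tau>)) \<le> norm (F (?u \<tau>) - F (?v \<tau>)) * norm (?u \<tau> - ?v \<tau>)"
      using Cauchy_Schwarz_ineq2[of "F (?u \<tau>) - F (?v \<tau>)" "?u \<tau> - ?v \<tau>"] by linarith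
    also have "\<dots> \<le> L * norm (?u \<tau> - ?v \<tau>) * norm (?u \<tau> - ?v \<tau>)"
      using F_lipschitz by (intro mult_right_mono) auto
    finally have 3: "- ((F (?u \<tau>) - F (?v \<tau>)) \<bullet> (?u \<tau> - ?v \<tau>)) \<le> L * (norm (?u \<tau> - ?v \<tau>))\<^sup>2"
      by (simp add: power2_eq_square)
    have "(- vel (step n) (?u \<tau>) + vel (step m) (?v \<tau>)) \<bullet> (?u \<tau> - ?v \<tau>)
        = - ((a - b) \<bullet> (?u \<tau> - ?v \<tau>)) + - ((F (?u \<tau>) - F (?v \<tau>)) \<bullet> (?u \<tau> - ?v \<tau>))"
      by (simp add: vel_def a_def b_def inner_add inner_diff algebra_simps)
    with 1 2 3 show "(- vel (step n) (?u \<tau>) + vel (step m) (?v \<tau>)) \<bullet> (?u \<tau> - ?v \<tau>)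
        \<le> L * (norm (?u \<tau> - ?v \<tau>))\<^sup>2 + 2 * (yosbound t)\<^sup>2 * (step n + step m)" by linarith
  qed (use assms L_pos in auto)
  then show ?thesis by (simp add: approx_0 algebra_simps)
qed

lemma approx_Cauchy:
  assumes "0 \<le> t"
  shows "Cauchy (\<lambda>n. approx x n t)"
proof (rule metric_CauchyI)
  fix e :: real assume "e > 0"
  define z where "z = minvel x - F x"
  define K where "K = (norm z)\<^sup>2 + 4 * (yosbound t)\<^sup>2 * t"
  have K: "0 \<le> K" using assms by (simp add: K_def)
  have "(\<lambda>n. 2 * step n * K) \<longlonglongrightarrow> 2 * 0 * K" by (intro tendsto_intros step_tendsto)
  moreover have "2 * 0 * K < exp (- 2 * L * t) * e\<^sup>2" using \<open>e > 0\<close> by simp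
  ultimately have "\<forall>\<^sub>F n in sequentially. 2 * step n * K < exp (- 2 * L * t) * e\<^sup>2"
    by (rule order_tendstoD(2))
  then obtain N where N: "2 * step N * K < exp (- 2 * L * t) * e\<^sup>2" by (meson eventually_happens' sequentially_bot)
  have anti: "step n \<le> step N" if "n \<ge> N" for n using that by (simp add: step_def field_simps)
  show "\<exists>M. \<forall>m\<ge>M. \<forall>n\<ge>M. dist (approx x m t) (approx x n t) < e"
  proof (intro exI[of _ N] allI impI)
    fix m n assume mn: "m \<ge> N" "n \<ge> N"
    have abs: "\<bar>step m - step n\<bar> \<le> step m + step n" "step m + step n \<le> 2 * step N"
      using anti[OF mn(1)] anti[OF mn(2)] step_pos[of m] step_pos[of n] by auto
    \<comment> \<open>One of the two factors \<open>\<bar>step m - step n\<bar>\<close> is bounded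
      by 1, so that this term is also linear in \<open>step N\<close>.\<close>
    have "(norm ((step m - step n) *\<^sub>R z))\<^sup>2 = \<bar>step m - step n\<bar> * \<bar>step m - step n\<bar> * (norm z)\<^sup>2"
      by (simp add: power_mult_distrib power2_eq_square)
    also have "\<dots> \<le> 1 * (2 * step N) * (norm z)\<^sup>2"
      using abs step_le_1[of m] step_le_1[of n] step_pos[of m] step_pos[of n] by (intro mult_mono) auto
    finally have 1: "(norm ((step m - step n) *\<^sub>R z))\<^sup>2 \<le> 2 * step N * (norm z)\<^sup>2" by simp
    have "4 * (yosbound t)\<^sup>2 * (step m + step n) * t \<le> 4 * (yosbound t)\<^sup>2 * (2 * step N) * t"
      using abs assms by (intro mult_right_mono mult_left_mono) auto
    moreover have "2 * step N * K = 2 * step N * (norm z)\<^sup>2 + 4 * (yosbound t)\<^sup>2 * (2 * step N) * t"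
      by (simp add: K_def algebra_simps)
    ultimately have "exp (- 2 * L * t) * (norm (approx x m t - approx x n t))\<^sup>2 < exp (- 2 * L * t) * e\<^sup>2"
      using 1 approx_diff[OF assms, of m n, folded z_def] N by linarith
    then have "(norm (approx x m t - approx x n t))\<^sup>2 < e\<^sup>2" by simp
    then show "dist (approx x m t) (approx x n t) < e"
      using \<open>e > 0\<close> by (simp add: dist_norm power2_less_imp_less)
  qed
qed

section \<open>The limit flow, its semigroup property and its differentiability\<close>

definition flow :: "real \<Rightarrow> 'a" where
  "flow t = lim (\<lambda>n. approx x n t)"

lemma approx_tendsto: "0 \<le> t \<Longrightarrow> (\<lambda>n. approx x n t) \<longlonglongrightarrow> flow t"
  unfolding flow_def using approx_Cauchy Cauchy_convergent convergent_LIMSEQ_iff by blast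

lemma flow_0: "flow 0 = x"
proof -
  have "(\<lambda>n. approx x n 0) \<longlonglongrightarrow> x + 0 *\<^sub>R (minvel x - F x)"
    unfolding approx_0 by (intro tendsto_intros step_tendsto)
  then show ?thesis using LIMSEQ_unique approx_tendsto[of 0] by fastforce
qed

text \<open>The correction due to the displaced initial value vanishes in the limit. What remains
  contains \<open>norm (minvel x)\<close> itself, the sharp constant on which the derivative of the
  flow depends.\<close>

lemma flow_increment:
  assumes "0 \<le> s" "s \<le> t"
  shows "norm (flow t - flow s) \<le> exp (L * t) * norm (minvel x) * (t - s)"
proof (rule LIMSEQ_le)
  show "(\<lambda>n. norm (approx x n t - approx x n s)) \<longlonglongrightarrow> norm (flow t - flow s)"
    using assms by (intro tendsto_intros approx_tendsto) auto
  have "(\<lambda>n. exp (L * t) * (norm (minvel x) + L * step n * norm (minvel x - F x)) * (t - s))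
      \<longlonglongrightarrow> exp (L * t) * (norm (minvel x) + L * 0 * norm (minvel x - F x)) * (t - s)"
    by (intro tendsto_intros step_tendsto)
  then show "(\<lambda>n. exp (L * t) * (norm (minvel x) + L * step n * norm (minvel x - F x)) * (t - s))
      \<longlonglongrightarrow> exp (L * t) * norm (minvel x) * (t - s)" by simp
qed (use approx_increment[OF assms] in blast)

lemma J_approx_in: "vel (step n) y - F y \<in> A (J (step n) y)"
  using Y_in[OF step_pos, of n y] by (simp add: vel_def)

text \<open>Resolvent points lie within \<open>step (m i) * yosbound T\<close> of the trajectory.
  The filter is arbitrary because the lemma serves both the limit at a fixed time and the joint
  limit in index and time.\<close>

lemma J_approx_tendsto:
  assumes "filterlim m sequentially G" "((\<lambda>i. approx x (m i) (\<tau> i)) \<longlongrightarrow> y) G"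
    "\<forall>\<^sub>F i in G. 0 \<le> \<tau> i \<and> \<tau> i \<le> T"
  shows "((\<lambda>i. J (step (m i)) (approx x (m i) (\<tau> i))) \<longlongrightarrow> y) G"
proof -
  have "((\<lambda>i. approx x (m i) (\<tau> i) - step (m i) *\<^sub>R Y (step (m i)) (approx x (m i) (\<tau> i))) \<longlongrightarrow> y - 0) G"
  proof (intro tendsto_diff assms(2))
    show "((\<lambda>i. step (m i) *\<^sub>R Y (step (m i)) (approx x (m i) (\<tau> i))) \<longlongrightarrow> 0) G"
    proof (rule Lim_null_comparison)
      show "\<forall>\<^sub>F i in G. norm (step (m i) *\<^sub>R Y (step (m i)) (approx x (m i) (\<tau> i))) \<le> step (m i) * yosbound T"
        using assms(3)
      proof eventually_elim
        case (elim i)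
        then show ?case using step_pos[of "m i"] Y_approx_bound[of "\<tau> i" T "m i"] by simp
      qed
      have "((\<lambda>i. step (m i) * yosbound T) \<longlongrightarrow> 0 * yosbound T) G"
        by (intro tendsto_intros filterlim_compose[OF step_tendsto assms(1)])
      then show "((\<lambda>i. step (m i) * yosbound T) \<longlongrightarrow> 0) G" by simp
    qed
  qed
  then show ?thesis by (simp add: J_eq step_pos)
qed

text \<open>The velocities are values of the operator at resolvent points tending to
  \<open>flow t\<close>, and their norms are eventually below the limiting bound plus any
  \<open>e\<close>; \<open>minsel_limit\<close> gives a value at \<open>flow t\<close> with that
  bound.\<close>

lemma flow_in:
  assumes "0 \<le> t"
  shows "A (flow t) \<noteq> {}" "norm (minvel (flow t)) \<le> exp (L * t) * norm (minvel x)"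
proof -
  have lim: "(\<lambda>n. approx x n t) \<longlonglongrightarrow> flow t" by (rule approx_tendsto) fact
  have limJ: "(\<lambda>n. J (step n) (approx x n t)) \<longlonglongrightarrow> flow t"
    by (rule J_approx_tendsto[where m = "\<lambda>n. n" and T = t]) (use assms lim in \<open>auto simp: filterlim_ident\<close>)
  have "(\<lambda>n. exp (L * t) * (norm (minvel x) + L * step n * norm (minvel x - F x)))
      \<longlonglongrightarrow> exp (L * t) * (norm (minvel x) + L * 0 * norm (minvel x - F x))"
    by (intro tendsto_intros step_tendsto)
  note lim_bound = this
  have ub: "\<forall>\<^sub>F n in sequentially. norm (vel (step n) (approx x n t)) \<le> exp (L * t) * norm (minvel x) + e"
    if "0 < e" for e
  proof -
    have "\<forall>\<^sub>F n in sequentially. exp (L * t) * (norm (minvel x) + L * step n * norm (minvel x - F x))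
        < exp (L * t) * norm (minvel x) + e"
      using that by (intro order_tendstoD(2)[OF lim_bound]) simp
    then show ?thesis
      by eventually_elim (rule order_trans[OF vel_approx_bound[OF assms]], simp)
  qed
  note ms = minsel_limit[OF sequentially_bot limJ F_tendsto[OF lim] always_eventually[OF allI[OF J_approx_in]] ub]
  show "A (flow t) \<noteq> {}" using ms(1)[of 1] by auto
  show "norm (minvel (flow t)) \<le> exp (L * t) * norm (minvel x)"
  proof (rule field_le_epsilon)
    show "norm (minvel (flow t)) \<le> exp (L * t) * norm (minvel x) + e" if "0 < e" for e
      using ms(2)[OF that] by (simp add: minvel_def)
  qed
qed

text \<open>Near \<open>t\<close> the regularised velocities have almost full component along the
  minimal velocity, uniformly in index and time. Integrating this for fixed \<open>n\<close> and
  then letting \<open>n\<close> grow gives a statement about increments of the flow on both sides of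
  \<open>t\<close>.\<close>

lemma flow_increment_inner_le:
  assumes "0 < t" "0 < e"
  shows "\<exists>d>0. \<forall>a b. t - d < a \<and> a \<le> b \<and> b < t + d \<longrightarrow>
    (flow b - flow a) \<bullet> minvel (flow t) \<le> (e - (norm (minvel (flow t)))\<^sup>2) * (b - a)"
proof -
  define m where "m = minvel (flow t)"
  \<comment> \<open>The joint filter provides a time neighbourhood independent of the index, which
    is what integration before the limit requires.\<close>
  define G where "G = sequentially \<times>\<^sub>F nhds t"
  have Gbot: "G \<noteq> bot" by (simp add: G_def prod_filter_eq_bot)
  have f: "filterlim fst sequentially G" "filterlim snd (nhds t) G"
    by (simp_all add: G_def filterlim_fst filterlim_snd)
  have range: "\<forall>\<^sub>F i in G. 0 \<le> snd i \<and> snd i \<le> t + 1"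
  proof -
    have "\<forall>\<^sub>F \<tau> in nhds t. 0 < \<tau> \<and> \<tau> < t + 1"
      using assms by (intro eventually_conj order_tendstoD[OF filterlim_ident]) auto
    then show ?thesis
      by (rule eventually_mono[OF eventually_compose_filterlim[OF _ f(2)]]) auto
  qed
  have lim: "((\<lambda>i. approx x (fst i) (snd i)) \<longlongrightarrow> flow t) G"
  proof (rule Lim_transform)
    show "((\<lambda>i. approx x (fst i) t) \<longlongrightarrow> flow t) G"
      using assms by (intro filterlim_compose[OF approx_tendsto f(1)]) auto
    show "((\<lambda>i. approx x (fst i) (snd i) - approx x (fst i) t) \<longlongrightarrow> 0) G"
    proof (rule Lim_null_comparison)
      show "\<forall>\<^sub>F i in G. norm (approx x (fst i) (snd i) - approx x (fst i) t)
          \<le> exp (L * (t + 1)) * velbound * \<bar>snd i - t\<bar>"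
        using range by eventually_elim (use assms in \<open>auto intro!: approx_lipschitz\<close>)
      have "((\<lambda>i. exp (L * (t + 1)) * velbound * \<bar>snd i - t\<bar>) \<longlongrightarrow> exp (L * (t + 1)) * velbound * \<bar>t - t\<bar>) G"
        by (intro tendsto_intros f(2))
      then show "((\<lambda>i. exp (L * (t + 1)) * velbound * \<bar>snd i - t\<bar>) \<longlongrightarrow> 0) G" by simp
    qed
  qed
  have "\<forall>\<^sub>F i in G. (norm m)\<^sup>2 - e \<le> vel (step (fst i)) (approx x (fst i) (snd i)) \<bullet> m"
    unfolding m_def minvel_def
  proof (rule minsel_inner_lower[OF Gbot])
    show "((\<lambda>i. J (step (fst i)) (approx x (fst i) (snd i))) \<longlongrightarrow> flow t) G"
      by (rule J_approx_tendsto[OF f(1) lim range])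
    show "((\<lambda>i. F (approx x (fst i) (snd i))) \<longlongrightarrow> F (flow t)) G" by (rule F_tendsto[OF lim])
    show "\<forall>\<^sub>F i in G. norm (vel (step (fst i)) (approx x (fst i) (snd i))) \<le> exp (L * (t + 1)) * velbound"
      using range by eventually_elim (auto intro!: vel_approx_uniform_bound)
  qed (use assms J_approx_in in auto)
  then obtain P Q where P: "eventually P sequentially" and Q: "eventually Q (nhds t)"
    and PQ: "\<And>n \<tau>. P n \<Longrightarrow> Q \<tau> \<Longrightarrow> (norm m)\<^sup>2 - e \<le> vel (step n) (approx x n \<tau>) \<bullet> m"
    unfolding G_def eventually_prod_filter by auto
  obtain d0 where d0: "d0 > 0" "\<And>\<tau>. dist \<tau> t < d0 \<Longrightarrow> Q \<tau>" using Q unfolding eventually_nhds_metric by blast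
  \<comment> \<open>The minimum with \<open>t\<close> keeps all times nonnegative.\<close>
  define d where "d = min d0 t"
  show ?thesis
  proof (intro exI[of _ d] conjI allI impI)
    show "d > 0" using d0 assms by (simp add: d_def)
    fix a b assume ab: "t - d < a \<and> a \<le> b \<and> b < t + d"
    then have a0: "0 \<le> a" "0 \<le> b" by (auto simp: d_def)
    show "(flow b - flow a) \<bullet> minvel (flow t) \<le> (e - (norm (minvel (flow t)))\<^sup>2) * (b - a)"
      unfolding m_def[symmetric]
    proof (rule tendsto_upperbound)
      show "(\<lambda>n. (approx x n b - approx x n a) \<bullet> m) \<longlonglongrightarrow> (flow b - flow a) \<bullet> m"
        by (intro tendsto_intros approx_tendsto a0)
      show "\<forall>\<^sub>F n in sequentially. (approx x n b - approx x n a) \<bullet> m \<le> (e - (norm m)\<^sup>2) * (b - a)"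
        using P
      proof eventually_elim
        case (elim n)
        show ?case
        proof (rule inner_increment_le[OF approx_deriv a0(1)])
          fix \<tau> assume "a < \<tau>" "\<tau> < b"
          then have "Q \<tau>" using ab by (intro d0) (auto simp: d_def dist_real_def)
          then show "- vel (step n) (approx x n \<tau>) \<bullet> m \<le> e - (norm m)\<^sup>2"
            using PQ[OF elim, of \<tau>] by simp
        qed (use ab in auto)
      qed
    qed simp
  qed
qed

end

text \<open>For equal \<open>n\<close> the shifted trajectory from \<open>x\<close> and the
  trajectory from \<open>flow x s\<close> solve the same equation; their distance at time
  \<open>t\<close> is at most \<open>exp (L * t)\<close> times an initial distance that tends to
  0.\<close>

lemma flow_semigroup:
  assumes dom: "A x \<noteq> {}" and st: "0 \<le> s" "0 \<le> t"
  shows "flow x (s + t) = flow (flow x s) t"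
proof -
  define y where "y = flow x s"
  have dy: "A y \<noteq> {}" using flow_in(1)[OF dom st(1)] by (simp add: y_def)
  have "(\<lambda>n. approx x n (s + t) - approx y n t) \<longlonglongrightarrow> 0"
  proof (rule Lim_null_comparison)
    have "norm (approx x n (s + t) - approx y n t) \<le> exp (L * (t - 0)) * norm (approx x n (s + 0) - approx y n 0)" for n
      using st trajectory_shift[OF approx_deriv st(1)] approx_deriv
      by (intro trajectories_contract[OF step_pos[of n], where u = "\<lambda>t. approx x n (s + t)"]) auto
    then show "\<forall>\<^sub>F n in sequentially. norm (approx x n (s + t) - approx y n t) \<le> exp (L * t) * norm (approx x n s - approx y n 0)"
      by simp
    have "(\<lambda>n. exp (L * t) * norm (approx x n s - approx y n 0)) \<longlonglongrightarrow> exp (L * t) * norm (flow x s - flow y 0)"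
      using st by (intro tendsto_intros approx_tendsto dom dy) auto
    then show "(\<lambda>n. exp (L * t) * norm (approx x n s - approx y n 0)) \<longlonglongrightarrow> 0"
      by (simp add: flow_0[OF dy] y_def[symmetric])
  qed
  moreover have "(\<lambda>n. approx x n (s + t) - approx y n t) \<longlonglongrightarrow> flow x (s + t) - flow y t"
    using st by (intro tendsto_intros approx_tendsto dom dy) auto
  ultimately have "flow x (s + t) - flow y t = 0" by (rule LIMSEQ_unique[rotated])
  then show ?thesis by (simp add: y_def)
qed

text \<open>Restarting at \<open>s\<close> replaces the minimal velocity at time 0 by the one at
  \<open>s\<close>, and \<open>exp (L * t)\<close> by \<open>exp (L * (t - s))\<close>. The first
  bound makes the weighted norm monotone, the second makes difference quotients asymptotically
  sharp.\<close>

lemma flow_restart: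
  assumes dom: "A x \<noteq> {}" and st: "0 \<le> s" "s \<le> t"
  shows "norm (minvel (flow x t)) \<le> exp (L * (t - s)) * norm (minvel (flow x s))"
    "norm (flow x t - flow x s) \<le> exp (L * (t - s)) * norm (minvel (flow x s)) * (t - s)"
proof -
  have eq: "flow x t = flow (flow x s) (t - s)" using flow_semigroup[OF dom st(1), of "t - s"] st by simp
  note dy = flow_in(1)[OF dom st(1)]
  show "norm (minvel (flow x t)) \<le> exp (L * (t - s)) * norm (minvel (flow x s))"
    unfolding eq using st by (intro flow_in(2) dy) auto
  show "norm (flow x t - flow x s) \<le> exp (L * (t - s)) * norm (minvel (flow x s)) * (t - s)"
    using flow_increment[OF dy order_refl, of "t - s"] st by (simp add: eq[symmetric] flow_0[OF dy])
qed

theorem flow_solution: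
  assumes dom: "A x \<noteq> {}"
  obtains U W :: "real \<Rightarrow> 'a" and N :: "real set"
  where "countable N" "U 0 = x"
    "\<And>t. 0 \<le> t \<Longrightarrow> - W t - F (U t) \<in> A (U t)"
    "\<And>t. 0 \<le> t \<Longrightarrow> norm (W t) \<le> exp (L * t) * norm (W 0)"
    "\<And>s t. 0 \<le> s \<Longrightarrow> s \<le> t \<Longrightarrow> norm (U t - U s) \<le> exp (L * t) * norm (W 0) * (t - s)"
    "\<And>t. 0 < t \<Longrightarrow> t \<notin> N \<Longrightarrow> isCont W t \<and> (U has_vector_derivative W t) (at t)"
proof -
  define U where "U = flow x"
  define m where "m t = minvel (U t)" for t
  \<comment> \<open>The minus sign makes the function nondecreasing, so that its discontinuities are
    countable.\<close>
  define g where "g t = - (exp (- L * t) * norm (m t))" for t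
  have g_mono: "mono_on {0<..} g"
  proof (rule mono_onI)
    fix s t :: real assume st: "s \<in> {0<..}" "t \<in> {0<..}" "s \<le> t"
    have "exp (- L * t) * norm (m t) \<le> exp (- L * t) * (exp (L * (t - s)) * norm (m s))"
      unfolding m_def U_def using st by (intro mult_left_mono flow_restart dom) auto
    also have "\<dots> = exp (- L * s) * norm (m s)"
      by (simp add: algebra_simps flip: mult.assoc exp_add)
    finally show "g s \<le> g t" by (simp add: g_def)
  qed
  define N where "N = {t \<in> {0<..}. \<not> isCont g t}"
  have dU: "A (U t) \<noteq> {}" if "0 \<le> t" for t unfolding U_def by (rule flow_in(1)[OF dom that])
  have main: "isCont m t \<and> (U has_vector_derivative - m t) (at t)" if t: "0 < t" "t \<notin> N" for t
  proof -
    have "isCont g t" using t by (simp add: N_def)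
    then have "isCont (\<lambda>t. - (exp (L * t) * g t)) t" by (intro continuous_intros)
    moreover have "(\<lambda>t. - (exp (L * t) * g t)) = (\<lambda>t. norm (m t))"
      by (auto simp: g_def exp_minus)
    ultimately have cn: "isCont (\<lambda>t. norm (m t)) t" by simp
    have pos: "\<forall>\<^sub>F \<tau> in nhds t. 0 < \<tau>" using t eventually_nhds_in_open[of "{0<..}" t] by auto
    then have pos': "\<forall>\<^sub>F \<tau> in at t. 0 < \<tau>" by (simp add: eventually_at_filter eventually_mono)
    have Ulim: "(U \<longlongrightarrow> U t) (at t)"
    proof (rule LIM_zero_cancel, rule Lim_null_comparison)
      define K where "K = exp (L * (t + 1)) * norm (minvel x)"
      have "\<forall>\<^sub>F \<tau> in at t. \<tau> < t + 1" by (intro order_tendstoD(2)[OF tendsto_ident_at]) simp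
      with pos' show "\<forall>\<^sub>F \<tau> in at t. norm (U \<tau> - U t) \<le> K * \<bar>\<tau> - t\<bar>"
      proof eventually_elim
        case (elim \<tau>)
        have *: "norm (U b - U a) \<le> K * (b - a)" if "0 \<le> a" "a \<le> b" "b \<le> t + 1" for a b
        proof -
          have "norm (U b - U a) \<le> exp (L * b) * norm (minvel x) * (b - a)"
            unfolding U_def using that by (intro flow_increment dom) auto
          also have "\<dots> \<le> K * (b - a)"
            unfolding K_def using that L_pos by (intro mult_right_mono) auto
          finally show ?thesis .
        qed
        show ?case using *[of t \<tau>] *[of \<tau> t] elim t
          by (cases "t \<le> \<tau>") (auto simp: norm_minus_commute)
      qed
      have "((\<lambda>\<tau>. K * \<bar>\<tau> - t\<bar>) \<longlongrightarrow> K * \<bar>t - t\<bar>) (at t)" by (intro tendsto_intros)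
      then show "((\<lambda>\<tau>. K * \<bar>\<tau> - t\<bar>) \<longlongrightarrow> 0) (at t)" by simp
    qed
    \<comment> \<open>Continuity of the norm at \<open>t\<close> is the missing upper bound in
      \<open>minsel_tendsto\<close>; it upgrades to norm continuity of the minimal section.\<close>
    have mlim: "(m \<longlongrightarrow> minsel (U t) (F (U t))) (at t)"
    proof (rule minsel_tendsto[OF _ Ulim F_tendsto[OF Ulim]])
      show "\<forall>\<^sub>F \<tau> in at t. m \<tau> - F (U \<tau>) \<in> A (U \<tau>)"
        using pos' by eventually_elim (use minvel_in dU in \<open>auto simp: m_def\<close>)
      fix e :: real assume "e > 0"
      show "\<forall>\<^sub>F \<tau> in at t. norm (m \<tau>) \<le> norm (minsel (U t) (F (U t))) + e"
        using order_tendstoD(2)[OF cn[unfolded isCont_def], of "norm (m t) + e"] \<open>e > 0\<close>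
        by (auto simp: m_def minvel_def elim: eventually_mono)
    qed simp
    then have cm: "isCont m t" by (simp add: isCont_def m_def[of t] minvel_def)
    \<comment> \<open>Pairings of \<open>q\<close> with \<open>m t\<close> are bounded below by
      \<open>flow_increment_inner_le\<close>, norms are bounded above by
      \<open>flow_restart\<close>.\<close>
    define q where "q \<tau> = - ((U \<tau> - U t) /\<^sub>R (\<tau> - t))" for \<tau>
    have "(q \<longlongrightarrow> m t) (at t)"
    proof (rule tendsto_of_inner_and_norm)
      fix e :: real assume "e > 0"
      obtain d where d: "d > 0" "\<And>a b. t - d < a \<Longrightarrow> a \<le> b \<Longrightarrow> b < t + d \<Longrightarrow>
          (U b - U a) \<bullet> m t \<le> (e - (norm (m t))\<^sup>2) * (b - a)"
        using flow_increment_inner_le[OF dom t(1) \<open>e > 0\<close>] unfolding U_def m_def by blast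
      show "\<forall>\<^sub>F \<tau> in at t. (norm (m t))\<^sup>2 - e \<le> q \<tau> \<bullet> m t"
        unfolding eventually_at
      proof (intro exI[of _ d] conjI ballI impI d(1))
        fix \<tau> assume "\<tau> \<noteq> t \<and> dist \<tau> t < d"
        then have \<tau>: "\<tau> \<noteq> t" "t - d < \<tau>" "\<tau> < t + d" by (auto simp: dist_real_def)
        have "(norm (m t))\<^sup>2 - e \<le> - ((U \<tau> - U t) \<bullet> m t) / (\<tau> - t)"
        proof (cases "t < \<tau>")
          case True
          then have "((norm (m t))\<^sup>2 - e) * (\<tau> - t) \<le> - ((U \<tau> - U t) \<bullet> m t)"
            using d(2)[of t \<tau>] \<tau> d(1) by (simp add: algebra_simps)
          then show ?thesis using True by (subst pos_le_divide_eq) auto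
        next
          case False
          then have "- ((U \<tau> - U t) \<bullet> m t) \<le> ((norm (m t))\<^sup>2 - e) * (\<tau> - t)"
            using d(2)[of \<tau> t] \<tau> d(1) by (simp add: algebra_simps inner_diff)
          then show ?thesis using False \<tau> by (subst neg_le_divide_eq) auto
        qed
        then show "(norm (m t))\<^sup>2 - e \<le> q \<tau> \<bullet> m t" by (simp add: q_def divide_inverse mult.commute)
      qed
      \<comment> \<open>To the right of \<open>t\<close> the flow is restarted at \<open>t\<close>,
        to the left at \<open>\<tau>\<close>; the maximum covers both cases, and continuity of the
        norm at \<open>t\<close> brings it down to \<open>norm (m t)\<close>.\<close>
      have "((\<lambda>\<tau>. exp (L * \<bar>\<tau> - t\<bar>) * max (norm (m \<tau>)) (norm (m t)))
          \<longlongrightarrow> exp (L * \<bar>t - t\<bar>) * max (norm (m t)) (norm (m t))) (at t)"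
        by (intro tendsto_intros tendsto_max cn[unfolded isCont_def])
      then have "\<forall>\<^sub>F \<tau> in at t. exp (L * \<bar>\<tau> - t\<bar>) * max (norm (m \<tau>)) (norm (m t)) < norm (m t) + e"
        using \<open>e > 0\<close> by (intro order_tendstoD(2)) auto
      moreover have "\<forall>\<^sub>F \<tau> in at t. \<tau> \<noteq> t" by (simp add: eventually_at_filter)
      ultimately show "\<forall>\<^sub>F \<tau> in at t. norm (q \<tau>) \<le> norm (m t) + e" using pos'
      proof eventually_elim
        case (elim \<tau>)
        have "norm (U \<tau> - U t) \<le> exp (L * \<bar>\<tau> - t\<bar>) * max (norm (m \<tau>)) (norm (m t)) * \<bar>\<tau> - t\<bar>"
        proof (cases "t < \<tau>")
          case True
          have "norm (U \<tau> - U t) \<le> exp (L * (\<tau> - t)) * norm (m t) * (\<tau> - t)"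
            unfolding U_def m_def using t True by (intro flow_restart dom) auto
          also have "\<dots> \<le> exp (L * (\<tau> - t)) * max (norm (m \<tau>)) (norm (m t)) * (\<tau> - t)"
            using True by (intro mult_right_mono mult_left_mono) auto
          finally show ?thesis using True by simp
        next
          case False
          have "norm (U t - U \<tau>) \<le> exp (L * (t - \<tau>)) * norm (m \<tau>) * (t - \<tau>)"
            unfolding U_def m_def using elim False by (intro flow_restart dom) auto
          also have "\<dots> \<le> exp (L * (t - \<tau>)) * max (norm (m \<tau>)) (norm (m t)) * (t - \<tau>)"
            using False by (intro mult_right_mono mult_left_mono) auto
          finally show ?thesis using False by (simp add: norm_minus_commute)
        qed
        then have "norm (q \<tau>) \<le> exp (L * \<bar>\<tau> - t\<bar>) * max (norm (m \<tau>)) (norm (m t))"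
          using elim by (simp add: q_def pos_divide_le_eq flip: divide_inverse_commute)
        then show ?case using elim by simp
      qed
    qed
    from tendsto_minus[OF this] have "(U has_vector_derivative - m t) (at t)"
      by (simp add: has_vector_derivative_iff_quotient q_def)
    with cm show ?thesis by blast
  qed
  have m0: "norm (m 0) = norm (minvel x)" by (simp add: m_def U_def flow_0[OF dom])
  show ?thesis
  proof (rule that[of N U "\<lambda>t. - m t"])
    show "countable N" unfolding N_def by (rule mono_on_ctble_discont_open[OF open_greaterThan g_mono])
    show "U 0 = x" unfolding U_def by (rule flow_0[OF dom])
    show "- (- m t) - F (U t) \<in> A (U t)" if "0 \<le> t" for t
      using minvel_in[OF dU[OF that]] by (simp add: m_def)
    show "norm (- m t) \<le> exp (L * t) * norm (- m 0)" if "0 \<le> t" for t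
      using flow_in(2)[OF dom that] m0 by (simp add: m_def U_def)
    show "norm (U t - U s) \<le> exp (L * t) * norm (- m 0) * (t - s)" if "0 \<le> s" "s \<le> t" for s t
      using flow_increment[OF dom that] m0 by (simp add: U_def)
    show "isCont (\<lambda>t. - m t) t \<and> (U has_vector_derivative - m t) (at t)" if "0 < t" "t \<notin> N" for t
      using main[OF that] by (simp add: continuous_minus)
  qed
qed

end

section \<open>Subdifferentials of convex potentials\<close>

text \<open>The lower limit in \<open>lsc\<close> is taken over punctured neighbourhoods; the strict
  inequality at \<open>p\<close> supplies the omitted point.\<close>

lemma lsc_eventually_greater:
  assumes "lsc \<phi>" "c < \<phi> p"
  shows "\<forall>\<^sub>F z in nhds p. c < \<phi> z"
proof -
  have "\<phi> p \<le> Liminf (at p) \<phi>" using assms(1) by (simp add: lsc_def)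
  then have "\<forall>\<^sub>F z in at p. c < \<phi> z" using assms(2) by (simp add: le_Liminf_iff)
  then show ?thesis using assms(2) by (auto simp: eventually_at_filter elim: eventually_mono)
qed

locale convex_potential =
  fixes \<phi> :: "'a::{real_inner,banach} \<Rightarrow> ereal"
  assumes proper: "proper \<phi>" and lsc: "lsc \<phi>" and convex: "ereal_convex \<phi>"
    and nonneg: "\<And>z. 0 \<le> \<phi> z"
begin

text \<open>Where \<open>\<phi>\<close> is infinite the value is 0 by convention, so comparisons
  through \<open>rval\<close> are guarded by finiteness.\<close>

definition rval :: "'a \<Rightarrow> real" where "rval z = real_of_ereal (\<phi> z)"

lemma rval: "\<phi> z \<noteq> \<infinity> \<Longrightarrow> \<phi> z = ereal (rval z)"
  using nonneg[of z] by (cases "\<phi> z") (auto simp: rval_def)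

lemma rval_nonneg: "0 \<le> rval z"
  using nonneg[of z] by (simp add: rval_def real_of_ereal_pos)

lemma rval_convex:
  assumes "\<phi> x \<noteq> \<infinity>" "\<phi> y \<noteq> \<infinity>" "0 < u" "u < 1"
  shows "\<phi> ((1 - u) *\<^sub>R x + u *\<^sub>R y) \<noteq> \<infinity>"
    "rval ((1 - u) *\<^sub>R x + u *\<^sub>R y) \<le> (1 - u) * rval x + u * rval y"
proof -
  let ?z = "(1 - u) *\<^sub>R x + u *\<^sub>R y"
  have "\<phi> ?z \<le> ereal (1 - u) * \<phi> x + ereal u * \<phi> y"
    using convex assms(3,4) unfolding ereal_convex_def by blast
  then have *: "\<phi> ?z \<le> ereal ((1 - u) * rval x + u * rval y)"
    unfolding rval[OF assms(1)] rval[OF assms(2)] by simp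
  then show "\<phi> ?z \<noteq> \<infinity>" by auto
  then have "\<phi> ?z = ereal (rval ?z)" by (rule rval)
  with * show "rval ?z \<le> (1 - u) * rval x + u * rval y" by simp
qed

text \<open>Properness provides a test point of finite value, which rules out an infinite value at
  \<open>x\<close>; the rest is real arithmetic on the effective domain.\<close>

lemma subdiff_iff:
  "\<zeta> \<in> subdiff \<phi> x \<longleftrightarrow> \<phi> x \<noteq> \<infinity> \<and> (\<forall>w. \<phi> w \<noteq> \<infinity> \<longrightarrow> rval x + \<zeta> \<bullet> (w - x) \<le> rval w)"
proof
  assume *: "\<zeta> \<in> subdiff \<phi> x"
  obtain w where "\<phi> w \<noteq> \<infinity>" using proper by (auto simp: proper_def)
  moreover have "\<phi> x + ereal (\<zeta> \<bullet> (w - x)) \<le> \<phi> w" using * by (simp add: subdiff_def)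
  ultimately have "\<phi> x \<noteq> \<infinity>" by auto
  moreover have "rval x + \<zeta> \<bullet> (w - x) \<le> rval w" if "\<phi> w \<noteq> \<infinity>" for w
  proof -
    have "\<phi> x + ereal (\<zeta> \<bullet> (w - x)) \<le> \<phi> w" using * by (simp add: subdiff_def)
    then show ?thesis using rval[OF \<open>\<phi> x \<noteq> \<infinity>\<close>] rval[OF that] by simp
  qed
  ultimately show "\<phi> x \<noteq> \<infinity> \<and> (\<forall>w. \<phi> w \<noteq> \<infinity> \<longrightarrow> rval x + \<zeta> \<bullet> (w - x) \<le> rval w)" by blast
next
  assume *: "\<phi> x \<noteq> \<infinity> \<and> (\<forall>w. \<phi> w \<noteq> \<infinity> \<longrightarrow> rval x + \<zeta> \<bullet> (w - x) \<le> rval w)"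
  have "\<phi> x + ereal (\<zeta> \<bullet> (w - x)) \<le> \<phi> w" for w
  proof (cases "\<phi> w = \<infinity>")
    case False
    then have "rval x + \<zeta> \<bullet> (w - x) \<le> rval w" using * by blast
    then show ?thesis using rval[of x] rval[OF False] * by simp
  qed auto
  then show "\<zeta> \<in> subdiff \<phi> x" by (simp add: subdiff_def)
qed

lemma subdiff_monotone:
  assumes "\<zeta> \<in> subdiff \<phi> x" "\<zeta>' \<in> subdiff \<phi> x'"
  shows "0 \<le> (\<zeta> - \<zeta>') \<bullet> (x - x')"
proof -
  have "rval x + \<zeta> \<bullet> (x' - x) \<le> rval x'" "rval x' + \<zeta>' \<bullet> (x - x') \<le> rval x"
    using assms by (auto simp: subdiff_iff)
  then show ?thesis by (simp add: inner_diff algebra_simps)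
qed

text \<open>The resolvent is the minimiser of \<open>\<phi> + |\<cdot> - x|\<^sup>2 / (2 \<mu>)\<close>; by the parallelogram law
  minimising sequences are Cauchy.\<close>

lemma ex_prox:
  assumes \<mu>: "0 < \<mu>"
  shows "\<exists>p. (x - p) /\<^sub>R \<mu> \<in> subdiff \<phi> p"
proof -
  define D where "D = {z. \<phi> z \<noteq> \<infinity>}"
  define g where "g z = rval z + (norm (z - x))\<^sup>2 / (2 * \<mu>)" for z
  define m where "m = Inf (g ` D)"
  have D: "D \<noteq> {}" using proper by (auto simp: proper_def D_def)
  have g0: "0 \<le> g z" for z using rval_nonneg[of z] \<mu> by (simp add: g_def)
  have bdd: "bdd_below (g ` D)" using g0 by (auto intro: bdd_belowI[of _ 0])
  have m_le: "m \<le> g z" if "z \<in> D" for z unfolding m_def by (rule cINF_lower[OF bdd that])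
  have "\<exists>z\<in>D. g z < m + inverse (real (Suc n))" for n
    using cInf_lessD[of "g ` D" "m + inverse (real (Suc n))"] D by (auto simp: m_def)
  then obtain z where z: "\<And>n. z n \<in> D" "\<And>n. g (z n) < m + inverse (real (Suc n))" by metis
  \<comment> \<open>The midpoint of \<open>y\<close> and \<open>w\<close> competes with the infimum;
    the parallelogram law converts the gain into control of their distance.\<close>
  have conv: "(norm (y - w))\<^sup>2 \<le> 4 * \<mu> * (g y + g w - 2 * m)" if "y \<in> D" "w \<in> D" for y w
  proof -
    let ?c = "(1 - 1/2) *\<^sub>R y + (1/2) *\<^sub>R w"
    have c: "?c \<in> D" "rval ?c \<le> (1 - 1/2) * rval y + 1/2 * rval w"
      using rval_convex[of y w "1/2"] that by (simp_all add: D_def)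
    have "?c - x = (1/2) *\<^sub>R ((y - x) + (w - x))" by (simp add: algebra_simps flip: scaleR_left.add)
    then have "(norm (?c - x))\<^sup>2 = (norm ((y - x) + (w - x)))\<^sup>2 / 4" by (simp add: power_mult_distrib power2_eq_square)
    moreover have "(norm ((y - x) + (w - x)))\<^sup>2 + (norm ((y - x) - (w - x)))\<^sup>2 = 2 * (norm (y - x))\<^sup>2 + 2 * (norm (w - x))\<^sup>2"
      unfolding power2_norm_eq_inner by (simp add: inner_add inner_diff algebra_simps)
    ultimately have *: "(norm (?c - x))\<^sup>2 = (2 * (norm (y - x))\<^sup>2 + 2 * (norm (w - x))\<^sup>2 - (norm (y - w))\<^sup>2) / 4"
      by simp
    have "m \<le> rval ?c + (norm (?c - x))\<^sup>2 / (2 * \<mu>)" using m_le[OF c(1)] by (simp add: g_def)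
    also have "\<dots> \<le> (rval y + rval w) / 2 + (2 * (norm (y - x))\<^sup>2 + 2 * (norm (w - x))\<^sup>2 - (norm (y - w))\<^sup>2) / 4 / (2 * \<mu>)"
      unfolding * using c(2) by (simp add: field_simps)
    also have "\<dots> = (g y + g w) / 2 - (norm (y - w))\<^sup>2 / (8 * \<mu>)"
      using \<mu> by (simp add: g_def field_simps)
    finally have *: "m \<le> (g y + g w) / 2 - (norm (y - w))\<^sup>2 / (8 * \<mu>)" .
    define q where "q = (norm (y - w))\<^sup>2 / (8 * \<mu>)"
    have "(norm (y - w))\<^sup>2 = 8 * \<mu> * q" using \<mu> by (simp add: q_def)
    also have "\<dots> \<le> 8 * \<mu> * ((g y + g w) / 2 - m)"
      using * \<mu> unfolding q_def[symmetric] by (intro mult_left_mono) auto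
    finally show ?thesis by (simp add: algebra_simps)
  qed
  have inv_lim: "(\<lambda>n. inverse (real (Suc n))) \<longlonglongrightarrow> 0" by (rule LIMSEQ_inverse_real_of_nat)
  have "Cauchy z"
  proof (rule metric_CauchyI)
    fix e :: real assume "e > 0"
    have "(\<lambda>n. 8 * \<mu> * inverse (real (Suc n))) \<longlonglongrightarrow> 8 * \<mu> * 0" by (intro tendsto_intros inv_lim)
    then have "\<forall>\<^sub>F n in sequentially. 8 * \<mu> * inverse (real (Suc n)) < e\<^sup>2"
      using \<open>e > 0\<close> by (intro order_tendstoD(2)) auto
    then obtain N where N: "8 * \<mu> * inverse (real (Suc N)) < e\<^sup>2" by (meson eventually_happens' sequentially_bot)
    show "\<exists>M. \<forall>m\<ge>M. \<forall>n\<ge>M. dist (z m) (z n) < e"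
    proof (intro exI[of _ N] allI impI)
      fix i j assume ij: "i \<ge> N" "j \<ge> N"
      have le: "inverse (real (Suc k)) \<le> inverse (real (Suc N))" if "k \<ge> N" for k using that by (simp add: field_simps)
      have "(norm (z i - z j))\<^sup>2 \<le> 4 * \<mu> * (g (z i) + g (z j) - 2 * m)" by (intro conv z)
      also have "\<dots> \<le> 4 * \<mu> * (2 * inverse (real (Suc N)))"
        using z(2)[of i] z(2)[of j] le[OF ij(1)] le[OF ij(2)] \<mu> by (intro mult_left_mono) linarith+
      finally have "(norm (z i - z j))\<^sup>2 < e\<^sup>2" using N by linarith
      then show "dist (z i) (z j) < e" using \<open>e > 0\<close> by (simp add: dist_norm power2_less_imp_less)
    qed
  qed
  then obtain p where p: "z \<longlonglongrightarrow> p" using Cauchy_convergent convergent_def by blast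
  \<comment> \<open>Stated for \<open>\<phi>\<close> rather than \<open>rval\<close>, the
    semicontinuity bound yields finiteness at \<open>p\<close> together with minimality.\<close>
  have phi_p: "\<phi> p \<le> ereal (m - (norm (p - x))\<^sup>2 / (2 * \<mu>))"
  proof (rule ccontr)
    assume "\<not> ?thesis"
    then have "ereal (m - (norm (p - x))\<^sup>2 / (2 * \<mu>)) < \<phi> p" by simp
    then obtain c where c: "ereal (m - (norm (p - x))\<^sup>2 / (2 * \<mu>)) < ereal c" "ereal c < \<phi> p"
      using ereal_dense2 by blast
    have "(\<lambda>n. m + inverse (real (Suc n)) - (norm (z n - x))\<^sup>2 / (2 * \<mu>)) \<longlonglongrightarrow> m + 0 - (norm (p - x))\<^sup>2 / (2 * \<mu>)"
      using \<mu> by (intro tendsto_intros inv_lim p) auto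
    then have "\<forall>\<^sub>F n in sequentially. m + inverse (real (Suc n)) - (norm (z n - x))\<^sup>2 / (2 * \<mu>) < c"
      using c(1) by (intro order_tendstoD(2)) auto
    moreover have "\<forall>\<^sub>F n in sequentially. ereal c < \<phi> (z n)"
      using lsc_eventually_greater[OF lsc c(2)] p by (rule eventually_compose_filterlim)
    ultimately have "\<forall>\<^sub>F n in sequentially. False"
    proof eventually_elim
      case (elim n)
      have "c < rval (z n)" using elim(2) rval[of "z n"] z(1)[of n] by (simp add: D_def)
      then show ?case using elim(1) z(2)[of n] by (simp add: g_def)
    qed
    then show False by simp
  qed
  then have pD: "\<phi> p \<noteq> \<infinity>" by auto
  have gp: "g p \<le> m" using phi_p rval[OF pD] by (simp add: g_def)
  have "rval p + ((x - p) /\<^sub>R \<mu>) \<bullet> (w - p) \<le> rval w" if w: "\<phi> w \<noteq> \<infinity>" for w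
  proof -
    define X where "X = rval p + ((x - p) /\<^sub>R \<mu>) \<bullet> (w - p) - rval w"
    \<comment> \<open>The minimum is compared with a point of the segment towards \<open>w\<close>
      and the result divided by \<open>u\<close>; the quadratic remainder then vanishes with
      \<open>u\<close>.\<close>
    have X: "X \<le> u * ((norm (w - p))\<^sup>2 / (2 * \<mu>))" if u: "0 < u" "u < 1" for u
    proof -
      let ?c = "(1 - u) *\<^sub>R p + u *\<^sub>R w"
      have "g p \<le> g ?c" using gp m_le[of ?c] rval_convex(1)[OF pD w u] by (simp add: D_def)
      also have "\<dots> \<le> (1 - u) * rval p + u * rval w + (norm (?c - x))\<^sup>2 / (2 * \<mu>)"
        using rval_convex(2)[OF pD w u] by (simp add: g_def)
      also have "?c - x = (p - x) + u *\<^sub>R (w - p)" by (simp add: algebra_simps)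
      also have "(norm \<dots>)\<^sup>2 = (norm (p - x))\<^sup>2 + 2 * u * ((p - x) \<bullet> (w - p)) + u\<^sup>2 * (norm (w - p))\<^sup>2"
        unfolding power2_norm_eq_inner by (simp add: inner_add inner_diff algebra_simps power2_eq_square inner_commute)
      finally have "u * (rval p - rval w) \<le> (2 * u * ((p - x) \<bullet> (w - p)) + u\<^sup>2 * (norm (w - p))\<^sup>2) / (2 * \<mu>)"
        unfolding g_def add_divide_distrib left_diff_distrib right_diff_distrib mult_1_left by linarith
      also have "\<dots> = u * (((p - x) \<bullet> (w - p)) / \<mu> + u * ((norm (w - p))\<^sup>2 / (2 * \<mu>)))"
        using \<mu> by (simp add: field_simps power2_eq_square)
      finally have "rval p - rval w \<le> ((p - x) \<bullet> (w - p)) / \<mu> + u * ((norm (w - p))\<^sup>2 / (2 * \<mu>))"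
        using u by simp
      moreover have "((x - p) /\<^sub>R \<mu>) \<bullet> (w - p) = - (((p - x) \<bullet> (w - p)) / \<mu>)"
        by (simp add: divide_inverse inner_diff algebra_simps)
      ultimately show ?thesis by (simp add: X_def)
    qed
    have "X \<le> 0"
    proof (rule tendsto_lowerbound)
      show "((\<lambda>u. u * ((norm (w - p))\<^sup>2 / (2 * \<mu>))) \<longlongrightarrow> 0) (at_right 0)"
        by (rule tendsto_eq_intros refl)+ auto
      show "\<forall>\<^sub>F u in at_right 0. X \<le> u * ((norm (w - p))\<^sup>2 / (2 * \<mu>))"
        using X eventually_at_right_less[of 0] by (auto simp: eventually_at_right[of 0 1] intro!: exI[of _ 1])
    qed simp
    then show ?thesis by (simp add: X_def)
  qed
  then show ?thesis using pD by (auto simp: subdiff_iff)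
qed

sublocale subdiff: maximal_monotone "subdiff \<phi>"
  by standard (use subdiff_monotone ex_prox in auto)

text \<open>By continuity the Yosida approximations at \<open>v\<close> stay bounded, so they converge to a subgradient.\<close>

lemma subdiff_continuous_nonempty:
  assumes fin: "\<And>z. \<phi> z \<noteq> \<infinity>" and cont: "continuous_on UNIV \<phi>"
  shows "subdiff \<phi> v \<noteq> {}"
proof -
  define s where "s n = inverse (real (Suc n))" for n
  have s: "0 < s n" for n by (simp add: s_def)
  define \<zeta> where "\<zeta> n = subdiff.Y (s n) v" for n
  define p where "p n = subdiff.J (s n) v" for n
  have z: "\<zeta> n \<in> subdiff \<phi> (p n)" for n unfolding \<zeta>_def p_def using subdiff.Y_in[OF s] .
  have ineq: "rval (p n) + \<zeta> n \<bullet> (w - p n) \<le> rval w" for n w using z[of n] fin by (auto simp: subdiff_iff)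
  have vp: "v - p n = s n *\<^sub>R \<zeta> n" for n by (simp add: \<zeta>_def p_def subdiff.J_eq s)
  \<comment> \<open>The subgradient inequality at \<open>p n\<close>, tested with \<open>v\<close>,
    bounds \<open>\<zeta> n \<bullet> (v - p n)\<close> by \<open>rval v\<close>, and
    \<open>v - p n\<close> is \<open>s n\<close> times \<open>\<zeta> n\<close>.\<close>
  have sq: "norm (v - p n) \<le> sqrt (s n * rval v)" for n
  proof -
    have "(norm (v - p n))\<^sup>2 = s n * (\<zeta> n \<bullet> (v - p n))" 
      unfolding power2_norm_eq_inner using vp by (metis inner_scaleR_left)
    also have "\<dots> \<le> s n * rval v" using ineq[of n v] rval_nonneg[of "p n"] s[of n] by (intro mult_left_mono) auto
    finally show ?thesis by (rule real_le_rsqrt)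
  qed
  have sq0: "(\<lambda>n. sqrt (s n * rval v)) \<longlonglongrightarrow> 0"
  proof -
    have "(\<lambda>n. sqrt (s n * rval v)) \<longlonglongrightarrow> sqrt (0 * rval v)"
      unfolding s_def by (intro tendsto_intros LIMSEQ_inverse_real_of_nat)
    then show ?thesis by simp
  qed
  have "(\<lambda>n. v - p n) \<longlonglongrightarrow> 0"
    by (rule Lim_null_comparison[OF always_eventually[OF allI[OF sq]] sq0])
  then have "(\<lambda>n. v - (v - p n)) \<longlonglongrightarrow> v - 0" by (intro tendsto_intros)
  then have p: "p \<longlonglongrightarrow> v" by simp
  have v1: "\<phi> v < ereal (rval v + 1)" using rval[OF fin, of v] by simp
  have "isCont \<phi> v" using cont by (simp add: continuous_on_eq_continuous_at)
  then have "\<forall>\<^sub>F w in at v. \<phi> w < ereal (rval v + 1)"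
    using v1 unfolding isCont_def by (rule order_tendstoD(2))
  then have "\<forall>\<^sub>F w in nhds v. \<phi> w < ereal (rval v + 1)"
    unfolding eventually_at_filter by eventually_elim (use v1 in blast)
  then obtain d where d: "d > 0" "\<And>w. dist w v < d \<Longrightarrow> \<phi> w < ereal (rval v + 1)"
    unfolding eventually_nhds_metric by blast
  have dr: "rval w < rval v + 1" if "dist w v < d" for w using d(2)[OF that] rval[OF fin, of w] by simp
  have "\<forall>\<^sub>F n in sequentially. dist (p n) v < d / 2" using p d(1) by (intro tendstoD) auto
  then have bound: "\<forall>\<^sub>F n in sequentially. norm (\<zeta> n) \<le> 2 * (rval v + 1) / d"
  proof eventually_elim
    case (elim n)
    show ?case
    proof (cases "\<zeta> n = 0")
      case True
      then show ?thesis using d(1) rval_nonneg[of v] by simp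
    next
      case False
      \<comment> \<open>The point lies at distance \<open>d / 2\<close> from \<open>p n\<close> in
        the direction of the subgradient. It stays in the ball where \<open>\<phi>\<close> is below
        \<open>rval v + 1\<close>, so a long subgradient would contradict its own
        inequality.\<close>
      define w where "w = p n + (d / (2 * norm (\<zeta> n))) *\<^sub>R \<zeta> n"
      have "norm (w - p n) = d / 2" using False d(1) by (simp add: w_def)
      then have "dist w v < d" using elim dist_triangle[of w v "p n"] by (simp add: dist_norm)
      then have "rval w < rval v + 1" by (rule dr)
      moreover have "\<zeta> n \<bullet> (w - p n) = d / 2 * norm (\<zeta> n)"
        using False by (simp add: w_def power2_eq_square flip: power2_norm_eq_inner)
      ultimately have "d / 2 * norm (\<zeta> n) \<le> rval v + 1" using ineq[of n w] rval_nonneg[of "p n"] by linarith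
      then show ?thesis using d(1) by (simp add: field_simps)
    qed
  qed
  have "subdiff.minsel v 0 - 0 \<in> subdiff \<phi> v"
    by (rule subdiff.minsel_limit(1)[OF sequentially_bot p tendsto_const _ bound]) (use z in simp)
  then show ?thesis by auto
qed

end

section \<open>Strong measurability and weak derivatives\<close>

lemma AE_lebesgue_onI_countable:
  assumes "S \<in> sets lebesgue" "countable N" "\<And>t. t \<in> S \<Longrightarrow> t \<notin> N \<Longrightarrow> P (t::real)"
  shows "AE t in lebesgue_on S. P t"
proof -
  have "N \<in> null_sets lebesgue"
    using negligible_countable[OF assms(2)] by (simp add: negligible_iff_null_sets)
  then have "AE t in lebesgue. t \<notin> N" by (rule AE_not_in)
  then show ?thesis using assms by (auto simp: AE_restrict_space_iff elim: eventually_mono)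
qed

text \<open>Discretising the time instead of the values gives simple functions for any range. The
  rounded times may leave \<open>S\<close>, which is harmless because continuity at \<open>t\<close>
  refers to the whole line.\<close>

lemma strongly_measurable_on_continuous_off_countable:
  assumes S: "S \<in> sets lebesgue" and N: "countable N"
    and cont: "\<And>t. t \<in> S \<Longrightarrow> t \<notin> N \<Longrightarrow> isCont u t"
  shows "strongly_measurable_on S u"
proof -
  \<comment> \<open>Clamping to \<open>[-n, n]\<close> leaves finitely many grid points of mesh
    \<open>1 / (n + 1)\<close>.\<close>
  define d :: "nat \<Rightarrow> real \<Rightarrow> real"
    where "d n t = real_of_int \<lfloor>real (Suc n) * max (- real n) (min (real n) t)\<rfloor> / real (Suc n)" for n t
  have simple: "simple_function (lebesgue_on S) (d n)" for n
  proof (rule simple_function_borel_measurable)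
    have "d n \<in> borel_measurable borel"
      unfolding d_def by measurable
    then have "d n \<in> borel_measurable lebesgue" by (intro measurable_completion) simp
    then show "d n \<in> borel_measurable (lebesgue_on S)" by (rule measurable_restrict_space1)
    let ?K = "{- int (Suc n * n) .. int (Suc n * n)}"
    have "d n t \<in> (\<lambda>k. real_of_int k / real (Suc n)) ` ?K" for t
    proof -
      define c where "c = max (- real n) (min (real n) t)"
      have c: "- real n \<le> c" "c \<le> real n" by (auto simp: c_def)
      have "real (Suc n) * c \<le> real (Suc n) * real n" "real (Suc n) * (- real n) \<le> real (Suc n) * c"
        by (rule mult_left_mono[OF c(2)], simp) (rule mult_left_mono[OF c(1)], simp)
      then have "real (Suc n) * c \<le> real_of_int (int (Suc n * n))" "real_of_int (- int (Suc n * n)) \<le> real (Suc n) * c"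
        by (simp_all only: of_nat_mult of_int_minus of_int_mult of_int_of_nat_eq mult_minus_right)
      then have "\<lfloor>real (Suc n) * c\<rfloor> \<in> ?K"
        by (simp add: le_floor_iff floor_le_iff del: of_nat_Suc of_nat_mult) 
      then show ?thesis unfolding d_def c_def[symmetric] by blast
    qed
    then have "d n ` space (lebesgue_on S) \<subseteq> (\<lambda>k. real_of_int k / real (Suc n)) ` ?K" by blast
    then show "finite (d n ` space (lebesgue_on S))" by (rule finite_subset) simp
  qed
  have lim: "(\<lambda>n. d n t) \<longlonglongrightarrow> t" for t
  proof (rule LIM_zero_cancel, rule Lim_null_comparison)
    obtain M :: nat where M: "\<bar>t\<bar> \<le> real M" using real_arch_simple by blast
    show "\<forall>\<^sub>F n in sequentially. norm (d n t - t) \<le> inverse (real (Suc n))"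
      using eventually_ge_at_top[of M]
    proof eventually_elim
      case (elim n)
      then have "max (- real n) (min (real n) t) = t" using M by auto
      then have "d n t - t = (real_of_int \<lfloor>real (Suc n) * t\<rfloor> - real (Suc n) * t) / real (Suc n)"
        by (simp add: d_def diff_divide_distrib)
      moreover have "\<bar>real_of_int \<lfloor>real (Suc n) * t\<rfloor> - real (Suc n) * t\<bar> \<le> 1"
        by linarith
      ultimately show ?case by (simp add: divide_inverse abs_mult mult_left_le_one_le)
    qed
    show "(\<lambda>n. inverse (real (Suc n))) \<longlonglongrightarrow> 0" by (rule LIMSEQ_inverse_real_of_nat)
  qed
  show ?thesis unfolding strongly_measurable_on_def
  proof (intro exI[of _ "\<lambda>n. u \<circ> d n"] conjI allI)
    show "simple_function (lebesgue_on S) (u \<circ> d n)" for n using simple by (rule simple_function_compose)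
    show "AE t in lebesgue_on S. (\<lambda>n. (u \<circ> d n) t) \<longlonglongrightarrow> u t"
      by (rule AE_lebesgue_onI_countable[OF S N])
        (use cont in \<open>auto simp: o_def intro!: isCont_tendsto_compose lim\<close>)
  qed
qed

text \<open>The norms of the simple functions are real and measurable; completeness of Lebesgue
  measure takes care of the null set where they need not converge, after extension by 0 outside
  \<open>S\<close>.\<close>

lemma strongly_measurable_on_norm:
  fixes u :: "real \<Rightarrow> 'a::real_normed_vector"
  assumes S: "S \<in> sets lebesgue" and u: "strongly_measurable_on S u"
  shows "(\<lambda>t. norm (u t)) \<in> borel_measurable (lebesgue_on S)"
proof -
  obtain s where s: "\<And>n. simple_function (lebesgue_on S) (s n)"
    "AE t in lebesgue_on S. (\<lambda>n. s n t) \<longlonglongrightarrow> u t"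
    using u by (auto simp: strongly_measurable_on_def)
  have m: "(\<lambda>t. norm (s n t)) \<in> borel_measurable (lebesgue_on S)" for n
    using borel_measurable_simple_function[OF simple_function_compose[OF s(1)], of norm] by (simp add: o_def)
  define g where "g t = lim (\<lambda>n. norm (s n t))" for t
  have g: "g \<in> borel_measurable (lebesgue_on S)"
    unfolding g_def[abs_def] by (rule borel_measurable_lim_metric) (rule m)
  have ae: "AE t in lebesgue_on S. g t = norm (u t)"
    using s(2) by eventually_elim (auto simp: g_def intro!: limI tendsto_norm)
  have "(\<lambda>t. if t \<in> S then g t else 0) \<in> borel_measurable lebesgue"
    using g S by (simp add: borel_measurable_if)
  moreover have "AE t in lebesgue. (if t \<in> S then g t else 0) = (if t \<in> S then norm (u t) else 0)"
    using ae S by (auto simp: AE_restrict_space_iff elim: eventually_mono)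
  ultimately have "(\<lambda>t. if t \<in> S then norm (u t) else 0) \<in> borel_measurable lebesgue"
    by (rule borel_measurable_AE)
  then show ?thesis using S by (simp add: borel_measurable_if)
qed

lemma Linf_imp_L2:
  fixes u :: "real \<Rightarrow> 'a::real_normed_vector"
  assumes "S \<in> lmeasurable" "u \<in> Linf S"
  shows "u \<in> L2 S"
proof -
  obtain C where C: "strongly_measurable_on S u" "AE t in lebesgue_on S. norm (u t) \<le> C"
    using assms(2) by (auto simp: Linf_def)
  have S: "S \<in> sets lebesgue" using assms(1) by auto
  interpret finite_measure "lebesgue_on S" using assms(1) by (rule finite_measure_lebesgue_on)
  have "integrable (lebesgue_on S) (\<lambda>t. (norm (u t))\<^sup>2)"
  proof (rule integrable_const_bound)
    show "AE t in lebesgue_on S. norm ((norm (u t))\<^sup>2) \<le> C\<^sup>2"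
      using C(2) by eventually_elim (auto intro: power_mono)
    show "(\<lambda>t. (norm (u t))\<^sup>2) \<in> borel_measurable (lebesgue_on S)"
      by (intro borel_measurable_power strongly_measurable_on_norm S C)
  qed
  then show ?thesis using C by (simp add: L2_def)
qed

lemma L2_norm_integrable:
  fixes u :: "real \<Rightarrow> 'a::real_normed_vector"
  assumes "S \<in> lmeasurable" "u \<in> L2 S"
  shows "integrable (lebesgue_on S) (\<lambda>t. norm (u t))"
proof -
  have S: "S \<in> sets lebesgue" using assms(1) by auto
  interpret finite_measure "lebesgue_on S" using assms(1) by (rule finite_measure_lebesgue_on)
  show ?thesis
  proof (rule Bochner_Integration.integrable_bound)
    show "integrable (lebesgue_on S) (\<lambda>t. 1 + (norm (u t))\<^sup>2)"
      using assms(2) by (intro Bochner_Integration.integrable_add) (auto simp: L2_def)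
    show "(\<lambda>t. norm (u t)) \<in> borel_measurable (lebesgue_on S)"
      using assms(2) by (intro strongly_measurable_on_norm S) (auto simp: L2_def)
    have "x \<le> 1 + x\<^sup>2" for x :: real
      using sum_squares_bound[of 1 x] zero_le_power2[of x] by (simp add: power2_eq_square) (smt (verit) zero_le_square)
    then show "AE t in lebesgue_on S. norm (norm (u t)) \<le> norm (1 + (norm (u t))\<^sup>2)"
      by (intro always_eventually) simp
  qed
qed

lemma Linf_bounded_continuous_off_countable:
  assumes "S \<in> sets lebesgue" "countable N" "\<And>t. t \<in> S \<Longrightarrow> t \<notin> N \<Longrightarrow> isCont u t"
    "\<And>t. t \<in> S \<Longrightarrow> norm (u t) \<le> C"
  shows "u \<in> Linf S"
  unfolding Linf_def
  using strongly_measurable_on_continuous_off_countable[OF assms(1-3)] assms(4)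
  by (auto intro!: exI[of _ C] AE_I2)

text \<open>The product rule for \<open>\<psi> *\<^sub>R u\<close> is integrated, with no boundary
  terms because \<open>\<psi>\<close> vanishes at 0 and \<open>T\<close>. Integrability of
  \<open>\<psi> *\<^sub>R g\<close> comes out as that of a difference.\<close>

lemma weak_derivative_of_derivative_off_countable:
  fixes u :: "real \<Rightarrow> 'a::banach"
  assumes "countable N" "0 < T" "continuous_on {0..T} u"
    and "\<And>t. 0 < t \<Longrightarrow> t < T \<Longrightarrow> t \<notin> N \<Longrightarrow> (u has_vector_derivative g t) (at t)"
  shows "weak_derivative {0<..<T} u g"
  unfolding weak_derivative_def
proof (intro allI impI)
  fix \<psi> \<psi>' assume tf: "test_function {0<..<T} \<psi> \<psi>'"
  then have \<psi>: "\<And>t. (\<psi> has_real_derivative \<psi>' t) (at t)" "continuous_on UNIV \<psi>'" "\<psi> 0 = 0" "\<psi> T = 0"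
    unfolding test_function_def by (auto simp: subset_iff)
  have c\<psi>: "continuous_on A \<psi>" for A
    using \<psi>(1) DERIV_isCont by (intro continuous_at_imp_continuous_on) blast
  have 1: "((\<lambda>t. \<psi> t *\<^sub>R g t + \<psi>' t *\<^sub>R u t) has_integral \<psi> T *\<^sub>R u T - \<psi> 0 *\<^sub>R u 0) {0..T}"
  proof (rule fundamental_theorem_of_calculus_countable[OF assms(1)])
    show "continuous_on {0..T} (\<lambda>t. \<psi> t *\<^sub>R u t)" by (intro continuous_intros c\<psi> assms)
    show "((\<lambda>t. \<psi> t *\<^sub>R u t) has_vector_derivative \<psi> t *\<^sub>R g t + \<psi>' t *\<^sub>R u t) (at t)" if "t \<in> {0<..<T} - N" for t
      using that by (intro has_vector_derivative_scaleR \<psi> assms) auto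
  qed (use assms in auto)
  have "(\<lambda>t. \<psi>' t *\<^sub>R u t) integrable_on {0..T}"
    by (intro integrable_continuous_real continuous_intros assms continuous_on_subset[OF \<psi>(2)]) auto
  then have 2: "((\<lambda>t. \<psi>' t *\<^sub>R u t) has_integral integral {0..T} (\<lambda>t. \<psi>' t *\<^sub>R u t)) {0..T}" by (rule integrable_integral)
  have "((\<lambda>t. \<psi> t *\<^sub>R g t) has_integral - integral {0..T} (\<lambda>t. \<psi>' t *\<^sub>R u t)) {0..T}"
    using has_integral_diff[OF 1 2] \<psi> by simp
  with 2 show "\<exists>J. ((\<lambda>t. \<psi>' t *\<^sub>R u t) has_integral J) {0<..<T} \<and> ((\<lambda>t. \<psi> t *\<^sub>R g t) has_integral - J) {0<..<T}"
    unfolding has_integral_Icc_iff_Ioo by blast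
qed

section \<open>Continuously differentiable cut-offs and integration of weak derivatives\<close>

lemma DERIV_square_positive_part:
  "((\<lambda>s. (max 0 s)\<^sup>2) has_real_derivative 2 * max 0 s) (at (s::real))"
proof -
  consider "s < 0" | "s = 0" | "0 < s" by linarith
  then show ?thesis
  proof cases
    case 1
    have "((\<lambda>s::real. 0) has_real_derivative 2 * max 0 s) (at s)" using 1 by simp
    then show ?thesis
      by (rule DERIV_cong_ev[THEN iffD1, rotated -1, OF _ refl _ refl])
        (use 1 eventually_nhds_in_open[of "{..<0}" s] in \<open>auto elim: eventually_mono\<close>)
  next
    case 3
    have "((\<lambda>s. s\<^sup>2) has_real_derivative 2 * max 0 s) (at s)"
      using 3 by (auto intro!: derivative_eq_intros)
    then show ?thesis
      by (rule DERIV_cong_ev[THEN iffD1, rotated -1, OF _ refl _ refl])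
        (use 3 eventually_nhds_in_open[of "{0<..}" s] in \<open>auto elim: eventually_mono\<close>)
  next
    case 2
    have "((\<lambda>h::real. (max 0 h)\<^sup>2 / h) \<longlongrightarrow> 0) (at 0)"
    proof (rule Lim_null_comparison)
      show "\<forall>\<^sub>F h in at 0. norm ((max 0 h)\<^sup>2 / h) \<le> \<bar>h\<bar>" for h :: real
        by (intro always_eventually) (auto simp: max_def power2_eq_square)
      show "((\<lambda>h::real. \<bar>h\<bar>) \<longlongrightarrow> 0) (at 0)" by (rule tendsto_eq_intros refl | simp)+
    qed
    then show ?thesis using 2 by (simp add: DERIV_def)
  qed
qed

text \<open>A second difference of the squared positive part is a continuously differentiable ramp from 0
  to 1 on \<open>[0, 2]\<close>.\<close>

definition ramp :: "real \<Rightarrow> real" where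
  "ramp s = ((max 0 s)\<^sup>2 - 2 * (max 0 (s - 1))\<^sup>2 + (max 0 (s - 2))\<^sup>2) / 2"

definition ramp' :: "real \<Rightarrow> real" where
  "ramp' s = max 0 s - 2 * max 0 (s - 1) + max 0 (s - 2)"

lemma ramp_simps: "s \<le> 0 \<Longrightarrow> ramp s = 0" "2 \<le> s \<Longrightarrow> ramp s = 1"
  "s \<le> 0 \<Longrightarrow> ramp' s = 0" "2 \<le> s \<Longrightarrow> ramp' s = 0"
  by (simp_all add: ramp_def ramp'_def power2_eq_square algebra_simps)

lemma ramp'_nonneg: "0 \<le> ramp' s"
  by (simp add: ramp'_def max_def)

lemma DERIV_ramp: "(ramp has_real_derivative ramp' s) (at s)"
proof -
  have p: "((\<lambda>s. (max 0 (s - k))\<^sup>2) has_real_derivative 2 * max 0 (s - k) * (1 - 0)) (at s)" for k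
    by (rule DERIV_chain2[OF DERIV_square_positive_part]) (intro DERIV_diff DERIV_ident DERIV_const)
  have "(ramp has_real_derivative
      (2 * max 0 (s - 0) * (1 - 0) - 2 * (2 * max 0 (s - 1) * (1 - 0)) + 2 * max 0 (s - 2) * (1 - 0)) / 2) (at s)"
    unfolding ramp_def[abs_def] using p[of 0]
    by (intro DERIV_cdivide DERIV_add DERIV_diff DERIV_cmult p) simp
  then show ?thesis by (rule DERIV_cong) (simp add: ramp'_def)
qed

lemma ramp_bounds: "0 \<le> ramp s" "ramp s \<le> 1"
proof -
  have m: "ramp a \<le> ramp b" if "a \<le> b" for a b
    by (rule DERIV_nonneg_imp_nondecreasing[OF that]) (use DERIV_ramp ramp'_nonneg in blast)
  show "0 \<le> ramp s" using m[of "min s 0" s] by (simp add: ramp_simps)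
  show "ramp s \<le> 1" using m[of s "max s 2"] by (simp add: ramp_simps)
qed

lemma continuous_on_ramp': "continuous_on A ramp'"
  unfolding ramp'_def[abs_def] by (intro continuous_intros)

lemma integral_split_plateau:
  fixes f :: "real \<Rightarrow> 'a::banach"
  assumes f: "f integrable_on {0..T}" and ord: "0 \<le> a - \<epsilon>" "0 \<le> \<epsilon>" "a \<le> b" "b + \<epsilon> \<le> T"
    and out: "\<And>t. t < a - \<epsilon> \<or> b + \<epsilon> < t \<Longrightarrow> f t = 0"
  shows "integral {0..T} f = integral {a - \<epsilon>..a} f + integral {a..b} f + integral {b..b + \<epsilon>} f"
proof -
  have i: "f integrable_on {c..d}" if "0 \<le> c" "d \<le> T" for c d
    using f by (rule integrable_subinterval_real) (use that in auto)
  have "(f has_integral integral {a - \<epsilon>..b + \<epsilon>} f) {a - \<epsilon>..b + \<epsilon>}" 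
    using ord by (intro integrable_integral i) auto
  then have "(f has_integral integral {a - \<epsilon>..b + \<epsilon>} f) {0..T}"
    by (rule has_integral_on_superset) (use ord out in auto)
  then have "integral {0..T} f = integral {a - \<epsilon>..b + \<epsilon>} f" by (rule integral_unique)
  also have "\<dots> = integral {a - \<epsilon>..a} f + integral {a..b + \<epsilon>} f"
    using ord by (intro Henstock_Kurzweil_Integration.integral_combine[symmetric] i) auto
  also have "integral {a..b + \<epsilon>} f = integral {a..b} f + integral {b..b + \<epsilon>} f"
    using ord by (intro Henstock_Kurzweil_Integration.integral_combine[symmetric] i) auto
  finally show ?thesis by simp
qed

text \<open>Since the kernel has mass 1, subtracting \<open>c\<close> under the integral leaves a
  weighted average of \<open>u - c\<close>.\<close>

lemma weighted_average_close:
  fixes u :: "real \<Rightarrow> 'a::banach"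
  assumes ab: "a \<le> b" and k: "(k has_integral 1) {a..b}" "continuous_on {a..b} k" "\<And>t. t \<in> {a..b} \<Longrightarrow> 0 \<le> k t"
    and u: "continuous_on {a..b} u" "\<And>t. t \<in> {a..b} \<Longrightarrow> norm (u t - c) \<le> e"
  shows "norm (integral {a..b} (\<lambda>t. k t *\<^sub>R u t) - c) \<le> e"
proof -
  have i: "(\<lambda>t. k t *\<^sub>R u t) integrable_on {a..b}" by (intro integrable_continuous_real continuous_intros k u)
  have c: "((\<lambda>t. k t *\<^sub>R c) has_integral 1 *\<^sub>R c) {a..b}"
    using has_integral_linear[OF k(1) bounded_linear_scaleR_left[of c]] by (simp add: o_def)
  have "((\<lambda>t. k t *\<^sub>R u t - k t *\<^sub>R c) has_integral integral {a..b} (\<lambda>t. k t *\<^sub>R u t) - 1 *\<^sub>R c) {a..b}"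
    by (intro has_integral_diff integrable_integral i c)
  then have I: "((\<lambda>t. k t *\<^sub>R (u t - c)) has_integral integral {a..b} (\<lambda>t. k t *\<^sub>R u t) - c) {a..b}"
    by (simp add: scaleR_diff_right)
  have K: "((\<lambda>t. k t * e) has_integral 1 * e) {a..b}" by (rule has_integral_mult_left[OF k(1)])
  have "norm (integral {a..b} (\<lambda>t. k t *\<^sub>R (u t - c))) \<le> integral {a..b} (\<lambda>t. k t * e)"
  proof (rule Henstock_Kurzweil_Integration.integral_norm_bound_integral)
    show "norm (k t *\<^sub>R (u t - c)) \<le> k t * e" if "t \<in> {a..b}" for t
      using k(3)[OF that] u(2)[OF that] by (simp add: mult_left_mono)
  qed (use I K in blast)+
  then show ?thesis unfolding integral_unique[OF I] integral_unique[OF K] by simp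
qed

text \<open>The test functions are trapezoids: 1 on \<open>[a, b]\<close>, with ramps of width \<open>\<epsilon>\<close> on both sides.\<close>

lemma has_integral_of_weak_derivative:
  fixes u :: "real \<Rightarrow> 'a::banach"
  assumes wd: "weak_derivative {0<..<T} u w" and u: "continuous_on {0..T} u"
    and w: "integrable (lebesgue_on {0<..<T}) (\<lambda>t. norm (w t))"
    and ab: "0 < a" "a < b" "b < T"
  shows "(w has_integral u b - u a) {a..b}"
proof -
  have nw: "(\<lambda>t. norm (w t)) integrable_on {0..T}"
    using integrable_on_lebesgue_on[OF w] by (simp add: integrable_on_Icc_iff_Ioo)
  \<comment> \<open>Each of the two ramps contributes two errors of size \<open>e\<close>: the
    weighted average of \<open>u\<close> against its endpoint value, and the part of
    \<open>w\<close> that it carries.\<close>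
  have main: "w integrable_on {a..b} \<and> norm (integral {a..b} w - (u b - u a)) \<le> 4 * e" if e: "e > 0" for e
  proof -
    obtain da where da: "da > 0" "\<And>t. t \<in> {0..T} \<Longrightarrow> dist t a < da \<Longrightarrow> dist (u t) (u a) < e"
      using u[unfolded continuous_on_iff, rule_format, of a e] ab e by auto
    obtain db where db: "db > 0" "\<And>t. t \<in> {0..T} \<Longrightarrow> dist t b < db \<Longrightarrow> dist (u t) (u b) < e"
      using u[unfolded continuous_on_iff, rule_format, of b e] ab e by auto
    \<comment> \<open>Continuity of this primitive makes \<open>w\<close> contribute little on short
      ramps, although \<open>w\<close> need not be bounded.\<close>
    define W where "W t = integral {0..t} (\<lambda>t. norm (w t))" for t
    have cW: "continuous_on {0..T} W" unfolding W_def[abs_def] by (rule indefinite_integral_continuous_1[OF nw])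
    obtain dW where dW: "dW > 0" "\<And>t. t \<in> {0..T} \<Longrightarrow> dist t a < dW \<Longrightarrow> dist (W t) (W a) < e"
      using cW[unfolded continuous_on_iff, rule_format, of a e] ab e by auto
    obtain dV where dV: "dV > 0" "\<And>t. t \<in> {0..T} \<Longrightarrow> dist t b < dV \<Longrightarrow> dist (W t) (W b) < e"
      using cW[unfolded continuous_on_iff, rule_format, of b e] ab e by auto
    define \<epsilon> where "\<epsilon> = Min {a, T - b, da, db, dW, dV} / 2"
    have \<epsilon>: "0 < \<epsilon>" "\<epsilon> < a" "\<epsilon> < T - b" "\<epsilon> < da" "\<epsilon> < db" "\<epsilon> < dW" "\<epsilon> < dV"
    proof -
      have m: "0 < Min {a, T - b, da, db, dW, dV}" using ab da db dW dV by simp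
      then show "0 < \<epsilon>" by (simp add: \<epsilon>_def)
      have "\<epsilon> < Min {a, T - b, da, db, dW, dV}" using m unfolding \<epsilon>_def by linarith
      then show "\<epsilon> < a" "\<epsilon> < T - b" "\<epsilon> < da" "\<epsilon> < db" "\<epsilon> < dW" "\<epsilon> < dV" by simp_all
    qed
    \<comment> \<open>The factor \<open>2 / \<epsilon>\<close> stretches the ramp interval of width
      \<open>\<epsilon>\<close> to \<open>[0, 2]\<close>; the offset 2 lets the left ramp end at
      \<open>a\<close>, while the right one begins at \<open>b\<close>.\<close>
    define ra where "ra t = ramp (2 / \<epsilon> * (t - a) + 2)" for t
    define rb where "rb t = ramp (2 / \<epsilon> * (t - b))" for t
    define ra' where "ra' t = 2 / \<epsilon> * ramp' (2 / \<epsilon> * (t - a) + 2)" for t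
    define rb' where "rb' t = 2 / \<epsilon> * ramp' (2 / \<epsilon> * (t - b))" for t
    have Da: "(ra has_real_derivative ra' t) (at t)" for t
      unfolding ra_def[abs_def] ra'_def
      by (rule DERIV_cong[OF DERIV_chain2[OF DERIV_ramp]]) (use \<epsilon>(1) in \<open>auto intro!: derivative_eq_intros\<close>)
    have Db: "(rb has_real_derivative rb' t) (at t)" for t
      unfolding rb_def[abs_def] rb'_def
      by (rule DERIV_cong[OF DERIV_chain2[OF DERIV_ramp]]) (use \<epsilon>(1) in \<open>auto intro!: derivative_eq_intros\<close>)
    have ca: "continuous_on A ra'" "continuous_on A rb'" for A
      unfolding ra'_def[abs_def] rb'_def[abs_def]
      by (intro continuous_intros continuous_on_compose2[OF continuous_on_ramp'] subset_UNIV; auto)+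
    have pos: "0 \<le> ra' t" "0 \<le> rb' t" for t
      using \<epsilon>(1) ramp'_nonneg by (auto simp: ra'_def rb'_def)
    have va: "t \<le> a - \<epsilon> \<Longrightarrow> ra t = 0" "t \<le> a - \<epsilon> \<Longrightarrow> ra' t = 0" "a \<le> t \<Longrightarrow> ra t = 1" "a \<le> t \<Longrightarrow> ra' t = 0" for t
    proof -
      show "ra t = 0" "ra' t = 0" if "t \<le> a - \<epsilon>"
      proof -
        have "2 / \<epsilon> * (t - a) + 2 \<le> 2 / \<epsilon> * (- \<epsilon>) + 2"
          using that \<epsilon>(1) by (intro add_right_mono mult_left_mono) auto
        then have "2 / \<epsilon> * (t - a) + 2 \<le> 0" using \<epsilon>(1) by simp
        then show "ra t = 0" "ra' t = 0" unfolding ra_def ra'_def by (simp_all only: ramp_simps mult_zero_right)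
      qed
      show "ra t = 1" "ra' t = 0" if "a \<le> t"
      proof -
        have "2 \<le> 2 / \<epsilon> * (t - a) + 2" using that \<epsilon>(1) by simp
        then show "ra t = 1" "ra' t = 0" unfolding ra_def ra'_def by (simp_all only: ramp_simps mult_zero_right)
      qed
    qed
    have vb: "t \<le> b \<Longrightarrow> rb t = 0" "t \<le> b \<Longrightarrow> rb' t = 0" "b + \<epsilon> \<le> t \<Longrightarrow> rb t = 1" "b + \<epsilon> \<le> t \<Longrightarrow> rb' t = 0" for t
    proof -
      show "rb t = 0" "rb' t = 0" if "t \<le> b"
      proof -
        have "2 / \<epsilon> * (t - b) \<le> 0" using that \<epsilon>(1) by (intro mult_nonneg_nonpos) auto
        then show "rb t = 0" "rb' t = 0" unfolding rb_def rb'_def by (simp_all only: ramp_simps mult_zero_right)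
      qed
      show "rb t = 1" "rb' t = 0" if "b + \<epsilon> \<le> t"
      proof -
        have "2 / \<epsilon> * \<epsilon> \<le> 2 / \<epsilon> * (t - b)" using that \<epsilon>(1) by (intro mult_left_mono) auto
        then have "2 \<le> 2 / \<epsilon> * (t - b)" using \<epsilon>(1) by simp
        then show "rb t = 1" "rb' t = 0" unfolding rb_def rb'_def by (simp_all only: ramp_simps mult_zero_right)
      qed
    qed
    define \<psi> where "\<psi> t = ra t - rb t" for t
    define \<psi>' where "\<psi>' t = ra' t - rb' t" for t
    have "test_function {0<..<T} \<psi> \<psi>'"
      unfolding test_function_def
    proof (intro conjI allI exI[of _ "{a - \<epsilon>..b + \<epsilon>}"] impI)
      show "(\<psi> has_real_derivative \<psi>' t) (at t)" for t
        unfolding \<psi>_def[abs_def] \<psi>'_def by (intro DERIV_diff Da Db)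
      show "continuous_on UNIV \<psi>'" unfolding \<psi>'_def[abs_def] by (intro continuous_intros ca)
      show "\<psi> t = 0" if "t \<notin> {a - \<epsilon>..b + \<epsilon>}" for t
        using that \<epsilon> ab va vb by (cases "t < a - \<epsilon>") (auto simp: \<psi>_def)
    qed (use \<epsilon> in auto)
    then obtain I where I: "((\<lambda>t. \<psi>' t *\<^sub>R u t) has_integral I) {0..T}" "((\<lambda>t. \<psi> t *\<^sub>R w t) has_integral - I) {0..T}"
      using wd unfolding weak_derivative_def has_integral_Icc_iff_Ioo by blast
    have out: "\<psi> t = 0 \<and> \<psi>' t = 0" if "t < a - \<epsilon> \<or> b + \<epsilon> < t" for t
      using that \<epsilon> ab va[of t] vb[of t] by (auto simp: \<psi>_def \<psi>'_def)
    have I1: "I = integral {a - \<epsilon>..a} (\<lambda>t. \<psi>' t *\<^sub>R u t) + integral {a..b} (\<lambda>t. \<psi>' t *\<^sub>R u t)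
        + integral {b..b + \<epsilon>} (\<lambda>t. \<psi>' t *\<^sub>R u t)"
      unfolding integral_unique[OF I(1), symmetric]
      by (rule integral_split_plateau) (use I \<epsilon> ab out in \<open>auto simp: integrable_on_def\<close>)
    have I2: "- I = integral {a - \<epsilon>..a} (\<lambda>t. \<psi> t *\<^sub>R w t) + integral {a..b} (\<lambda>t. \<psi> t *\<^sub>R w t)
        + integral {b..b + \<epsilon>} (\<lambda>t. \<psi> t *\<^sub>R w t)"
      unfolding integral_unique[OF I(2), symmetric]
      by (rule integral_split_plateau) (use I \<epsilon> ab out in \<open>auto simp: integrable_on_def\<close>)
    have e1: "integral {a - \<epsilon>..a} (\<lambda>t. \<psi>' t *\<^sub>R u t) = integral {a - \<epsilon>..a} (\<lambda>t. ra' t *\<^sub>R u t)"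
      using ab vb by (intro integral_cong) (auto simp: \<psi>'_def)
    have e2: "integral {a..b} (\<lambda>t. \<psi>' t *\<^sub>R u t) = integral {a..b} (\<lambda>t. 0)"
      using va vb by (intro integral_cong) (auto simp: \<psi>'_def)
    have e3: "integral {b..b + \<epsilon>} (\<lambda>t. \<psi>' t *\<^sub>R u t) = - integral {b..b + \<epsilon>} (\<lambda>t. rb' t *\<^sub>R u t)"
      unfolding integral_neg[symmetric] using ab va by (intro integral_cong) (auto simp: \<psi>'_def)
    have e4: "integral {a..b} (\<lambda>t. \<psi> t *\<^sub>R w t) = integral {a..b} w"
      using va vb by (intro integral_cong) (auto simp: \<psi>_def)
    have int\<psi>: "(\<lambda>t. \<psi> t *\<^sub>R w t) integrable_on {c..d}" if "0 \<le> c" "d \<le> T" for c d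
      by (rule integrable_subinterval_real[of _ 0 T]) (use I that in \<open>auto simp: integrable_on_def\<close>)
    \<comment> \<open>The test function equals 1 on \<open>[a, b]\<close>, so integrability of
      \<open>w\<close> there is read off from the weak derivative.\<close>
    have wint: "w integrable_on {a..b}"
      using int\<psi>[of a b] ab va vb by (subst integrable_cong[of _ _ "\<lambda>t. \<psi> t *\<^sub>R w t"]) (auto simp: \<psi>_def)
    have A: "norm (integral {a - \<epsilon>..a} (\<lambda>t. ra' t *\<^sub>R u t) - u a) \<le> e"
    proof (rule weighted_average_close)
      have "(ra' has_integral ra a - ra (a - \<epsilon>)) {a - \<epsilon>..a}"
        using Da \<epsilon> by (intro fundamental_theorem_of_calculus)
          (auto simp flip: has_real_derivative_iff_has_vector_derivative intro: has_field_derivative_at_within)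
      then show "(ra' has_integral 1) {a - \<epsilon>..a}" using va \<epsilon> by simp
      show "continuous_on {a - \<epsilon>..a} u" by (rule continuous_on_subset[OF u]) (use \<epsilon> ab in auto)
      show "norm (u t - u a) \<le> e" if "t \<in> {a - \<epsilon>..a}" for t
        using da(2)[of t] that \<epsilon> ab by (auto simp: dist_norm)
    qed (use \<epsilon> ca pos in auto)
    have B: "norm (integral {b..b + \<epsilon>} (\<lambda>t. rb' t *\<^sub>R u t) - u b) \<le> e"
    proof (rule weighted_average_close)
      have "(rb' has_integral rb (b + \<epsilon>) - rb b) {b..b + \<epsilon>}"
        using Db \<epsilon> by (intro fundamental_theorem_of_calculus)
          (auto simp flip: has_real_derivative_iff_has_vector_derivative intro: has_field_derivative_at_within)
      then show "(rb' has_integral 1) {b..b + \<epsilon>}" using vb \<epsilon> by simp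
      show "continuous_on {b..b + \<epsilon>} u" by (rule continuous_on_subset[OF u]) (use \<epsilon> ab in auto)
      show "norm (u t - u b) \<le> e" if "t \<in> {b..b + \<epsilon>}" for t
        using db(2)[of t] that \<epsilon> ab by (auto simp: dist_norm)
    qed (use \<epsilon> ca pos in auto)
    have \<psi>1: "\<bar>\<psi> t\<bar> \<le> 1" for t
      using ramp_bounds[of "2 / \<epsilon> * (t - a) + 2"] ramp_bounds[of "2 / \<epsilon> * (t - b)"]
      by (auto simp: \<psi>_def ra_def rb_def)
    have nwi: "(\<lambda>t. norm (w t)) integrable_on {c..d}" if "0 \<le> c" "d \<le> T" for c d
      by (rule integrable_subinterval_real[OF nw]) (use that in auto)
    have bd: "norm (integral {c..d} (\<lambda>t. \<psi> t *\<^sub>R w t)) \<le> W d - W c" if "0 \<le> c" "c \<le> d" "d \<le> T" for c d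
    proof -
      have "norm (integral {c..d} (\<lambda>t. \<psi> t *\<^sub>R w t)) \<le> integral {c..d} (\<lambda>t. norm (w t))"
        using that \<psi>1 by (intro Henstock_Kurzweil_Integration.integral_norm_bound_integral int\<psi> nwi)
          (auto intro: mult_left_le_one_le)
      also have "\<dots> = W d - W c"
        using Henstock_Kurzweil_Integration.integral_combine[of 0 c d "\<lambda>t. norm (w t)"] nwi[of 0 d] that by (simp add: W_def)
      finally show ?thesis .
    qed
    have C: "norm (integral {a - \<epsilon>..a} (\<lambda>t. \<psi> t *\<^sub>R w t)) \<le> e"
      using bd[of "a - \<epsilon>" a] dW(2)[of "a - \<epsilon>"] \<epsilon> ab by (auto simp: dist_real_def)
    have D: "norm (integral {b..b + \<epsilon>} (\<lambda>t. \<psi> t *\<^sub>R w t)) \<le> e"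
      using bd[of b "b + \<epsilon>"] dV(2)[of "b + \<epsilon>"] \<epsilon> ab by (auto simp: dist_real_def)
    have eq: "integral {a..b} w - (u b - u a) =
        (integral {b..b + \<epsilon>} (\<lambda>t. rb' t *\<^sub>R u t) - u b) - (integral {a - \<epsilon>..a} (\<lambda>t. ra' t *\<^sub>R u t) - u a)
        - integral {a - \<epsilon>..a} (\<lambda>t. \<psi> t *\<^sub>R w t) - integral {b..b + \<epsilon>} (\<lambda>t. \<psi> t *\<^sub>R w t)"
    proof -
      have solve: "w0 = - i - c0 - d0" if "- i = c0 + w0 + d0" for i c0 w0 d0 :: 'a using that by simp
      show ?thesis
        unfolding solve[OF I2[unfolded e4]] unfolding I1 e1 e2 e3 by simp
    qed
    have "norm (integral {a..b} w - (u b - u a)) \<le> e + e + e + e"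
      unfolding eq by (intro order_trans[OF norm_triangle_ineq4] add_mono A B C D)
    then show ?thesis using wint by simp
  qed
  have "norm (integral {a..b} w - (u b - u a)) \<le> 0"
  proof (rule field_le_epsilon)
    show "norm (integral {a..b} w - (u b - u a)) \<le> 0 + e" if "0 < e" for e
      using main[of "e / 4"] that by simp
  qed
  then show ?thesis using main[of 1] by (simp add: has_integral_integrable_integral)
qed

text \<open>Induction on the number of steps of length \<open>\<delta>\<close> that lead from
  \<open>a\<close> to the given time.\<close>

lemma nonincreasing_of_local:
  fixes H :: "real \<Rightarrow> real"
  assumes "0 < \<delta>" and loc: "\<And>s t. a \<le> s \<Longrightarrow> s \<le> t \<Longrightarrow> t \<le> b \<Longrightarrow> t - s \<le> \<delta> \<Longrightarrow> H t \<le> H s" and "a \<le> b"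
  shows "H b \<le> H a"
proof -
  have *: "H t \<le> H a" if "a \<le> t" "t \<le> b" "t - a \<le> real n * \<delta>" for n t
    using that
  proof (induction n arbitrary: t)
    case (Suc n)
    define s where "s = max a (t - \<delta>)"
    have "H s \<le> H a" using Suc.prems \<open>0 < \<delta>\<close> by (intro Suc.IH) (auto simp: s_def algebra_simps)
    moreover have "H t \<le> H s" using Suc.prems \<open>0 < \<delta>\<close> by (intro loc) (auto simp: s_def)
    ultimately show ?case by simp
  qed simp
  obtain n where "(b - a) / \<delta> \<le> real n" using real_arch_simple by blast
  then show ?thesis using assms by (intro *[of b n]) (auto simp: field_simps)
qed

lemma has_integral_le_off_negligible:
  fixes f g :: "real \<Rightarrow> real"
  assumes "(f has_integral i) S" "(g has_integral j) S" "negligible N"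
    "\<And>t. t \<in> S \<Longrightarrow> t \<notin> N \<Longrightarrow> f t \<le> g t"
  shows "i \<le> j"
proof (rule has_integral_le[OF _ assms(2)])
  show "((\<lambda>t. if t \<in> N then g t else f t) has_integral i) S"
    by (rule has_integral_spike[OF assms(3) _ assms(1)]) auto
qed (use assms in auto)

section \<open>Uniqueness\<close>

text \<open>Only the integrated equation for \<open>d\<close> is available, so the growth of \<open>|d|\<^sup>2\<close> is estimated on
  short intervals from \<open>|d t|\<^sup>2 - |d s|\<^sup>2 = \<langle>d t - d s, d t + d s\<rangle>\<close>.\<close>

lemma one_sided_gronwall:
  fixes d w :: "real \<Rightarrow> 'a::{real_inner,banach}"
  assumes d: "continuous_on {0..T} d" and d0: "d 0 = 0"
    and int: "\<And>a b. 0 < a \<Longrightarrow> a < b \<Longrightarrow> b < T \<Longrightarrow> (w has_integral d b - d a) {a..b}"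
    and m: "m integrable_on {0..T}" "\<And>t. 0 < t \<Longrightarrow> t < T \<Longrightarrow> norm (w t) \<le> m t"
    and N: "negligible N" and diss: "\<And>t. 0 < t \<Longrightarrow> t < T \<Longrightarrow> t \<notin> N \<Longrightarrow> w t \<bullet> d t \<le> L * (norm (d t))\<^sup>2"
    and L: "0 \<le> L" and t: "0 \<le> t" "t < T"
  shows "d t = 0"
proof -
  define y where "y t = (norm (d t))\<^sup>2" for t
  have cy: "continuous_on {0..T} y" unfolding y_def[abs_def] by (intro continuous_intros d)
  have iy: "y integrable_on {a..b}" if "0 \<le> a" "b \<le> T" for a b
    by (intro integrable_continuous_real continuous_on_subset[OF cy]) (use that in auto)
  have im: "m integrable_on {a..b}" if "0 \<le> a" "b \<le> T" for a b
    by (rule integrable_subinterval_real[OF m(1)]) (use that in auto)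
  \<comment> \<open>The term with \<open>e\<close> is the price of replacing
    \<open>d t + d s\<close> by \<open>2 *\<^sub>R d \<tau>\<close> on short intervals; it
    disappears in \<open>step2\<close>.\<close>
  have step: "y b \<le> y a + (2 * L * integral {a..b} y + 2 * e * integral {a..b} m)"
    if ab: "0 < a" "a \<le> b" "b < T" and e: "0 < e" for a b e
  proof -
    define g where "g t = 2 * L * y t + 2 * e * m t" for t
    have ig: "g integrable_on {s..t}" if "0 \<le> s" "t \<le> T" for s t
      unfolding g_def[abs_def] using that by (intro integrable_add integrable_on_mult_right iy im)
    define H where "H t = y t - integral {a..t} g" for t
    have "uniformly_continuous_on {0..T} d" by (rule compact_uniformly_continuous[OF d]) simp
    then obtain \<delta> where \<delta>: "\<delta> > 0" "\<And>s t. s \<in> {0..T} \<Longrightarrow> t \<in> {0..T} \<Longrightarrow> dist t s < \<delta> \<Longrightarrow> dist (d t) (d s) < e"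
      unfolding uniformly_continuous_on_def using e by meson
    have "H b \<le> H a"
    proof (rule nonincreasing_of_local[where H = H and \<delta> = "\<delta> / 2"])
      fix s t assume st: "a \<le> s" "s \<le> t" "t \<le> b" "t - s \<le> \<delta> / 2"
      show "H t \<le> H s"
      proof (cases "s = t")
        case False
        then have lt: "s < t" using st by simp
        have 1: "((\<lambda>\<tau>. w \<tau> \<bullet> (d t + d s)) has_integral (d t - d s) \<bullet> (d t + d s)) {s..t}"
          using has_integral_linear[OF int[of s t] bounded_linear_inner_left] lt st ab by (simp add: o_def)
        have 2: "(g has_integral integral {s..t} g) {s..t}"
          using st ab by (intro integrable_integral ig) auto
        have "(d t - d s) \<bullet> (d t + d s) \<le> integral {s..t} g"
        proof (rule has_integral_le_off_negligible[OF 1 2 N])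
          fix \<tau> assume \<tau>: "\<tau> \<in> {s..t}" "\<tau> \<notin> N"
          have r: "0 < \<tau>" "\<tau> < T" using \<tau> st ab by auto
          have "\<bar>t - \<tau>\<bar> < \<delta>" "\<bar>s - \<tau>\<bar> < \<delta>" using \<tau> st \<delta>(1) by auto
          then have c: "norm (d t - d \<tau>) \<le> e" "norm (d s - d \<tau>) \<le> e"
            using \<delta>(2)[of \<tau> t] \<delta>(2)[of \<tau> s] \<tau> st ab by (auto simp: dist_norm)
          \<comment> \<open>The dissipation hypothesis pairs \<open>w \<tau>\<close> with
            \<open>d\<close> at the same time \<open>\<tau>\<close> only; uniform continuity bounds
            the remaining difference by \<open>2 * e\<close>.\<close>
          have "w \<tau> \<bullet> (d t + d s) = 2 * (w \<tau> \<bullet> d \<tau>) + w \<tau> \<bullet> ((d t - d \<tau>) + (d s - d \<tau>))"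
            by (simp add: inner_add inner_diff)
          also have "w \<tau> \<bullet> d \<tau> \<le> L * y \<tau>" using diss[OF r \<tau>(2)] by (simp add: y_def)
          also have "w \<tau> \<bullet> ((d t - d \<tau>) + (d s - d \<tau>)) \<le> norm (w \<tau>) * norm ((d t - d \<tau>) + (d s - d \<tau>))"
            by (rule norm_cauchy_schwarz)
          also have "\<dots> \<le> m \<tau> * (e + e)"
          proof (rule mult_mono)
            show "norm ((d t - d \<tau>) + (d s - d \<tau>)) \<le> e + e"
              using norm_triangle_ineq[of "d t - d \<tau>" "d s - d \<tau>"] c by linarith
          qed (use m(2)[OF r] norm_ge_zero[of "w \<tau>"] in \<open>linarith | simp\<close>)+
          finally show "w \<tau> \<bullet> (d t + d s) \<le> g \<tau>" by (simp add: g_def algebra_simps)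
        qed
        moreover have "(d t - d s) \<bullet> (d t + d s) = y t - y s"
          by (simp add: y_def power2_norm_eq_inner inner_add inner_diff inner_commute)
        moreover have "integral {a..s} g + integral {s..t} g = integral {a..t} g"
          using st ab by (intro Henstock_Kurzweil_Integration.integral_combine ig) auto
        ultimately show ?thesis by (simp add: H_def)
      qed simp
    qed (use \<delta> ab in auto)
    then have "y b \<le> y a + integral {a..b} g" by (simp add: H_def)
    also have "integral {a..b} g = 2 * L * integral {a..b} y + 2 * e * integral {a..b} m"
      unfolding g_def[abs_def] using ab by (simp add: integral_add integrable_on_mult_right iy im)
    finally show ?thesis .
  qed
  define Z where "Z t = integral {0..t} y" for t
  have step2: "y b \<le> y a + 2 * L * Z b" if ab: "0 < a" "a \<le> b" "b < T" for a b
  proof (rule field_le_epsilon)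
    fix e :: real assume e: "0 < e"
    \<comment> \<open>Applying \<open>step\<close> with \<open>e / M\<close> absorbs the integral of
      \<open>m\<close>, which does not depend on \<open>e\<close>.\<close>
    define M where "M = 2 * \<bar>integral {a..b} m\<bar> + 1"
    have M: "M > 0" by (simp add: M_def)
    have "2 * (e / M) * integral {a..b} m \<le> (e / M) * M"
      using e M unfolding mult.commute[of 2] mult.assoc by (intro mult_left_mono) (auto simp: M_def)
    then have "2 * (e / M) * integral {a..b} m \<le> e" using M by simp
    moreover have "integral {a..b} y \<le> Z b"
    proof -
      have "Z b = integral {0..a} y + integral {a..b} y"
        unfolding Z_def using ab by (intro Henstock_Kurzweil_Integration.integral_combine[symmetric] iy) auto
      moreover have "0 \<le> integral {0..a} y"
        using ab by (intro Henstock_Kurzweil_Integration.integral_nonneg iy) (auto simp: y_def)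
      ultimately show ?thesis by simp
    qed
    then have "2 * L * integral {a..b} y \<le> 2 * L * Z b" using L by (intro mult_left_mono) auto
    ultimately show "y b \<le> y a + 2 * L * Z b + e" using step[OF ab, of "e / M"] e M by simp
  qed
  have y0: "y 0 = 0" by (simp add: y_def d0)
  \<comment> \<open>The integrated equation is available only from positive times onwards, so the
    initial condition enters through \<open>a\<close> tending to 0.\<close>
  have step3: "y b \<le> 2 * L * Z b" if b: "0 < b" "b < T" for b
  proof (rule tendsto_lowerbound)
    have "(y \<longlongrightarrow> y 0) (at 0 within {0..T})"
      using cy b unfolding continuous_on_def by auto
    then have "(y \<longlongrightarrow> 0) (at 0 within {0<..<b})"
      unfolding y0 by (rule tendsto_within_subset) (use b in auto)
    then show "((\<lambda>a. y a + 2 * L * Z b) \<longlongrightarrow> 2 * L * Z b) (at 0 within {0<..<b})"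
      by (auto intro!: tendsto_eq_intros)
    show "\<forall>\<^sub>F a in at 0 within {0<..<b}. y b \<le> y a + 2 * L * Z b"
      using step2 b by (auto simp: eventually_at_filter)
    show "at 0 within {0<..<b} \<noteq> bot"
      using b by (simp add: at_within_eq_bot_iff islimpt_greaterThanLessThan1 trivial_limit_def)
        (metis islimpt_greaterThanLessThan1 trivial_limit_within trivial_limit_def)
  qed
  \<comment> \<open>The continuous function \<open>y\<close> need not be differentiable, so the
    integrating factor is applied to its primitive.\<close>
  have Z: "Z b \<le> 0" if b: "0 \<le> b" "b < T" for b
  proof -
    define g where "g t = exp (- 2 * L * t) * Z t" for t
    have "g b \<le> g 0"
    proof (rule DERIV_nonpos_imp_decreasing_open[OF b(1)])
      have "continuous_on {0..b} Z" unfolding Z_def[abs_def]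
        using b by (intro indefinite_integral_continuous_1 iy) auto
      then show "continuous_on {0..b} g" unfolding g_def[abs_def] by (intro continuous_intros)
      fix \<tau> assume \<tau>: "0 < \<tau>" "\<tau> < b"
      have "(Z has_vector_derivative y \<tau>) (at \<tau> within {0..b})"
        unfolding Z_def[abs_def] using \<tau> b
        by (intro integral_has_vector_derivative continuous_on_subset[OF cy]) auto
      moreover have "at \<tau> within {0..b} = at \<tau>" using \<tau> by (intro at_within_interior) simp
      ultimately have Z': "(Z has_real_derivative y \<tau>) (at \<tau>)"
        by (simp add: has_real_derivative_iff_has_vector_derivative)
      have "((\<lambda>t. exp (- 2 * L * t)) has_real_derivative exp (- 2 * L * \<tau>) * (- 2 * L)) (at \<tau>)"
        by (auto intro!: derivative_eq_intros)
      from DERIV_mult[OF this Z'] have "(g has_real_derivative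
          exp (- 2 * L * \<tau>) * (- 2 * L) * Z \<tau> + y \<tau> * exp (- 2 * L * \<tau>)) (at \<tau>)"
        unfolding g_def[abs_def] .
      moreover have "exp (- 2 * L * \<tau>) * (- 2 * L) * Z \<tau> + y \<tau> * exp (- 2 * L * \<tau>) = exp (- 2 * L * \<tau>) * (y \<tau> - 2 * L * Z \<tau>)"
        by (simp add: algebra_simps)
      moreover have "\<dots> \<le> 0" using step3[of \<tau>] \<tau> b by (intro mult_nonneg_nonpos) auto
      ultimately show "\<exists>z. (g has_real_derivative z) (at \<tau>) \<and> z \<le> 0" by metis
    qed
    then show ?thesis by (simp add: g_def Z_def mult_le_0_iff)
  qed
  have "y t \<le> 0"
  proof (cases "t = 0")
    case False
    have "2 * L * Z t \<le> 0" using Z[OF t] L by (intro mult_nonneg_nonpos) auto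
    then show ?thesis using step3[of t] False t by simp
  qed (simp add: y0)
  then show ?thesis by (simp add: y_def)
qed

locale dry_friction = convex_potential \<phi> for \<phi> :: "'a::{real_inner,banach} \<Rightarrow> ereal" +
  fixes \<gamma> \<beta> r :: real and f :: "'a \<Rightarrow> real" and df :: "'a \<Rightarrow> 'a"
  assumes \<gamma>: "0 < \<gamma>" and \<beta>: "0 \<le> \<beta>"
    and gradient: "\<And>z. GDERIV f z :> df z" and df_cont: "continuous_on UNIV df"
    and df_lipschitz: "\<And>B. bounded B \<Longrightarrow> \<exists>L. L-lipschitz_on B df"
    and f_bdd: "bdd_below (range f)"
    and \<phi>_0: "\<phi> 0 = 0" and r: "0 < r" and ball: "cball 0 r \<subseteq> subdiff \<phi> 0"
begin

text \<open>For the difference in the product space, monotonicity and damping remove the selections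
  and the \<open>\<gamma>\<close> terms with the right sign. The coupling of position and velocity
  and the gradient remain, both Lipschitz.\<close>

lemma strong_solution_unique:
  assumes T: "0 < T" and s1: "strong_solution \<gamma> \<beta> \<phi> df x0 v0 T x v"
    and s2: "strong_solution \<gamma> \<beta> \<phi> df x0 v0 T x' v'" and t: "0 \<le> t" "t < T"
  shows "x t = x' t" "v t = v' t"
proof -
  let ?I = "{0<..<T}"
  obtain w \<xi> where 1: "w \<in> L2 ?I" "weak_derivative ?I v w" "inclusion_ae \<gamma> \<beta> \<phi> df T x v w \<xi>"
    using s1 by (auto simp: strong_solution_def)
  obtain w' \<xi>' where 2: "w' \<in> L2 ?I" "weak_derivative ?I v' w'" "inclusion_ae \<gamma> \<beta> \<phi> df T x' v' w' \<xi>'"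
    using s2 by (auto simp: strong_solution_def)
  have c: "continuous_on {0..T} x" "continuous_on {0..T} v" "continuous_on {0..T} x'" "continuous_on {0..T} v'"
    and wd: "weak_derivative ?I x v" "weak_derivative ?I x' v'"
    and init: "x 0 = x0" "x' 0 = x0" "v 0 = v0" "v' 0 = v0"
    and L2: "v \<in> L2 ?I" "v' \<in> L2 ?I"
    using s1 s2 by (auto simp: strong_solution_def W12_def)
  have I: "?I \<in> lmeasurable" by simp
  note ni = L2_norm_integrable[OF I]
  define d where "d t = (x t - x' t, v t - v' t)" for t
  define W where "W t = (v t - v' t, w t - w' t)" for t
  define m where "m t = norm (v t) + norm (v' t) + (norm (w t) + norm (w' t))" for t
  \<comment> \<open>Both curves are compact, so a Lipschitz constant of \<open>df\<close> on bounded
    sets serves for the whole interval.\<close>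
  define yB where "yB = (\<lambda>t. x t + \<beta> *\<^sub>R v t) ` {0..T} \<union> (\<lambda>t. x' t + \<beta> *\<^sub>R v' t) ` {0..T}"
  have "bounded yB" unfolding yB_def
    by (intro bounded_Un[THEN iffD2] conjI compact_imp_bounded compact_continuous_image continuous_intros c) auto
  then obtain K where K: "K-lipschitz_on yB df" using df_lipschitz by blast
  have K0: "0 \<le> K" using K by (rule lipschitz_on_nonneg)
  \<comment> \<open>The 1 pays for the pairing of velocity and position differences, the other term
    for the gradient at \<open>x + \<beta> v\<close>.\<close>
  define L where "L = 1 + K * (1 + \<beta>)"
  obtain N where N: "negligible N" and NP: "\<And>t. t \<in> ?I \<Longrightarrow> t \<notin> N \<Longrightarrow> 
      (\<xi> t \<in> subdiff \<phi> (v t) \<and> w t + \<gamma> *\<^sub>R v t + \<xi> t + df (x t + \<beta> *\<^sub>R v t) = 0) \<and>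
      (\<xi>' t \<in> subdiff \<phi> (v' t) \<and> w' t + \<gamma> *\<^sub>R v' t + \<xi>' t + df (x' t + \<beta> *\<^sub>R v' t) = 0)"
  proof -
    have "AE t in lebesgue_on ?I. (\<xi> t \<in> subdiff \<phi> (v t) \<and> w t + \<gamma> *\<^sub>R v t + \<xi> t + df (x t + \<beta> *\<^sub>R v t) = 0) \<and>
      (\<xi>' t \<in> subdiff \<phi> (v' t) \<and> w' t + \<gamma> *\<^sub>R v' t + \<xi>' t + df (x' t + \<beta> *\<^sub>R v' t) = 0)"
      using 1(3) 2(3) unfolding inclusion_ae_def by eventually_elim blast
    then have "AE t in lebesgue. t \<in> ?I \<longrightarrow> (\<xi> t \<in> subdiff \<phi> (v t) \<and> w t + \<gamma> *\<^sub>R v t + \<xi> t + df (x t + \<beta> *\<^sub>R v t) = 0) \<and>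
      (\<xi>' t \<in> subdiff \<phi> (v' t) \<and> w' t + \<gamma> *\<^sub>R v' t + \<xi>' t + df (x' t + \<beta> *\<^sub>R v' t) = 0)"
      by (subst (asm) AE_restrict_space_iff) auto
    then obtain N where "N \<in> null_sets lebesgue" "{t. \<not> (t \<in> ?I \<longrightarrow> (\<xi> t \<in> subdiff \<phi> (v t) \<and> w t + \<gamma> *\<^sub>R v t + \<xi> t + df (x t + \<beta> *\<^sub>R v t) = 0) \<and>
      (\<xi>' t \<in> subdiff \<phi> (v' t) \<and> w' t + \<gamma> *\<^sub>R v' t + \<xi>' t + df (x' t + \<beta> *\<^sub>R v' t) = 0))} \<subseteq> N"
      unfolding completion.AE_iff_null_sets eventually_ae_filter by auto
    then show ?thesis by (intro that[of N]) (auto simp: negligible_iff_null_sets)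
  qed
  have "d t = 0"
  proof (rule one_sided_gronwall[where d = d and w = W and m = m and N = N and L = L and T = T])
    show "continuous_on {0..T} d" unfolding d_def[abs_def] by (intro continuous_intros c)
    show "d 0 = 0" by (simp add: d_def init zero_prod_def)
    show "(W has_integral d b - d a) {a..b}" if ab: "0 < a" "a < b" "b < T" for a b
    proof -
      note hi = has_integral_of_weak_derivative[OF _ _ _ ab]
      have X: "((\<lambda>t. v t - v' t) has_integral (x b - x a) - (x' b - x' a)) {a..b}"
        by (intro has_integral_diff hi wd c ni L2)
      have V: "((\<lambda>t. w t - w' t) has_integral (v b - v a) - (v' b - v' a)) {a..b}"
        by (intro has_integral_diff hi 1 2 c ni)
      have bl: "bounded_linear (\<lambda>z::'a. (z, 0::'a))" "bounded_linear (\<lambda>z::'a. (0::'a, z))"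
        by (intro bounded_linear_Pair bounded_linear_ident bounded_linear_zero)+
      have "((\<lambda>t. (v t - v' t, 0) + (0, w t - w' t)) has_integral
          ((x b - x a) - (x' b - x' a), 0) + (0, (v b - v a) - (v' b - v' a))) {a..b}"
        using has_integral_add[OF has_integral_linear[OF X bl(1)] has_integral_linear[OF V bl(2)]] by (simp add: o_def)
      then show ?thesis by (simp add: W_def[abs_def] d_def algebra_simps)
    qed
    show "m integrable_on {0..T}"
    proof -
      have "integrable (lebesgue_on ?I) m"
        unfolding m_def[abs_def] by (intro Bochner_Integration.integrable_add ni L2 1 2)
      then show ?thesis by (simp add: integrable_on_lebesgue_on integrable_on_Icc_iff_Ioo)
    qed
    show "norm (W t) \<le> m t" for t
    proof -
      have "norm (W t) \<le> norm (v t - v' t) + norm (w t - w' t)" unfolding W_def by (rule norm_Pair_le)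
      also have "\<dots> \<le> m t" unfolding m_def by (intro add_mono norm_triangle_ineq4)
      finally show ?thesis .
    qed
    show "W t \<bullet> d t \<le> L * (norm (d t))\<^sup>2" if "0 < t" "t < T" "t \<notin> N" for t
    proof -
      have solve: "a = - (b + c + d)" if "a + b + c + d = 0" for a b c d :: 'a
        using that unfolding eq_neg_iff_add_eq_0 add.assoc .
      have P: "\<xi> t \<in> subdiff \<phi> (v t)" "w t = - (\<gamma> *\<^sub>R v t + \<xi> t + df (x t + \<beta> *\<^sub>R v t))"
        "\<xi>' t \<in> subdiff \<phi> (v' t)" "w' t = - (\<gamma> *\<^sub>R v' t + \<xi>' t + df (x' t + \<beta> *\<^sub>R v' t))"
        using NP[of t] that solve by auto
      define X V where "X = x t - x' t" and "V = v t - v' t"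
      have n: "norm X \<le> norm (d t)" "norm V \<le> norm (d t)"
        using norm_fst_le[of "fst (d t)" "snd (d t)"] norm_snd_le[of "snd (d t)" "fst (d t)"] by (simp_all add: d_def X_def V_def)
      define D where "D = df (x t + \<beta> *\<^sub>R v t) - df (x' t + \<beta> *\<^sub>R v' t)"
      have 1: "norm D \<le> K * norm ((x t + \<beta> *\<^sub>R v t) - (x' t + \<beta> *\<^sub>R v' t))"
        using lipschitz_onD[OF K, of "x t + \<beta> *\<^sub>R v t" "x' t + \<beta> *\<^sub>R v' t"] that by (simp add: D_def dist_norm yB_def)
      have "(x t + \<beta> *\<^sub>R v t) - (x' t + \<beta> *\<^sub>R v' t) = X + \<beta> *\<^sub>R V" by (simp add: X_def V_def algebra_simps)
      also have "norm \<dots> \<le> norm X + \<beta> * norm V" using norm_triangle_ineq[of X "\<beta> *\<^sub>R V"] \<beta> by simp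
      also have "\<dots> \<le> norm (d t) + \<beta> * norm (d t)" using n \<beta> by (intro add_mono mult_left_mono)
      finally have "norm ((x t + \<beta> *\<^sub>R v t) - (x' t + \<beta> *\<^sub>R v' t)) \<le> (1 + \<beta>) * norm (d t)"
        by (simp add: algebra_simps)
      with 1 have Db: "norm D \<le> K * ((1 + \<beta>) * norm (d t))"
        using K0 by (meson mult_left_mono order_trans)
      have "W t \<bullet> d t = V \<bullet> X - \<gamma> * (V \<bullet> V) - (\<xi> t - \<xi>' t) \<bullet> V - D \<bullet> V"
        by (simp add: W_def d_def P X_def V_def D_def inner_diff inner_add algebra_simps)
      also have "\<dots> \<le> norm V * norm X + norm D * norm V"
        using norm_cauchy_schwarz[of V X] Cauchy_Schwarz_ineq2[of D V] \<gamma> subdiff_monotone[OF P(1,3)] inner_ge_zero[of V]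
          mult_nonneg_nonneg[of \<gamma> "V \<bullet> V"] unfolding V_def[symmetric] by linarith
      also have "\<dots> \<le> norm (d t) * norm (d t) + (K * ((1 + \<beta>) * norm (d t))) * norm (d t)"
        using n Db K0 \<beta> by (intro add_mono mult_mono) auto
      also have "\<dots> = L * (norm (d t))\<^sup>2" by (simp add: L_def power2_eq_square algebra_simps)
      finally show ?thesis .
    qed
    show "0 \<le> L" using K0 \<beta> by (simp add: L_def)
  qed (use N t in auto)
  then show "x t = x' t" "v t = v' t" by (simp_all add: d_def zero_prod_def)
qed

end

section \<open>Energy and existence on bounded intervals\<close>

lemma isCont_inside:
  fixes g :: "real \<Rightarrow> 'b::topological_space"
  assumes "continuous_on {0..T} g" "0 < t" "t < T"
  shows "isCont g t"
  using assms by (intro continuous_on_interior[OF assms(1)]) simp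

context dry_friction begin

text \<open>The inclusion is required at every time, and only derivatives and continuity of
  \<open>w\<close> are excused on \<open>N\<close>. Keeping \<open>N\<close> and \<open>w\<close> as
  parameters allows one pair to serve all intervals.\<close>

definition regular_solution ::
    "real \<Rightarrow> real set \<Rightarrow> (real \<Rightarrow> 'a) \<Rightarrow> (real \<Rightarrow> 'a) \<Rightarrow> (real \<Rightarrow> 'a) \<Rightarrow> bool" where
  "regular_solution T N x v w \<longleftrightarrow> countable N \<and> continuous_on {0..T} x \<and> continuous_on {0..T} v \<and>
     bounded (w ` {0..T}) \<and>
     (\<forall>t\<in>{0..T}. - w t - \<gamma> *\<^sub>R v t - df (x t + \<beta> *\<^sub>R v t) \<in> subdiff \<phi> (v t)) \<and>
     (\<forall>t. 0 < t \<longrightarrow> t < T \<longrightarrow> t \<notin> N \<longrightarrow> isCont w t \<and>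
        (x has_vector_derivative v t) (at t) \<and> (v has_vector_derivative w t) (at t))"

definition select :: "(real \<Rightarrow> 'a) \<Rightarrow> (real \<Rightarrow> 'a) \<Rightarrow> (real \<Rightarrow> 'a) \<Rightarrow> real \<Rightarrow> 'a" where
  "select x v w t = - w t - \<gamma> *\<^sub>R v t - df (x t + \<beta> *\<^sub>R v t)"

text \<open>For \<open>\<beta> = 0\<close> the last term vanishes without a case distinction. Where
  \<open>\<phi> (v t)\<close> is finite this is the real value of \<open>energy\<close>.\<close>

definition renergy :: "(real \<Rightarrow> 'a) \<Rightarrow> (real \<Rightarrow> 'a) \<Rightarrow> real \<Rightarrow> real" where
  "renergy x v t = f (x t + \<beta> *\<^sub>R v t) - (INF z. f z) + (1 + \<beta> * \<gamma>) / 2 * (norm (v t))\<^sup>2 + \<beta> * rval (v t)"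

lemma regular_solution_subinterval:
  "regular_solution T N x v w \<Longrightarrow> S \<le> T \<Longrightarrow> regular_solution S N x v w"
  unfolding regular_solution_def
  by (auto elim!: continuous_on_subset bounded_subset)

lemma f_has_derivative: "(f has_derivative (\<lambda>h. h \<bullet> df z)) (at z)"
  using gradient[of z] by (simp add: gderiv_def)

lemma f_cont: "continuous_on A f"
  using f_has_derivative by (meson continuous_at_imp_continuous_on has_derivative_continuous)

lemma df_isCont: "isCont df z"
  using df_cont by (simp add: continuous_on_eq_continuous_at)

text \<open>Testing \<open>\<xi>\<close> at the origin gives
  \<open>\<phi> v \<le> \<xi> \<bullet> v\<close>; the subgradient
  \<open>(r / norm v) *\<^sub>R v\<close> at the origin gives
  \<open>r * norm v \<le> \<phi> v\<close>.\<close>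

lemma subdiff_inner_lower:
  assumes "\<xi> \<in> subdiff \<phi> v"
  shows "r * norm v \<le> \<xi> \<bullet> v"
proof -
  have fin0: "\<phi> 0 \<noteq> \<infinity>" using \<phi>_0 by simp
  have fin: "\<phi> v \<noteq> \<infinity>" using assms unfolding subdiff_iff by blast
  have 1: "rval v + \<xi> \<bullet> (0 - v) \<le> rval 0" using assms fin0 unfolding subdiff_iff by blast
  have r0: "rval 0 = 0" using \<phi>_0 by (simp add: rval_def)
  have "r * norm v \<le> rval v"
  proof (cases "v = 0")
    case False
    define z where "z = (r / norm v) *\<^sub>R v"
    have "z \<in> cball 0 r" using r False by (simp add: z_def)
    then have "rval 0 + z \<bullet> (v - 0) \<le> rval v" using ball fin by (auto simp: subdiff_iff)
    moreover have "z \<bullet> v = r * norm v" using False by (simp add: z_def power2_eq_square flip: power2_norm_eq_inner)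
    ultimately show ?thesis using r0 by simp
  qed (simp add: r0)
  with 1 r0 show ?thesis by simp
qed

context
  fixes T N x v w
  assumes sol: "regular_solution T N x v w" and T: "0 < T"
begin

lemma reg: "countable N" "continuous_on {0..T} x" "continuous_on {0..T} v" "bounded (w ` {0..T})"
  "\<And>t. 0 \<le> t \<Longrightarrow> t \<le> T \<Longrightarrow> select x v w t \<in> subdiff \<phi> (v t)"
  "\<And>t. 0 < t \<Longrightarrow> t < T \<Longrightarrow> t \<notin> N \<Longrightarrow> isCont w t"
  "\<And>t. 0 < t \<Longrightarrow> t < T \<Longrightarrow> t \<notin> N \<Longrightarrow> (x has_vector_derivative v t) (at t)"
  "\<And>t. 0 < t \<Longrightarrow> t < T \<Longrightarrow> t \<notin> N \<Longrightarrow> (v has_vector_derivative w t) (at t)"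
  using sol by (auto simp: regular_solution_def select_def)

lemma y_cont: "continuous_on {0..T} (\<lambda>t. x t + \<beta> *\<^sub>R v t)"
  by (intro continuous_intros reg)

lemma select_bounded: "\<exists>K. \<forall>t\<in>{0..T}. norm (select x v w t) \<le> K"
proof -
  have "bounded ((\<lambda>t. \<gamma> *\<^sub>R v t + df (x t + \<beta> *\<^sub>R v t)) ` {0..T})"
    by (intro compact_imp_bounded compact_continuous_image continuous_intros reg
        continuous_on_compose2[OF df_cont] y_cont) auto
  then obtain K1 where K1: "\<And>t. t \<in> {0..T} \<Longrightarrow> norm (\<gamma> *\<^sub>R v t + df (x t + \<beta> *\<^sub>R v t)) \<le> K1"
    unfolding bounded_iff by blast
  obtain K2 where K2: "\<And>t. t \<in> {0..T} \<Longrightarrow> norm (w t) \<le> K2"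
    using reg(4) unfolding bounded_iff by blast
  have "norm (select x v w t) \<le> K1 + K2" if t: "t \<in> {0..T}" for t
  proof -
    have "select x v w t = - (w t + (\<gamma> *\<^sub>R v t + df (x t + \<beta> *\<^sub>R v t)))" by (simp add: select_def)
    then show ?thesis
      using norm_triangle_ineq[of "w t" "\<gamma> *\<^sub>R v t + df (x t + \<beta> *\<^sub>R v t)"] K1[OF t] K2[OF t]
      by (simp only: norm_minus_cancel)
  qed
  then show ?thesis by blast
qed

lemma v_dom: "0 \<le> t \<Longrightarrow> t \<le> T \<Longrightarrow> \<phi> (v t) \<noteq> \<infinity>"
  using reg(5) by (auto simp: subdiff_iff)

lemma rval_increment:
  assumes "0 \<le> s" "s \<le> T" "0 \<le> t" "t \<le> T"
  shows "select x v w s \<bullet> (v t - v s) \<le> rval (v t) - rval (v s)"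
  using reg(5)[of s] v_dom[of t] assms by (auto simp: subdiff_iff)

text \<open>Subgradient inequalities at both times bound the oscillation of
  \<open>rval (v t)\<close> by that of \<open>v\<close>, with the bound of the selection as
  constant. Semicontinuity of \<open>\<phi>\<close> alone would not give this.\<close>

lemma rval_cont: "continuous_on {0..T} (\<lambda>t. rval (v t))"
proof -
  obtain K where K: "\<And>t. t \<in> {0..T} \<Longrightarrow> norm (select x v w t) \<le> K" using select_bounded by blast
  have *: "rval (v s) - rval (v t) \<le> K * norm (v t - v s)" if "s \<in> {0..T}" "t \<in> {0..T}" for s t
  proof -
    have "rval (v s) - rval (v t) \<le> - (select x v w s \<bullet> (v t - v s))" using rval_increment[of s t] that by simp
    also have "\<dots> \<le> norm (select x v w s) * norm (v t - v s)"
      using Cauchy_Schwarz_ineq2[of "select x v w s" "v t - v s"] by linarith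
    also have "\<dots> \<le> K * norm (v t - v s)" using K that by (intro mult_right_mono) auto
    finally show ?thesis .
  qed
  show ?thesis unfolding continuous_on_def
  proof
    fix t assume t: "t \<in> {0..T}"
    show "((\<lambda>t. rval (v t)) \<longlongrightarrow> rval (v t)) (at t within {0..T})"
    proof (rule LIM_zero_cancel, rule Lim_null_comparison)
      show "\<forall>\<^sub>F s in at t within {0..T}. norm (rval (v s) - rval (v t)) \<le> K * norm (v s - v t)"
        using *[OF _ t] *[OF t] by (auto simp: eventually_at_filter abs_le_iff norm_minus_commute intro!: always_eventually)
      have "((\<lambda>s. K * norm (v s - v t)) \<longlongrightarrow> K * norm (v t - v t)) (at t within {0..T})"
        using reg(3) t by (intro tendsto_intros) (auto simp: continuous_on_def)
      then show "((\<lambda>s. K * norm (v s - v t)) \<longlongrightarrow> 0) (at t within {0..T})" by simp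
    qed
  qed
qed

lemma select_isCont:
  assumes "0 < t" "t < T" "t \<notin> N"
  shows "isCont (select x v w) t"
proof -
  have "isCont (\<lambda>t. df (x t + \<beta> *\<^sub>R v t)) t"
    by (rule isCont_o2[OF isCont_inside[OF y_cont assms(1,2)] df_isCont])
  then show ?thesis unfolding select_def[abs_def]
    by (intro continuous_intros reg isCont_inside[OF reg(3)] assms)
qed

text \<open>The subgradient inequalities at \<open>t\<close> and at \<open>s\<close> squeeze the
  quotient between \<open>?\<xi> t \<bullet> q s\<close> and \<open>?\<xi> s \<bullet> q s\<close>,
  in an order that depends on the side. The gap closes because the selection is continuous at
  \<open>t\<close>.\<close>

lemma rval_derivative:
  assumes t: "0 < t" "t < T" "t \<notin> N"
  shows "((\<lambda>t. rval (v t)) has_real_derivative select x v w t \<bullet> w t) (at t)"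
proof -
  let ?\<xi> = "select x v w"
  define q where "q s = (v s - v t) /\<^sub>R (s - t)" for s
  define Q where "Q s = (rval (v s) - rval (v t)) /\<^sub>R (s - t)" for s
  have q: "(q \<longlongrightarrow> w t) (at t)"
    using reg(8)[OF t] unfolding has_vector_derivative_iff_quotient q_def[abs_def] .
  have \<xi>: "(?\<xi> \<longlongrightarrow> ?\<xi> t) (at t)" using select_isCont[OF t] by (simp add: isCont_def)
  have "((\<lambda>s. Q s - ?\<xi> t \<bullet> q s) \<longlongrightarrow> 0) (at t)"
  proof (rule Lim_null_comparison)
    have "\<forall>\<^sub>F s in nhds t. s \<in> {0<..<T}" using t by (intro eventually_nhds_in_open) auto
    then have "\<forall>\<^sub>F s in at t. s \<in> {0<..<T} \<and> s \<noteq> t" by (simp add: eventually_at_filter eventually_mono)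
    then show "\<forall>\<^sub>F s in at t. norm (Q s - ?\<xi> t \<bullet> q s) \<le> \<bar>?\<xi> s \<bullet> q s - ?\<xi> t \<bullet> q s\<bar>"
    proof eventually_elim
      case (elim s)
      have 1: "?\<xi> t \<bullet> (v s - v t) \<le> rval (v s) - rval (v t)"
        using rval_increment[of t s] t elim by simp
      have "?\<xi> s \<bullet> (v t - v s) \<le> rval (v t) - rval (v s)"
        using rval_increment[of s t] t elim by simp
      then have 2: "rval (v s) - rval (v t) \<le> ?\<xi> s \<bullet> (v s - v t)" by (simp add: inner_diff)
      have q': "?\<xi> \<tau> \<bullet> q s = (?\<xi> \<tau> \<bullet> (v s - v t)) / (s - t)" for \<tau> by (simp add: q_def divide_inverse)
      have Q': "Q s = (rval (v s) - rval (v t)) / (s - t)" by (simp add: Q_def divide_inverse)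
      show ?case
      proof (cases "t < s")
        case True
        then have "?\<xi> t \<bullet> q s \<le> Q s" "Q s \<le> ?\<xi> s \<bullet> q s" using 1 2 unfolding q' Q' by (auto intro: divide_right_mono)
        then show ?thesis by simp
      next
        case False
        then have "Q s \<le> ?\<xi> t \<bullet> q s" "?\<xi> s \<bullet> q s \<le> Q s" using 1 2 elim unfolding q' Q' by (auto intro: divide_right_mono_neg)
        then show ?thesis by simp
      qed
    qed
    have "((\<lambda>s. \<bar>?\<xi> s \<bullet> q s - ?\<xi> t \<bullet> q s\<bar>) \<longlongrightarrow> \<bar>?\<xi> t \<bullet> w t - ?\<xi> t \<bullet> w t\<bar>) (at t)"
      by (intro tendsto_intros \<xi> q)
    then show "((\<lambda>s. \<bar>?\<xi> s \<bullet> q s - ?\<xi> t \<bullet> q s\<bar>) \<longlongrightarrow> 0) (at t)" by simp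
  qed
  from tendsto_add[OF this tendsto_inner[OF tendsto_const[of "?\<xi> t"] q]]
  have "(Q \<longlongrightarrow> ?\<xi> t \<bullet> w t) (at t)" by simp
  then show ?thesis
    unfolding has_real_derivative_iff_has_vector_derivative has_vector_derivative_iff_quotient Q_def[abs_def] .
qed

text \<open>Writing the gradient as \<open>- w - \<gamma> v - \<xi>\<close>, its pairing with
  \<open>v + \<beta> w\<close> produces \<open>- (1 + \<beta> \<gamma>) (v \<bullet> w)\<close> and
  \<open>- \<beta> (\<xi> \<bullet> w)\<close>. The kinetic coefficient and the term
  \<open>\<beta> \<phi>\<close> of the energy cancel exactly these.\<close>

lemma renergy_derivative:
  assumes t: "0 < t" "t < T" "t \<notin> N"
  shows "(renergy x v has_real_derivative
    - (\<beta> * (norm (w t))\<^sup>2 + \<gamma> * (norm (v t))\<^sup>2 + select x v w t \<bullet> v t)) (at t)"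
proof -
  let ?y = "\<lambda>t. x t + \<beta> *\<^sub>R v t" and ?\<xi> = "select x v w t"
  have y: "(?y has_vector_derivative v t + \<beta> *\<^sub>R w t) (at t)"
    by (intro has_vector_derivative_add bounded_linear.has_vector_derivative[OF bounded_linear_scaleR_right] reg t)
  have "((f \<circ> ?y) has_derivative ((\<lambda>h. h \<bullet> df (?y t)) \<circ> (\<lambda>h. h *\<^sub>R (v t + \<beta> *\<^sub>R w t)))) (at t)"
    by (rule diff_chain_at[OF y[unfolded has_vector_derivative_def] f_has_derivative])
  moreover have "(\<lambda>h. h \<bullet> df (?y t)) \<circ> (\<lambda>h. h *\<^sub>R (v t + \<beta> *\<^sub>R w t)) = (*) ((v t + \<beta> *\<^sub>R w t) \<bullet> df (?y t))"
    by (auto simp: o_def)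
  ultimately have 1: "((\<lambda>t. f (?y t)) has_real_derivative (v t + \<beta> *\<^sub>R w t) \<bullet> df (?y t)) (at t)"
    by (simp add: has_field_derivative_def o_def)
  have "((\<lambda>t. v t \<bullet> v t) has_vector_derivative v t \<bullet> w t + w t \<bullet> v t) (at t)"
    by (intro bounded_bilinear.has_vector_derivative[OF bounded_bilinear_inner] reg t)
  then have 2: "((\<lambda>t. (norm (v t))\<^sup>2) has_real_derivative 2 * (v t \<bullet> w t)) (at t)"
    by (simp add: has_real_derivative_iff_has_vector_derivative power2_norm_eq_inner inner_commute)
  have "(renergy x v has_real_derivative ((v t + \<beta> *\<^sub>R w t) \<bullet> df (?y t) - 0
      + (1 + \<beta> * \<gamma>) / 2 * (2 * (v t \<bullet> w t)) + \<beta> * (?\<xi> \<bullet> w t))) (at t)"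
    unfolding renergy_def[abs_def]
    by (intro DERIV_add DERIV_diff DERIV_cmult DERIV_const 1 2 rval_derivative t)
  moreover have "(v t + \<beta> *\<^sub>R w t) \<bullet> df (?y t) - 0 + (1 + \<beta> * \<gamma>) / 2 * (2 * (v t \<bullet> w t)) + \<beta> * (?\<xi> \<bullet> w t)
      = - (\<beta> * (norm (w t))\<^sup>2 + \<gamma> * (norm (v t))\<^sup>2 + ?\<xi> \<bullet> v t)"
    by (simp add: select_def power2_norm_eq_inner inner_add inner_diff inner_commute algebra_simps)
  ultimately show ?thesis by simp
qed

lemma renergy_cont: "continuous_on {0..T} (renergy x v)"
  unfolding renergy_def[abs_def]
  by (intro continuous_intros reg rval_cont continuous_on_compose2[OF f_cont[of UNIV] y_cont]) auto

lemma renergy_integral: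
  "((\<lambda>t. \<beta> * (norm (w t))\<^sup>2 + \<gamma> * (norm (v t))\<^sup>2 + select x v w t \<bullet> v t)
    has_integral renergy x v 0 - renergy x v T) {0..T}"
proof -
  let ?g = "\<lambda>t. \<beta> * (norm (w t))\<^sup>2 + \<gamma> * (norm (v t))\<^sup>2 + select x v w t \<bullet> v t"
  have "((\<lambda>t. - ?g t) has_integral renergy x v T - renergy x v 0) {0..T}"
    using T renergy_derivative
    by (intro fundamental_theorem_of_calculus_countable[OF reg(1)] renergy_cont)
      (auto simp: has_real_derivative_iff_has_vector_derivative)
  from has_integral_neg[OF this] show ?thesis by (simp only: minus_minus minus_diff_eq)
qed

lemma dissipation_lower:
  assumes "0 \<le> t" "t \<le> T"
  shows "\<beta> * (norm (w t))\<^sup>2 + \<gamma> * (norm (v t))\<^sup>2 + r * norm (v t)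
    \<le> \<beta> * (norm (w t))\<^sup>2 + \<gamma> * (norm (v t))\<^sup>2 + select x v w t \<bullet> v t"
  using subdiff_inner_lower[OF reg(5)[OF assms]] by simp

lemma renergy_decreases: "renergy x v T \<le> renergy x v 0"
proof -
  have "0 \<le> renergy x v 0 - renergy x v T"
  proof (rule has_integral_nonneg[OF renergy_integral])
    fix t assume "t \<in> {0..T}"
    moreover have "0 \<le> \<beta> * (norm (w t))\<^sup>2 + \<gamma> * (norm (v t))\<^sup>2 + r * norm (v t)"
      using \<beta> \<gamma> r by simp
    ultimately show "0 \<le> \<beta> * (norm (w t))\<^sup>2 + \<gamma> * (norm (v t))\<^sup>2 + select x v w t \<bullet> v t"
      using dissipation_lower[of t] by simp
  qed
  then show ?thesis by simp
qed

lemma x_increment: "(v has_integral x T - x 0) {0..T}"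
  using T reg by (intro fundamental_theorem_of_calculus_countable[OF reg(1)]) auto

end

lemma renergy_lower: "(norm (v t))\<^sup>2 / 2 \<le> renergy x v t"
proof -
  have "(INF z. f z) \<le> f (x t + \<beta> *\<^sub>R v t)" by (rule cINF_lower[OF f_bdd]) simp
  moreover have "0 \<le> \<beta> * rval (v t)" using \<beta> rval_nonneg by simp
  moreover have "0 \<le> \<beta> * \<gamma> / 2 * (norm (v t))\<^sup>2" using \<beta> \<gamma> by simp
  moreover have "(1 + \<beta> * \<gamma>) / 2 * (norm (v t))\<^sup>2 = (norm (v t))\<^sup>2 / 2 + \<beta> * \<gamma> / 2 * (norm (v t))\<^sup>2"
    by (simp add: algebra_simps add_divide_distrib)
  ultimately show ?thesis unfolding renergy_def by linarith
qed

end

section \<open>Truncation of the gradient and existence on a bounded interval\<close>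

definition radial :: "real \<Rightarrow> 'a::real_normed_vector \<Rightarrow> 'a" where
  "radial R z = z /\<^sub>R max 1 (norm z / R)"

lemma radial_id: "0 < R \<Longrightarrow> norm z \<le> R \<Longrightarrow> radial R z = z"
  by (simp add: radial_def max_def)

lemma radial_norm:
  assumes "0 < R"
  shows "norm (radial R z) \<le> R"
proof -
  have "norm z / R \<le> max 1 (norm z / R)" by simp
  then have "norm z \<le> R * max 1 (norm z / R)" using assms by (simp only: pos_divide_le_eq mult.commute)
  then show ?thesis by (simp add: radial_def divide_simps mult.commute flip: divide_inverse_commute)
qed

text \<open>The difference splits into a rescaled \<open>x - y\<close> and a change of the scaling
  factor acting on \<open>radial R y\<close>; that factor varies by at most
  \<open>norm (x - y) / R\<close>, and \<open>R\<close> bounds the vector. Each part costs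
  1.\<close>

lemma radial_lipschitz:
  assumes R: "0 < R"
  shows "norm (radial R x - radial R y) \<le> 2 * norm (x - y)"
proof -
  define c where "c z = max 1 (norm z / R)" for z :: 'a
  have c1: "1 \<le> c z" for z by (simp add: c_def)
  have cd: "\<bar>c y - c x\<bar> \<le> norm (x - y) / R"
  proof -
    have "\<bar>c y - c x\<bar> \<le> \<bar>norm y / R - norm x / R\<bar>" by (auto simp: c_def max_def abs_if)
    also have "\<dots> = \<bar>norm y - norm x\<bar> / R" using R by (simp flip: diff_divide_distrib)
    also have "\<dots> \<le> norm (x - y) / R"
      using R norm_triangle_ineq3[of y x] by (intro divide_right_mono) (auto simp: norm_minus_commute)
    finally show ?thesis .
  qed
  have "radial R x - radial R y = (x - y) /\<^sub>R c x + ((c y - c x) / c x) *\<^sub>R radial R y"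
  proof -
    have "(c y - c x) / c x * inverse (c y) = inverse (c x) - inverse (c y)"
      using c1[of x] c1[of y] by (simp add: field_simps)
    then have "((c y - c x) / c x) *\<^sub>R radial R y = (inverse (c x) - inverse (c y)) *\<^sub>R y"
      unfolding radial_def c_def[symmetric] scaleR_scaleR by simp
    then show ?thesis unfolding radial_def c_def[symmetric] by (simp add: algebra_simps)
  qed
  also have "norm \<dots> \<le> norm ((x - y) /\<^sub>R c x) + norm (((c y - c x) / c x) *\<^sub>R radial R y)"
    by (rule norm_triangle_ineq)
  also have "norm ((x - y) /\<^sub>R c x) \<le> norm (x - y)"
    using c1[of x] by (simp add: mult_left_le_one_le inverse_le_1_iff)
  also have "norm (((c y - c x) / c x) *\<^sub>R radial R y) \<le> norm (x - y) / R * R"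
  proof -
    have "\<bar>(c y - c x) / c x\<bar> \<le> \<bar>c y - c x\<bar>"
      using c1[of x] by (simp add: pos_divide_le_eq mult_le_cancel_left1)
    then have "\<bar>(c y - c x) / c x\<bar> \<le> norm (x - y) / R" using cd by linarith
    then show ?thesis using radial_norm[OF R, of y] R unfolding norm_scaleR by (intro mult_mono) auto
  qed
  finally show ?thesis using R by simp
qed

context dry_friction begin

text \<open>The position component of the operator is zero, so the resolvent fixes positions and
  solves the proximal problem in the velocity.\<close>

lemma product_maximal_monotone: "maximal_monotone (\<lambda>p::'a \<times> 'a. {0} \<times> subdiff \<phi> (snd p))"
proof
  show "0 \<le> (\<zeta> - \<zeta>') \<bullet> (p - p')" if "\<zeta> \<in> {0} \<times> subdiff \<phi> (snd p)" "\<zeta>' \<in> {0} \<times> subdiff \<phi> (snd p')"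
    for \<zeta> \<zeta>' p p' :: "'a \<times> 'a"
    using that subdiff_monotone by (auto simp: inner_prod_def)
  show "\<exists>q. (p - q) /\<^sub>R \<mu> \<in> {0} \<times> subdiff \<phi> (snd q)" if "0 < \<mu>" for \<mu> and p :: "'a \<times> 'a"
  proof -
    obtain z where "(snd p - z) /\<^sub>R \<mu> \<in> subdiff \<phi> z" using ex_prox \<open>0 < \<mu>\<close> by blast
    then show ?thesis by (intro exI[of _ "(fst p, z)"]) (auto simp: mem_Times_iff)
  qed
qed

text \<open>The gradient is truncated outside a ball so large that the energy bound keeps \<open>x + \<beta> v\<close> inside
  it up to time \<open>T\<close>.\<close>

lemma ex_regular_solution:
  assumes v0: "subdiff \<phi> v0 \<noteq> {}" and T: "0 < T"
  shows "\<exists>N x v w. regular_solution T N x v w \<and> x 0 = x0 \<and> v 0 = v0"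
proof -
  \<comment> \<open>Half the squared speed is at most the energy, so \<open>V\<close> bounds the
    speed as long as the energy stays below its initial value.\<close>
  define V where "V = sqrt (2 * renergy (\<lambda>_. x0) (\<lambda>_. v0) 0)"
  \<comment> \<open>The first two terms bound the position up to time \<open>T\<close>, the third
    the shift by \<open>\<beta> v\<close>; the 1 leaves room for a strict inequality.\<close>
  define R where "R = norm x0 + V * T + \<beta> * V + 1"
  have e0: "0 \<le> renergy (\<lambda>_. x0) (\<lambda>_. v0) 0"
    using renergy_lower[of "\<lambda>_. v0" 0 "\<lambda>_. x0"] by (smt (verit) zero_le_power2 divide_nonneg_nonneg)
  have V: "0 \<le> V" using e0 by (simp add: V_def)
  have R: "0 < R" using V \<beta> T by (simp add: R_def add_nonneg_pos)
  obtain K where K: "K-lipschitz_on (cball 0 R) df" using df_lipschitz[of "cball 0 R"] by auto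
  have K0: "0 \<le> K" using K by (rule lipschitz_on_nonneg)
  define F where "F p = (- snd p, \<gamma> *\<^sub>R snd p + df (radial R (fst p + \<beta> *\<^sub>R snd p)))" for p
  \<comment> \<open>The summands stem from the coupling to the velocity, the damping and the
    truncated gradient; the 2 is the Lipschitz constant of \<open>radial\<close>.\<close>
  define L where "L = 1 + \<gamma> + K * (2 * (1 + \<beta>))"
  define A :: "'a \<times> 'a \<Rightarrow> ('a \<times> 'a) set" where "A = (\<lambda>p. {0} \<times> subdiff \<phi> (snd p))"
  interpret maximal_monotone A unfolding A_def by (rule product_maximal_monotone)
  interpret lipschitz_perturbation A F L
  proof
    show "0 < L" using \<gamma> K0 \<beta> by (simp add: L_def add_pos_nonneg)
    fix p q :: "'a \<times> 'a"
    have n: "norm (fst p - fst q) \<le> norm (p - q)" "norm (snd p - snd q) \<le> norm (p - q)"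
    proof -
      have "p - q = (fst p - fst q, snd p - snd q)" by (simp add: prod_eq_iff)
      then show "norm (fst p - fst q) \<le> norm (p - q)" "norm (snd p - snd q) \<le> norm (p - q)"
        by (simp_all only: norm_fst_le norm_snd_le)
    qed
    define D where "D = df (radial R (fst p + \<beta> *\<^sub>R snd p)) - df (radial R (fst q + \<beta> *\<^sub>R snd q))"
    have 1: "norm D \<le> K * norm (radial R (fst p + \<beta> *\<^sub>R snd p) - radial R (fst q + \<beta> *\<^sub>R snd q))"
      unfolding D_def dist_norm[symmetric]
      by (rule lipschitz_onD[OF K]) (simp_all add: radial_norm[OF R])
    have "norm (radial R (fst p + \<beta> *\<^sub>R snd p) - radial R (fst q + \<beta> *\<^sub>R snd q))
        \<le> 2 * norm ((fst p + \<beta> *\<^sub>R snd p) - (fst q + \<beta> *\<^sub>R snd q))" by (rule radial_lipschitz[OF R])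
    also have "(fst p + \<beta> *\<^sub>R snd p) - (fst q + \<beta> *\<^sub>R snd q) = (fst p - fst q) + \<beta> *\<^sub>R (snd p - snd q)"
      by (simp add: algebra_simps)
    also have "norm \<dots> \<le> norm (fst p - fst q) + \<beta> * norm (snd p - snd q)"
      using norm_triangle_ineq[of "fst p - fst q" "\<beta> *\<^sub>R (snd p - snd q)"] \<beta> by simp
    also have "\<dots> \<le> norm (p - q) + \<beta> * norm (p - q)" using n \<beta> by (intro add_mono mult_left_mono)
    finally have "norm (radial R (fst p + \<beta> *\<^sub>R snd p) - radial R (fst q + \<beta> *\<^sub>R snd q)) \<le> 2 * (1 + \<beta>) * norm (p - q)"
      by (simp add: algebra_simps)
    with 1 have D: "norm D \<le> K * (2 * (1 + \<beta>) * norm (p - q))"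
      using K0 by (meson mult_left_mono order_trans)
    have "F p - F q = (- (snd p - snd q), \<gamma> *\<^sub>R (snd p - snd q) + D)"
      by (simp add: F_def D_def algebra_simps)
    then have "norm (F p - F q) \<le> norm (- (snd p - snd q)) + norm (\<gamma> *\<^sub>R (snd p - snd q) + D)"
      using norm_Pair_le by metis
    also have "norm (\<gamma> *\<^sub>R (snd p - snd q) + D) \<le> \<gamma> * norm (snd p - snd q) + norm D"
      using norm_triangle_ineq[of "\<gamma> *\<^sub>R (snd p - snd q)" D] \<gamma> by simp
    also have "norm (- (snd p - snd q)) + (\<gamma> * norm (snd p - snd q) + norm D)
        \<le> norm (p - q) + (\<gamma> * norm (p - q) + K * (2 * (1 + \<beta>) * norm (p - q)))"
      using n D \<gamma> unfolding norm_minus_cancel by (intro add_mono mult_left_mono) auto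
    also have "\<dots> = L * norm (p - q)" by (simp add: L_def algebra_simps)
    finally show "norm (F p - F q) \<le> L * norm (p - q)" by simp
  qed
  have dom: "A (x0, v0) \<noteq> {}" using v0 by (auto simp: A_def)
  obtain U W N where flow: "countable N" "U 0 = (x0, v0)"
    "\<And>t. 0 \<le> t \<Longrightarrow> - W t - F (U t) \<in> A (U t)"
    "\<And>t. 0 \<le> t \<Longrightarrow> norm (W t) \<le> exp (L * t) * norm (W 0)"
    "\<And>s t. 0 \<le> s \<Longrightarrow> s \<le> t \<Longrightarrow> norm (U t - U s) \<le> exp (L * t) * norm (W 0) * (t - s)"
    "\<And>t. 0 < t \<Longrightarrow> t \<notin> N \<Longrightarrow> isCont W t \<and> (U has_vector_derivative W t) (at t)"
    using flow_solution[OF dom] by metis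
  define x v w where "x t = fst (U t)" and "v t = snd (U t)" and "w t = snd (W t)" for t
  define y where "y t = x t + \<beta> *\<^sub>R v t" for t
  have init: "x 0 = x0" "v 0 = v0" using flow(2) by (simp_all add: x_def v_def)
  have W: "fst (W t) = v t" "- w t - \<gamma> *\<^sub>R v t - df (radial R (y t)) \<in> subdiff \<phi> (v t)" if "0 \<le> t" for t
    using flow(3)[OF that] by (auto simp: A_def F_def x_def v_def w_def y_def mem_Times_iff algebra_simps)
  have contU: "continuous_on {0..S} U" if "0 \<le> S" for S
  proof -
    define M where "M = exp (L * S) * norm (W 0)"
    have *: "norm (U t - U s) \<le> M * (t - s)" if "0 \<le> s" "s \<le> t" "t \<le> S" for s t
    proof -
      have "norm (U t - U s) \<le> exp (L * t) * norm (W 0) * (t - s)" using that by (intro flow) auto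
      also have "\<dots> \<le> M * (t - s)" unfolding M_def using that L_pos by (intro mult_right_mono) auto
      finally show ?thesis .
    qed
    have "M-lipschitz_on {0..S} U"
    proof (rule lipschitz_onI)
      fix s t assume "s \<in> {0..S}" "t \<in> {0..S}"
      then show "dist (U s) (U t) \<le> M * dist s t"
        using *[of s t] *[of t s] by (cases "s \<le> t") (auto simp: dist_norm norm_minus_commute)
    qed (simp add: M_def)
    then show ?thesis by (rule lipschitz_on_continuous_on)
  qed
  have cont: "continuous_on {0..S} x" "continuous_on {0..S} v" if "0 \<le> S" for S
    unfolding x_def[abs_def] v_def[abs_def] using contU[OF that] by (auto intro!: continuous_intros)
  \<comment> \<open>While \<open>y\<close> remains in the ball, the truncation acts as the identity
    and the flow solves the original inclusion.\<close>
  have reg_if: "regular_solution S N x v w" if S: "0 < S" "S \<le> T" and yR: "\<And>t. t \<in> {0..S} \<Longrightarrow> norm (y t) \<le> R" for S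
    unfolding regular_solution_def
  proof (intro conjI ballI allI impI)
    show "bounded (w ` {0..S})"
    proof -
      have "norm (w t) \<le> exp (L * S) * norm (W 0)" if "t \<in> {0..S}" for t
      proof -
        have "norm (w t) \<le> norm (W t)"
          using norm_snd_le[of "snd (W t)" "fst (W t)"] by (simp add: w_def)
        also have "\<dots> \<le> exp (L * t) * norm (W 0)" using that by (intro flow) auto
        also have "\<dots> \<le> exp (L * S) * norm (W 0)" using that L_pos by (intro mult_right_mono) auto
        finally show ?thesis .
      qed
      then show ?thesis unfolding bounded_iff by blast
    qed
    show "- w t - \<gamma> *\<^sub>R v t - df (x t + \<beta> *\<^sub>R v t) \<in> subdiff \<phi> (v t)" if "t \<in> {0..S}" for t
      using W(2)[of t] radial_id[OF R yR[OF that]] that by (simp add: y_def)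
    fix t assume t: "0 < t" "t < S" "t \<notin> N"
    have U': "isCont W t" "(U has_vector_derivative W t) (at t)" using flow(6)[OF t(1,3)] by auto
    show "isCont w t" unfolding w_def[abs_def] using U'(1) by (intro continuous_intros)
    show "(x has_vector_derivative v t) (at t)"
      unfolding x_def[abs_def] using bounded_linear.has_vector_derivative[OF bounded_linear_fst U'(2)] W(1)[of t] t by simp
    show "(v has_vector_derivative w t) (at t)"
      unfolding v_def[abs_def] w_def by (rule bounded_linear.has_vector_derivative[OF bounded_linear_snd U'(2)])
  qed (use flow(1) cont S in auto)
  have v_le: "norm (v t) \<le> V" if "renergy x v t \<le> renergy x v 0" for t
  proof -
    have "(norm (v t))\<^sup>2 / 2 \<le> renergy x v 0" using renergy_lower[of v t x] that by linarith
    also have "renergy x v 0 = renergy (\<lambda>_. x0) (\<lambda>_. v0) 0" by (simp add: renergy_def init)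
    finally show ?thesis unfolding V_def by (intro real_le_rsqrt) simp
  qed
  \<comment> \<open>The bootstrap step: the bound \<open>R\<close> up to \<open>S\<close>
    legitimises the energy estimate, which returns a strict bound at \<open>S\<close>.\<close>
  have bound: "norm (y S) < R" if S: "0 \<le> S" "S \<le> T" and yR: "\<And>t. t \<in> {0..S} \<Longrightarrow> norm (y t) \<le> R" for S
  proof -
    have vb: "norm (v t) \<le> V" if t: "t \<in> {0..S}" for t
    proof (rule v_le, cases "t = 0")
      case False
      then have "regular_solution t N x v w" using t S yR by (intro reg_if) auto
      then show "renergy x v t \<le> renergy x v 0" using False t by (intro renergy_decreases) auto
    qed simp
    have "norm (x S - x 0) \<le> V * S"
    proof (cases "S = 0")
      case False
      then have "(v has_integral x S - x 0) {0..S}" using S yR by (intro x_increment[OF reg_if]) auto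
      then have "norm (x S - x 0) \<le> V * Henstock_Kurzweil_Integration.content {0..S}"
        by (rule has_integral_bound_real[OF V finite.emptyI]) (use vb in auto)
      then show ?thesis using S by simp
    qed simp
    also have "\<dots> \<le> V * T" using S V by (intro mult_left_mono)
    finally have "norm (x S) \<le> norm x0 + V * T"
      using norm_triangle_ineq[of "x S - x 0" "x 0"] by (simp add: init)
    moreover have "norm (\<beta> *\<^sub>R v S) \<le> \<beta> * V" using vb[of S] S \<beta> by (simp add: mult_left_mono)
    ultimately show ?thesis using norm_triangle_ineq[of "x S" "\<beta> *\<^sub>R v S"] by (simp add: y_def R_def)
  qed
  have cy: "continuous_on {0..S} y" if "0 \<le> S" for S
    unfolding y_def[abs_def] using that by (intro continuous_intros cont)
  have "norm (y t) \<le> R" if "t \<in> {0..T}" for t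
  proof (rule ccontr)
    assume "\<not> norm (y t) \<le> R"
    \<comment> \<open>The infimum of this closed set would be the first time at which the norm
      reaches \<open>R\<close>; continuity gives the bound \<open>R\<close> up to and including that
      time, and \<open>bound\<close> then contradicts it.\<close>
    define E where "E = {t \<in> {0..T}. R \<le> norm (y t)}"
    have E: "E \<noteq> {}" using that \<open>\<not> norm (y t) \<le> R\<close> by (auto simp: E_def)
    have "closed E" unfolding E_def using T
      by (intro continuous_on_closed_Collect_le continuous_intros cy) auto
    define s where "s = Inf E"
    have bdd: "bdd_below E" by (auto simp: E_def intro: bdd_belowI[of _ 0])
    have "s \<in> E" unfolding s_def by (rule closed_contains_Inf[OF E bdd \<open>closed E\<close>])
    then have s: "0 \<le> s" "s \<le> T" "R \<le> norm (y s)" by (auto simp: E_def)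
    have below: "norm (y \<tau>) \<le> R" if "\<tau> \<in> {0..<s}" for \<tau>
    proof (rule ccontr)
      assume "\<not> ?thesis"
      then have "\<tau> \<in> E" using that s by (auto simp: E_def)
      then have "s \<le> \<tau>" unfolding s_def by (rule cInf_lower[OF _ bdd])
      then show False using that by simp
    qed
    have "norm (y s) \<le> R"
    proof (cases "s = 0")
      case True
      then show ?thesis
      proof -
        have "norm (v 0) \<le> V" by (rule v_le) simp
        then have "norm (\<beta> *\<^sub>R v 0) \<le> \<beta> * V" using \<beta> by (simp add: mult_left_mono)
        moreover have "0 \<le> V * T" using V T by simp
        ultimately show ?thesis
          using True norm_triangle_ineq[of "x 0" "\<beta> *\<^sub>R v 0"] by (simp add: y_def R_def init)
      qed
    next
      case False
      then have cl: "closure {0..<s} = {0..s}" using s by simp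
      show ?thesis
      proof (rule continuous_le_on_closure[where S = "{0..<s}" and f = "\<lambda>t. norm (y t)"])
        show "continuous_on (closure {0..<s}) (\<lambda>t. norm (y t))"
          unfolding cl using s by (intro continuous_intros cy)
      qed (use s False cl below in auto)
    qed
    then have "norm (y s) < R" using s below by (intro bound) (auto simp: less_eq_real_def)
    then show False using s(3) by simp
  qed
  then have "regular_solution T N x v w" using T by (intro reg_if) auto
  with init show ?thesis by blast
qed

end

section \<open>Global solutions\<close>

lemma set_integrable_lebesgue_on_iff:
  fixes g :: "real \<Rightarrow> real"
  assumes "S \<in> sets lebesgue"
  shows "set_integrable lebesgue S g \<longleftrightarrow> integrable (lebesgue_on S) g"
  using assms by (simp add: set_integrable_def integrable_restrict_space)

text \<open>Monotone convergence along the intervals \<open>[0, n + 1]\<close>, whose integrals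
  share the bound \<open>B\<close>.\<close>

lemma integrable_halfline_of_bounded:
  fixes g :: "real \<Rightarrow> real"
  assumes pos: "\<And>t. 0 \<le> t \<Longrightarrow> 0 \<le> g t"
    and int: "\<And>T. 0 < T \<Longrightarrow> set_integrable lebesgue {0..T} g"
    and bd: "\<And>T. 0 < T \<Longrightarrow> (LINT t:{0..T}|lebesgue. g t) \<le> B"
  shows "set_integrable lebesgue {0..} g" "(LINT t:{0..}|lebesgue. g t) \<le> B"
proof -
  define h where "h n t = indicator {0..real (Suc n)} t *\<^sub>R g t" for n t
  have hi: "integrable lebesgue (h n)" for n
    using int[of "real (Suc n)"] unfolding set_integrable_def h_def[abs_def] by simp
  have hB: "(\<integral>t. h n t \<partial>lebesgue) \<le> B" for n
    using bd[of "real (Suc n)"] unfolding set_lebesgue_integral_def h_def[abs_def] by simp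
  have hmono: "mono (\<lambda>n. h n t)" for t
    by (rule monoI) (auto simp: h_def indicator_def pos)
  have lim: "(\<lambda>n. h n t) \<longlonglongrightarrow> indicator {0..} t *\<^sub>R g t" for t
  proof (rule tendsto_eventually)
    obtain M :: nat where M: "t \<le> real M" using real_arch_simple by blast
    show "\<forall>\<^sub>F n in sequentially. h n t = indicator {0..} t *\<^sub>R g t"
      using eventually_ge_at_top[of M] by eventually_elim (use M in \<open>auto simp: h_def indicator_def\<close>)
  qed
  have "incseq (\<lambda>n. \<integral>t. h n t \<partial>lebesgue)"
    using hmono by (intro monoI integral_mono hi) (auto simp: mono_def)
  moreover have "bdd_above (range (\<lambda>n. \<integral>t. h n t \<partial>lebesgue))"
    using hB by (intro bdd_aboveI[of _ B]) auto
  ultimately obtain x where x: "(\<lambda>n. \<integral>t. h n t \<partial>lebesgue) \<longlonglongrightarrow> x"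
    using incseq_convergent[of "\<lambda>n. \<integral>t. h n t \<partial>lebesgue" B] hB by blast
  have meas: "(\<lambda>t. indicator {0..} t *\<^sub>R g t) \<in> borel_measurable lebesgue"
    by (rule borel_measurable_LIMSEQ_real[OF lim]) (use hi in auto)
  show "set_integrable lebesgue {0..} g" unfolding set_integrable_def
    by (rule integrable_monotone_convergence[OF hi _ _ x meas]) (use hmono lim in auto)
  have "(\<integral>t. indicator {0..} t *\<^sub>R g t \<partial>lebesgue) = x"
    by (rule integral_monotone_convergence[OF hi _ _ x meas]) (use hmono lim in auto)
  then show "(LINT t:{0..}|lebesgue. g t) \<le> B"
    unfolding set_lebesgue_integral_def using LIMSEQ_le_const2[OF x, of B] hB by auto
qed

context dry_friction begin

lemma regular_solution_strong:
  assumes T: "0 < T" and sol: "regular_solution T N x v w"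
  shows "w \<in> Linf {0<..<T}" "select x v w \<in> Linf {0<..<T}" "v \<in> W1inf {0<..<T}"
    "weak_derivative {0<..<T} v w" "inclusion_ae \<gamma> \<beta> \<phi> df T x v w (select x v w)"
    "strong_solution \<gamma> \<beta> \<phi> df (x 0) (v 0) T x v"
    "t \<in> {0..T} \<Longrightarrow> (x has_vector_derivative v t) (at t within {0..T})"
proof -
  let ?I = "{0<..<T}"
  note reg = reg[OF sol T]
  have I: "?I \<in> sets lebesgue" "?I \<in> lmeasurable" by simp_all
  obtain Cw where Cw: "\<And>t. t \<in> {0..T} \<Longrightarrow> norm (w t) \<le> Cw"
    using reg(4) unfolding bounded_iff by blast
  obtain Cs where Cs: "\<And>t. t \<in> {0..T} \<Longrightarrow> norm (select x v w t) \<le> Cs"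
    using select_bounded[OF sol T] by blast
  have Linf_cont: "u \<in> Linf ?I" if u: "continuous_on {0..T} u" for u :: "real \<Rightarrow> 'a"
  proof -
    have "bounded (u ` {0..T})" by (intro compact_imp_bounded compact_continuous_image u) auto
    then obtain C where C: "\<And>t. t \<in> {0..T} \<Longrightarrow> norm (u t) \<le> C" unfolding bounded_iff by blast
    show ?thesis
      by (rule Linf_bounded_continuous_off_countable[OF I(1) countable_empty, where C = C])
        (use C isCont_inside[OF u] in auto)
  qed
  show w: "w \<in> Linf ?I"
    by (rule Linf_bounded_continuous_off_countable[OF I(1) reg(1), where C = Cw]) (use reg(6) Cw in auto)
  show s: "select x v w \<in> Linf ?I"
    by (rule Linf_bounded_continuous_off_countable[OF I(1) reg(1), where C = Cs])
      (use select_isCont[OF sol T] Cs in auto)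
  show wd: "weak_derivative ?I v w"
    by (rule weak_derivative_of_derivative_off_countable[OF reg(1) T reg(3)]) (use reg(8) in auto)
  have wdx: "weak_derivative ?I x v"
    by (rule weak_derivative_of_derivative_off_countable[OF reg(1) T reg(2)]) (use reg(7) in auto)
  show "v \<in> W1inf ?I" using Linf_cont[OF reg(3)] w wd by (auto simp: W1inf_def)
  show inc: "inclusion_ae \<gamma> \<beta> \<phi> df T x v w (select x v w)"
    unfolding inclusion_ae_def
  proof (rule AE_I2)
    fix t assume "t \<in> space (lebesgue_on ?I)"
    then show "select x v w t \<in> subdiff \<phi> (v t) \<and> w t + \<gamma> *\<^sub>R v t + select x v w t + df (x t + \<beta> *\<^sub>R v t) = 0"
      using reg(5)[of t] by (simp add: select_def)
  qed
  note L2 = Linf_imp_L2[OF I(2)]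
  show "strong_solution \<gamma> \<beta> \<phi> df (x 0) (v 0) T x v"
    unfolding strong_solution_def W12_def
    using reg(2,3) wd wdx inc L2[OF w] L2[OF s] L2[OF Linf_cont[OF reg(2)]] L2[OF Linf_cont[OF reg(3)]]
    by blast
  show "(x has_vector_derivative v t) (at t within {0..T})" if t: "t \<in> {0..T}"
  proof -
    \<comment> \<open>As a primitive of the continuous function \<open>v\<close>, the curve
      \<open>x\<close> is differentiable also at exceptional times and, one-sidedly, at the
      endpoints.\<close>
    have eq: "x s = x 0 + integral {0..s} v" if s: "s \<in> {0..T}" for s
    proof (cases "s = 0")
      case False
      then have "regular_solution s N x v w" "0 < s" using s regular_solution_subinterval[OF sol] by auto
      from integral_unique[OF x_increment[OF this]] show ?thesis by simp
    qed simp
    have "((\<lambda>s. x 0 + integral {0..s} v) has_vector_derivative v t) (at t within {0..T})"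
      using integral_has_vector_derivative[OF reg(3) t] by (auto intro!: derivative_eq_intros)
    then show ?thesis
      by (rule has_vector_derivative_transform[OF t, rotated]) (rule eq)
  qed
qed

lemma energy_eq:
  assumes "\<phi> (v t) \<noteq> \<infinity>"
  shows "energy \<gamma> \<beta> \<phi> f x v t = ereal (renergy x v t)"
  using rval[OF assms] by (simp add: energy_def renergy_def)

lemma energy_inequality:
  assumes T: "0 < T" and sol: "regular_solution T N x v w"
  shows "set_integrable lebesgue {0..T} (\<lambda>t. (norm (w t))\<^sup>2)"
    "set_integrable lebesgue {0..T} (\<lambda>t. norm (v t))"
    "renergy x v T + (\<beta> * (LINT t:{0..T}|lebesgue. (norm (w t))\<^sup>2) +
       \<gamma> * (LINT t:{0..T}|lebesgue. (norm (v t))\<^sup>2) + r * (LINT t:{0..T}|lebesgue. norm (v t))) \<le> renergy x v 0"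
proof -
  let ?I = "{0<..<T}" and ?J = "{0..T}"
  note reg = reg[OF sol T]
  have J: "?J \<in> sets lebesgue" "?J \<in> lmeasurable" by simp_all
  obtain Cw where Cw: "\<And>t. t \<in> ?J \<Longrightarrow> norm (w t) \<le> Cw" using reg(4) unfolding bounded_iff by blast
  have "bounded (v ` ?J)" by (intro compact_imp_bounded compact_continuous_image reg) auto
  then obtain Cv where Cv: "\<And>t. t \<in> ?J \<Longrightarrow> norm (v t) \<le> Cv" unfolding bounded_iff by blast
  \<comment> \<open>Two-sided continuity is known only inside the interval, so its endpoints join
    the exceptional set.\<close>
  define N' where "N' = N \<union> {0, T}"
  have N': "countable N'" using reg(1) by (simp add: N'_def)
  have wJ: "w \<in> Linf ?J"
    by (rule Linf_bounded_continuous_off_countable[OF J(1) N', where C = Cw])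
      (use reg(6) Cw in \<open>auto simp: N'_def less_le\<close>)
  have vJ: "v \<in> Linf ?J"
    by (rule Linf_bounded_continuous_off_countable[OF J(1) N', where C = Cv])
      (use isCont_inside[OF reg(3)] Cv in \<open>auto simp: N'_def less_le\<close>)
  note L2 = Linf_imp_L2[OF J(2)]
  have iw: "integrable (lebesgue_on ?J) (\<lambda>t. (norm (w t))\<^sup>2)" using L2[OF wJ] by (simp add: L2_def)
  have iv2: "integrable (lebesgue_on ?J) (\<lambda>t. (norm (v t))\<^sup>2)" using L2[OF vJ] by (simp add: L2_def)
  have iv: "integrable (lebesgue_on ?J) (\<lambda>t. norm (v t))" by (rule L2_norm_integrable[OF J(2) L2[OF vJ]])
  show "set_integrable lebesgue ?J (\<lambda>t. (norm (w t))\<^sup>2)" "set_integrable lebesgue ?J (\<lambda>t. norm (v t))"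
    using iw iv by (simp_all add: set_integrable_lebesgue_on_iff)
  have li: "integral\<^sup>L (lebesgue_on ?J) g = (LINT t:?J|lebesgue. g t)" for g :: "real \<Rightarrow> real"
    by (simp add: set_lebesgue_integral_def integral_restrict_space)
  have "((\<lambda>t. \<beta> * (norm (w t))\<^sup>2 + \<gamma> * (norm (v t))\<^sup>2 + r * norm (v t)) has_integral
      \<beta> * (LINT t:?J|lebesgue. (norm (w t))\<^sup>2) + \<gamma> * (LINT t:?J|lebesgue. (norm (v t))\<^sup>2) + r * (LINT t:?J|lebesgue. norm (v t))) ?J"
    unfolding li[symmetric]
    by (intro has_integral_add has_integral_mult_right has_integral_integral_lebesgue_on iw iv2 iv J)
  then have "\<beta> * (LINT t:?J|lebesgue. (norm (w t))\<^sup>2) + \<gamma> * (LINT t:?J|lebesgue. (norm (v t))\<^sup>2)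
      + r * (LINT t:?J|lebesgue. norm (v t)) \<le> renergy x v 0 - renergy x v T"
    by (rule has_integral_le[OF _ renergy_integral[OF sol T]]) (use dissipation_lower[OF sol T] in simp)
  then show "renergy x v T + (\<beta> * (LINT t:?J|lebesgue. (norm (w t))\<^sup>2) +
       \<gamma> * (LINT t:?J|lebesgue. (norm (v t))\<^sup>2) + r * (LINT t:?J|lebesgue. norm (v t))) \<le> renergy x v 0"
    by linarith
qed

text \<open>Solutions on \<open>[0, n + 1]\<close> are glued. Uniqueness makes positions and
  velocities agree on overlaps; accelerations are not compared, and \<open>w\<close> simply follows
  the piece selected by the integer part of the time.\<close>

lemma ex_global_regular_solution:
  assumes v0: "subdiff \<phi> v0 \<noteq> {}"
  obtains N x v w where "\<And>T. 0 < T \<Longrightarrow> regular_solution T N x v w" "x 0 = x0" "v 0 = v0"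
proof -
  have "\<exists>N x v w. regular_solution (real (Suc n)) N x v w \<and> x 0 = x0 \<and> v 0 = v0" for n
    by (rule ex_regular_solution[OF v0]) simp
  then obtain Ns xs vs ws where s: "\<And>n. regular_solution (real (Suc n)) (Ns n) (xs n) (vs n) (ws n)"
    "\<And>n. xs n 0 = x0" "\<And>n. vs n 0 = v0" by metis
  have agree: "xs m t = xs n t \<and> vs m t = vs n t" if t: "0 \<le> t" "t < real (Suc m)" and mn: "m \<le> n" for m n t
  proof -
    have T: "0 < real (Suc m)" by simp
    have "regular_solution (real (Suc m)) (Ns n) (xs n) (vs n) (ws n)"
      by (rule regular_solution_subinterval[OF s(1)]) (use mn in simp)
    from regular_solution_strong(6)[OF T this] regular_solution_strong(6)[OF T s(1)[of m]]
    show ?thesis unfolding s(2,3) using strong_solution_unique[OF T _ _ t] by blast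
  qed
  define k where "k t = nat \<lfloor>t::real\<rfloor>" for t
  have k: "real (k t) \<le> t" "t < real (Suc (k t))" if "0 \<le> t" for t
    using that by (simp_all add: k_def) linarith+
  define x v w where "x t = xs (k t) t" and "v t = vs (k t) t" and "w t = ws (k t) t" for t
  \<comment> \<open>The selected piece changes at integer times, where \<open>w\<close> may jump.
    Away from them all three functions come locally from a single piece.\<close>
  define N where "N = (\<Union>n. Ns n) \<union> range real"
  have eq: "x t = xs n t" "v t = vs n t" if "0 \<le> t" "t < real (Suc n)" for t n
  proof -
    have "k t \<le> n" using k[OF that(1)] that by linarith
    then show "x t = xs n t" "v t = vs n t" using agree[OF that(1) k(2)[OF that(1)]] by (auto simp: x_def v_def)
  qed
  have N: "countable N" unfolding N_def using s(1) by (auto simp: regular_solution_def)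
  have main: "regular_solution T N x v w" if T: "0 < T" for T
  proof -
    define n where "n = k T"
    have n: "T < real (Suc n)" using k(2)[of T] T by (simp add: n_def)
    have en: "x t = xs n t" "v t = vs n t" if "t \<in> {0..T}" for t using eq[of t n] that n by auto
    have sn: "regular_solution T (Ns n) (xs n) (vs n) (ws n)"
      using n by (intro regular_solution_subinterval[OF s(1)]) simp
    show ?thesis
      unfolding regular_solution_def
    proof (intro conjI ballI allI impI N)
      show "continuous_on {0..T} x"
        using sn en by (subst continuous_on_cong[OF refl, of _ x "xs n"]) (auto simp: regular_solution_def)
      show "continuous_on {0..T} v"
        using sn en by (subst continuous_on_cong[OF refl, of _ v "vs n"]) (auto simp: regular_solution_def)
      \<comment> \<open>Only the finitely many pieces with index at most \<open>n\<close> occur up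
        to time \<open>T\<close>.\<close>
      have "w ` {0..T} \<subseteq> (\<Union>m\<le>n. ws m ` {0..real (Suc m)})"
      proof
        fix z assume "z \<in> w ` {0..T}"
        then obtain t where t: "0 \<le> t" "t \<le> T" "z = ws (k t) t" by (auto simp: w_def)
        then have "k t \<le> n" using k[OF t(1)] n by linarith
        then show "z \<in> (\<Union>m\<le>n. ws m ` {0..real (Suc m)})" using t k(2)[OF t(1)]
          by (intro UN_I[of "k t"]) auto
      qed
      moreover have "bounded (\<Union>m\<le>n. ws m ` {0..real (Suc m)})"
        using s(1) by (intro bounded_UN) (auto simp: regular_solution_def)
      ultimately show "bounded (w ` {0..T})" using bounded_subset by blast
      show "- w t - \<gamma> *\<^sub>R v t - df (x t + \<beta> *\<^sub>R v t) \<in> subdiff \<phi> (v t)" if t: "t \<in> {0..T}" for t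
        unfolding x_def v_def w_def using s(1)[of "k t"] k[of t] t
        unfolding regular_solution_def by simp
      fix t assume t: "0 < t" "t < T" "t \<notin> N"
      define m where "m = k t"
      have "real m \<noteq> t" using t(3) by (auto simp: N_def)
      then have m: "real m < t" "t < real (Suc m)" using k[of t] t(1) by (auto simp: m_def)
      have tN: "t \<notin> Ns m" using t(3) by (auto simp: N_def)
      let ?S = "{real m<..<real (Suc m)}"
      have S: "open ?S" "t \<in> ?S" using m by auto
      have near: "x s = xs m s" "v s = vs m s" "w s = ws m s" if "s \<in> ?S" for s
      proof -
        have "\<lfloor>s\<rfloor> = int m" using that by (simp add: floor_eq_iff)
        then have "k s = m" by (simp add: k_def)
        then show "x s = xs m s" "v s = vs m s" "w s = ws m s" by (simp_all add: x_def v_def w_def)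
      qed
      have d: "isCont (ws m) t" "(xs m has_vector_derivative vs m t) (at t)" "(vs m has_vector_derivative ws m t) (at t)"
        using s(1)[of m] t(1) m(2) tN by (auto simp: regular_solution_def)
      have at: "x t = xs m t" "v t = vs m t" "w t = ws m t" by (auto simp: x_def v_def w_def m_def)
      show "isCont w t"
        using d(1) S near by (subst isCont_cong[of _ "ws m"]) (auto intro!: eventually_nhds[THEN iffD2])
      show "(x has_vector_derivative v t) (at t)"
        unfolding at by (rule has_vector_derivative_transform_within_open[OF d(2) S]) (simp add: near)
      show "(v has_vector_derivative w t) (at t)"
        unfolding at by (rule has_vector_derivative_transform_within_open[OF d(3) S]) (simp add: near)
    qed
  qed
  show ?thesis
    by (rule that[OF main]) (use eq[of 0 0] s(2,3) in auto)
qed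

end

theorem theorem2p6:
  fixes \<gamma> \<beta> r :: real
    and f :: "'a::{real_inner,banach} \<Rightarrow> real"
    and df :: "'a \<Rightarrow> 'a"
    and \<phi> :: "'a \<Rightarrow> ereal"
    and x0 v0 :: 'a
  assumes "\<gamma> > 0" and "\<beta> \<ge> 0"
    and "\<And>z. GDERIV f z :> df z" and "continuous_on UNIV df"
    and "\<And>B. bounded B \<Longrightarrow> \<exists>L. L-lipschitz_on B df"
    and "bdd_below (range f)"
    and "proper \<phi>" and "lsc \<phi>" and "ereal_convex \<phi>"
    and "\<phi> 0 = 0" and "\<And>z. 0 \<le> \<phi> z"
    and "r > 0" and "cball 0 r \<subseteq> subdiff \<phi> 0"
    and "v0 \<in> Dom_subdiff \<phi> \<or> ((\<forall>z. \<phi> z \<noteq> \<infinity>) \<and> continuous_on UNIV \<phi>)"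
  shows "\<exists>x v.
    global_strong_solution \<gamma> \<beta> \<phi> df x0 v0 x v \<and>
    (\<forall>x' v'. global_strong_solution \<gamma> \<beta> \<phi> df x0 v0 x' v' \<longrightarrow>
       (\<forall>t\<ge>0. x' t = x t \<and> v' t = v t)) \<and>
    (\<exists>w \<xi>.
       (\<forall>T>0.
          (\<forall>t\<in>{0..T}. (x has_vector_derivative v t) (at t within {0..T})) \<and>
          continuous_on {0..T} v \<and>
          v \<in> W1inf {0<..<T} \<and> weak_derivative {0<..<T} v w \<and> w \<in> Linf {0<..<T} \<and>
          \<xi> \<in> Linf {0<..<T} \<and>
          inclusion_ae \<gamma> \<beta> \<phi> df T x v w \<xi>) \<and>
       (\<forall>t\<ge>0. \<bar>energy \<gamma> \<beta> \<phi> f x v t\<bar> \<noteq> \<infinity>) \<and>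
       (AE t in lebesgue_on {0<..}.
          \<exists>E'. ((\<lambda>s. real_of_ereal (energy \<gamma> \<beta> \<phi> f x v s)) has_real_derivative E') (at t) \<and>
               E' + \<beta> * (norm (w t))\<^sup>2 + \<gamma> * (norm (v t))\<^sup>2 + \<xi> t \<bullet> v t = 0) \<and>
       (\<forall>T>0.
          energy \<gamma> \<beta> \<phi> f x v T +
          ereal (\<beta> * (LINT t:{0..T}|lebesgue. (norm (w t))\<^sup>2) +
                 \<gamma> * (LINT t:{0..T}|lebesgue. (norm (v t))\<^sup>2) +
                 r * (LINT t:{0..T}|lebesgue. norm (v t)))
          \<le> energy \<gamma> \<beta> \<phi> f x v 0) \<and>
       set_integrable lebesgue {0..} (\<lambda>t. norm (v t)) \<and>
       ereal (LINT t:{0..}|lebesgue. norm (v t)) \<le> energy \<gamma> \<beta> \<phi> f x v 0 / ereal r \<and>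
       (\<beta> > 0 \<longrightarrow> w \<in> L2 {0<..}))"
proof -
  interpret dry_friction \<phi> \<gamma> \<beta> r f df by standard (fact assms)+
  let "\<exists>x v. ?global x v \<and> ?unique x v \<and> (\<exists>w \<xi>. ?props x v w \<xi>)" = ?thesis
  have v0: "subdiff \<phi> v0 \<noteq> {}"
    using assms(14) subdiff_continuous_nonempty by (auto simp: Dom_subdiff_def)
  obtain N x v w where sol: "\<And>T. 0 < T \<Longrightarrow> regular_solution T N x v w" and init: "x 0 = x0" "v 0 = v0"
    using ex_global_regular_solution[OF v0] by blast
  note strong = regular_solution_strong[OF _ sol]
  have N: "countable N" using sol[of 1] by (simp add: regular_solution_def)
  have fin: "\<phi> (v t) \<noteq> \<infinity>" if "0 \<le> t" for t
    using v_dom[OF sol[of "t + 1"], of t] that by simp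
  have en: "energy \<gamma> \<beta> \<phi> f x v t = ereal (renergy x v t)" if "0 \<le> t" for t by (rule energy_eq) (rule fin[OF that])
  have ineq: "renergy x v T + (\<beta> * (LINT t:{0..T}|lebesgue. (norm (w t))\<^sup>2) +
       \<gamma> * (LINT t:{0..T}|lebesgue. (norm (v t))\<^sup>2) + r * (LINT t:{0..T}|lebesgue. norm (v t))) \<le> renergy x v 0"
    and si: "set_integrable lebesgue {0..T} (\<lambda>t. (norm (w t))\<^sup>2)" "set_integrable lebesgue {0..T} (\<lambda>t. norm (v t))"
    if "0 < T" for T
    using energy_inequality[OF that sol[OF that]] by auto
  have nn: "0 \<le> renergy x v T" for T
    by (rule order_trans[OF _ renergy_lower]) simp
  have pos: "0 \<le> (LINT t:S|lebesgue. (norm (w t))\<^sup>2)" "0 \<le> (LINT t:S|lebesgue. (norm (v t))\<^sup>2)"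
    "0 \<le> (LINT t:S|lebesgue. norm (v t))" for S
    unfolding set_lebesgue_integral_def by (auto intro!: Bochner_Integration.integral_nonneg)
  have dv: "(LINT t:{0..T}|lebesgue. norm (v t)) \<le> renergy x v 0 / r" if "0 < T" for T
  proof -
    have "r * (LINT t:{0..T}|lebesgue. norm (v t)) \<le> renergy x v 0"
      using ineq[OF that] nn[of T] mult_nonneg_nonneg[OF \<beta> pos(1)[of "{0..T}"]]
        mult_nonneg_nonneg[OF less_imp_le[OF \<gamma>] pos(2)[of "{0..T}"]] by linarith
    then show ?thesis using r by (simp add: pos_le_divide_eq mult.commute)
  qed
  \<comment> \<open>Dropping the other dissipation terms leaves \<open>\<beta>\<close> times the
    integral; dividing by \<open>\<beta>\<close> is where its positivity enters.\<close>
  have dw: "(LINT t:{0..T}|lebesgue. (norm (w t))\<^sup>2) \<le> renergy x v 0 / \<beta>" if "0 < T" "0 < \<beta>" for T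
  proof -
    have "\<beta> * (LINT t:{0..T}|lebesgue. (norm (w t))\<^sup>2) \<le> renergy x v 0"
      using ineq[OF that(1)] nn[of T] mult_nonneg_nonneg[OF less_imp_le[OF r] pos(3)[of "{0..T}"]]
        mult_nonneg_nonneg[OF less_imp_le[OF \<gamma>] pos(2)[of "{0..T}"]] by linarith
    then show ?thesis using that by (simp add: pos_le_divide_eq mult.commute)
  qed
  note hv = integrable_halfline_of_bounded[of "\<lambda>t. norm (v t)", OF _ si(2) dv]
  have glob: "?global x v"
    unfolding global_strong_solution_def using strong(6) init by auto
  have "?unique x v"
  proof (intro allI impI conjI)
    fix x' v' and t :: real
    assume g': "global_strong_solution \<gamma> \<beta> \<phi> df x0 v0 x' v'" and t: "0 \<le> t"
    \<comment> \<open>Uniqueness on \<open>[0, T]\<close> is available strictly before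
      \<open>T\<close>, so the horizon is moved past \<open>t\<close>.\<close>
    have T: "0 < t + 1" using t by simp
    show "x' t = x t" "v' t = v t"
      using strong_solution_unique[OF T, of x0 v0 x' v' x v t] g' glob T t
      unfolding global_strong_solution_def by auto
  qed
  moreover have "?props x v w (select x v w)"
  proof (intro conjI allI impI ballI)
    fix T :: real assume T: "T > 0"
    show "(x has_vector_derivative v t) (at t within {0..T})" if "t \<in> {0..T}" for t
      using strong(7)[OF T T that] .
    show "continuous_on {0..T} v" using sol[OF T] by (simp add: regular_solution_def)
    show "v \<in> W1inf {0<..<T}" "weak_derivative {0<..<T} v w" "w \<in> Linf {0<..<T}"
      "select x v w \<in> Linf {0<..<T}" "inclusion_ae \<gamma> \<beta> \<phi> df T x v w (select x v w)"
      using strong[OF T T] by auto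
    show "energy \<gamma> \<beta> \<phi> f x v T + ereal (\<beta> * (LINT t:{0..T}|lebesgue. (norm (w t))\<^sup>2) +
                 \<gamma> * (LINT t:{0..T}|lebesgue. (norm (v t))\<^sup>2) +
                 r * (LINT t:{0..T}|lebesgue. norm (v t)))
          \<le> energy \<gamma> \<beta> \<phi> f x v 0"
      using ineq[OF T] T by (simp add: en)
  next
    fix t :: real assume "t \<ge> 0"
    then show "\<bar>energy \<gamma> \<beta> \<phi> f x v t\<bar> \<noteq> \<infinity>" by (simp add: en)
  next
    show "AE t in lebesgue_on {0<..}.
          \<exists>E'. ((\<lambda>s. real_of_ereal (energy \<gamma> \<beta> \<phi> f x v s)) has_real_derivative E') (at t) \<and>
               E' + \<beta> * (norm (w t))\<^sup>2 + \<gamma> * (norm (v t))\<^sup>2 + select x v w t \<bullet> v t = 0"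
    proof (rule AE_lebesgue_onI_countable[OF _ N])
      fix t :: real assume t: "t \<in> {0<..}" "t \<notin> N"
      then have T: "0 < t + 1" by simp
      have "(renergy x v has_real_derivative
          - (\<beta> * (norm (w t))\<^sup>2 + \<gamma> * (norm (v t))\<^sup>2 + select x v w t \<bullet> v t)) (at t)"
        using renergy_derivative[OF sol[OF T] T, of t] t by simp
      \<comment> \<open>The two energies are identified at nonnegative times, hence in a
        neighbourhood of each positive \<open>t\<close>.\<close>
      moreover have "\<forall>\<^sub>F s in nhds t. renergy x v s = real_of_ereal (energy \<gamma> \<beta> \<phi> f x v s)"
      proof -
        have "\<forall>\<^sub>F s in nhds t. s \<in> {0<..}" using t by (intro eventually_nhds_in_open) auto
        then show ?thesis by eventually_elim (simp add: en)
      qed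
      ultimately have "((\<lambda>s. real_of_ereal (energy \<gamma> \<beta> \<phi> f x v s)) has_real_derivative
          - (\<beta> * (norm (w t))\<^sup>2 + \<gamma> * (norm (v t))\<^sup>2 + select x v w t \<bullet> v t)) (at t)"
        by (subst (asm) DERIV_cong_ev[OF refl _ refl])
      then show "\<exists>E'. ((\<lambda>s. real_of_ereal (energy \<gamma> \<beta> \<phi> f x v s)) has_real_derivative E') (at t) \<and>
               E' + \<beta> * (norm (w t))\<^sup>2 + \<gamma> * (norm (v t))\<^sup>2 + select x v w t \<bullet> v t = 0"
        by (intro exI conjI) (assumption, simp)
    qed simp
  next
    show "set_integrable lebesgue {0..} (\<lambda>t. norm (v t))" by (rule hv) auto
    have "(LINT t:{0..}|lebesgue. norm (v t)) \<le> renergy x v 0 / r" by (rule hv) auto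
    then show "ereal (LINT t:{0..}|lebesgue. norm (v t)) \<le> energy \<gamma> \<beta> \<phi> f x v 0 / ereal r"
      using r by (simp add: en)
  next
    assume \<beta>: "\<beta> > 0"
    have S: "{0<..} \<in> sets (lebesgue :: real measure)" by simp
    have cont: "isCont w t" if "t \<in> {0<..}" "t \<notin> N" for t
      using sol[of "t + 1"] that by (simp add: regular_solution_def)
    have "set_integrable lebesgue {0..} (\<lambda>t. (norm (w t))\<^sup>2)"
      by (rule integrable_halfline_of_bounded[OF _ si(1) dw]) (use \<beta> in auto)
    then have "set_integrable lebesgue {0<..} (\<lambda>t. (norm (w t))\<^sup>2)"
      by (rule set_integrable_subset) auto
    then have "integrable (lebesgue_on {0<..}) (\<lambda>t. (norm (w t))\<^sup>2)"
      by (simp add: set_integrable_lebesgue_on_iff)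
    then show "w \<in> L2 {0<..}"
      unfolding L2_def using strongly_measurable_on_continuous_off_countable[OF S N cont] by simp
  qed
  ultimately show ?thesis using glob by blast
qed

end
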